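(* Let $W\subset \mathrm{GL}(E)$ be a finite complex reflection group with set of reflections $\mathcal{R}$, let $V$ be a finite-dimensional complex vector space with a linear action of $W$, and let $t_s\in\mathfrak{gl}(V)$ $(s\in\mathcal{R})$ be such that the 1-form $\omega=h\sum_{s\in\mathcal{R}}t_s\,\omega_s$ on $X$ is integrable and $W$-equivariant. Let $W_0$ be a parabolic subgroup of $W$ with set of reflections $\mathcal{R}_0=\mathcal{R}\cap W_0$, let $\omega_0=h\sum_{s\in\mathcal{R}_0}t_s\,\omega_s$ be the corresponding integrable 1-form on $X_0$, and let $B_0=\pi_1(X_0/W_0)$ be embedded in $B=\pi_1(X/W)$ by the natural embedding described in the context. Then the restriction to $B_0$ of the monodromy representation of $\omega$ is isomorphic to the monodromy representation of $\omega_0$.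
   Context: $E$ is a finite-dimensional complex vector space. A reflection is an element $s\in \mathrm{GL}(E)$ with $s^2=1$ and $\mathrm{Ker}(s-1)$ a hyperplane; a finite complex reflection group is a finite subgroup $W\subset\mathrm{GL}(E)$ generated by reflections, and $\mathcal{R}$ is the set of reflections in $W$. $\mathcal{A}=\{\mathrm{Ker}(s-1): s\in\mathcal{R}\}$, $X=E\setminus\bigcup\mathcal{A}$, $P=\pi_1(X)$, $B=\pi_1(X/W)$. For $s\in\mathcal{R}$, $\omega_s=\frac{1}{\mathrm{i}\pi}\,\mathrm{d}b_s/b_s$ where $b_s$ is a linear form on $E$ with kernel $\mathrm{Ker}(s-1)$. Let $h$ be a formal parameter, $A=\mathbb{C}[[h]]$, $K=\mathbb{C}((h))$. Integrable means $\left(\sum_s t_s\omega_s\right)\wedge\left(\sum_s t_s\omega_s\right)=0$; $W$-equivariant means $w t_s w^{-1}=t_{wsw^{-1}}$ in $\mathrm{End}(V)$ for all $w\in W$, $s\in\mathcal{R}$. Monodromy: fix a base point $\underline{z}\in X$. For a path $\gamma$ in $X$ starting at $\underline{z}$, let $T_\gamma\in \mathrm{GL}(V\otimes A)$ be the endpoint value of the solution along $\gamma$ of $\mathrm{d}F=\omega F$ with $F(\underline{z})=\mathrm{Id}$. An element of $B$ is represented by a path $\gamma$ in $X$ from $\underline{z}$ to $w^{-1}\underline{z}$ for some $w\in W$, and its image under the monodromy representation $B\to\mathrm{GL}(V\otimes K)$ is $wT_\gamma$ (products of paths being read from right to left so that this is a homomorphism). The monodromy representation of $\omega_0$ is the analogous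 representation of $B_0$, defined with $X_0$, $W_0$, $\omega_0$. A parabolic subgroup $W_0$ is the pointwise stabilizer in $W$ of a proper subspace $I\subset E$; it is generated by the set $\mathcal{R}_0$ of reflections of $W$ whose hyperplane contains $I$. $\mathcal{A}_0=\{H\in\mathcal{A}: H\supset I\}$ and $X_0=E\setminus\bigcup\mathcal{A}_0$, $P_0=\pi_1(X_0)$, $B_0=\pi_1(X_0/W_0)$. Embedding $B_0\to B$: choose a $W$-invariant Hermitian norm on $E$, a point $x_1\in I$ lying on no $H\in\mathcal{A}\setminus\mathcal{A}_0$, $\epsilon>0$ such that the ball $\Omega=\{x: \|x-x_1\|\le\epsilon\}$ meets no $H\in\mathcal{A}\setminus\mathcal{A}_0$, and $x_2\in X$ with $\|x_2-x_1\|<\epsilon$. Then $\pi_1(X\cap\Omega,x_2)\to\pi_1(X_0,x_2)$ is an isomorphism, and composing its inverse with $\pi_1(X\cap\Omega,x_2)\to\pi_1(X,x_2)$ gives an embedding $P_0\to P$. As $\Omega$ is stable under $W_0$, it extends in the same way (using $(X\cap\Omega)/W_0$) to an embedding $B_0\to B$. These embeddings are well defined up to $P$-conjugation. *)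

theory Defs
  imports
    "HOL-Analysis.Analysis"
    "HOL-Algebra.Generated_Groups"
    "HOL-Computational_Algebra.Formal_Laurent_Series"
begin

section \<open>Complex reflection groups and parabolic subgroups\<close>

definition GL :: "('a::field ^ 'n ^ 'n) monoid" where
  "GL = \<lparr>carrier = {A. invertible A}, mult = (**), one = mat 1\<rparr>"

definition fixed_space :: "complex ^ 'n ^ 'n \<Rightarrow> (complex ^ 'n) set" where
  "fixed_space s = {x. s *v x = x}"

definition is_hyperplane :: "(complex ^ 'n) set \<Rightarrow> bool" where
  "is_hyperplane H \<longleftrightarrow> vec.subspace H \<and> vec.dim H + 1 = CARD('n)"

definition is_reflection :: "complex ^ 'n ^ 'n \<Rightarrow> bool" where
  "is_reflection s \<longleftrightarrow> s ** s = mat 1 \<and> is_hyperplane (fixed_space s)"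

definition refls :: "(complex ^ 'n ^ 'n) set \<Rightarrow> (complex ^ 'n ^ 'n) set" where
  "refls W = {s \<in> W. is_reflection s}"

definition reflection_group :: "(complex ^ 'n ^ 'n) set \<Rightarrow> bool" where
  "reflection_group W \<longleftrightarrow> finite W \<and> subgroup W GL \<and> generate GL (refls W) = W"

definition arrangement :: "(complex ^ 'n ^ 'n) set \<Rightarrow> (complex ^ 'n) set set" where
  "arrangement W = fixed_space ` refls W"

definition parabolic :: "(complex ^ 'n ^ 'n) set \<Rightarrow> (complex ^ 'n) set \<Rightarrow> (complex ^ 'n ^ 'n) set" where
  "parabolic W I = {w \<in> W. \<forall>x\<in>I. w *v x = x}"

definition linear_form :: "(complex ^ 'n \<Rightarrow> complex) \<Rightarrow> bool" where
  "linear_form b \<longleftrightarrow> Vector_Spaces.linear (*s) (*) b"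

text \<open>Hermitian inner products are linear in the first argument.\<close>

definition hermitian_inner :: "(complex ^ 'n \<Rightarrow> complex ^ 'n \<Rightarrow> complex) \<Rightarrow> bool" where
  "hermitian_inner B \<longleftrightarrow>
     (\<forall>y. linear_form (\<lambda>x. B x y)) \<and> (\<forall>x y. B y x = cnj (B x y)) \<and> (\<forall>x. x \<noteq> 0 \<longrightarrow> Re (B x x) > 0)"

definition hermitian_norm :: "(complex ^ 'n \<Rightarrow> complex ^ 'n \<Rightarrow> complex) \<Rightarrow> complex ^ 'n \<Rightarrow> real" where
  "hermitian_norm B x = sqrt (Re (B x x))"


section \<open>Orbit spaces\<close>

definition orbit_of :: "(complex ^ 'n ^ 'n) set \<Rightarrow> complex ^ 'n \<Rightarrow> (complex ^ 'n) set" where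
  "orbit_of W x = (\<lambda>w. w *v x) ` W"

definition orbit_space :: "(complex ^ 'n ^ 'n) set \<Rightarrow> (complex ^ 'n) set \<Rightarrow> (complex ^ 'n) set topology" where
  "orbit_space W S = topology (\<lambda>U. U \<subseteq> orbit_of W ` S \<and> openin (top_of_set S) {x \<in> S. orbit_of W x \<in> U})"

lemma openin_orbit_space:
  "openin (orbit_space W S) U \<longleftrightarrow>
     U \<subseteq> orbit_of W ` S \<and> openin (top_of_set S) {x \<in> S. orbit_of W x \<in> U}"
proof -
  have "istopology (\<lambda>U. U \<subseteq> orbit_of W ` S \<and> openin (top_of_set S) {x \<in> S. orbit_of W x \<in> U})"
    unfolding istopology_def
  proof (intro conjI allI impI)
    fix A B
    assume A: "A \<subseteq> orbit_of W ` S \<and> openin (top_of_set S) {x \<in> S. orbit_of W x \<in> A}"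
      and B: "B \<subseteq> orbit_of W ` S \<and> openin (top_of_set S) {x \<in> S. orbit_of W x \<in> B}"
    have "{x \<in> S. orbit_of W x \<in> A \<inter> B} = {x \<in> S. orbit_of W x \<in> A} \<inter> {x \<in> S. orbit_of W x \<in> B}"
      by auto
    moreover have "openin (top_of_set S) ({x \<in> S. orbit_of W x \<in> A} \<inter> {x \<in> S. orbit_of W x \<in> B})"
      using A B by (intro openin_Int) auto
    ultimately show "openin (top_of_set S) {x \<in> S. orbit_of W x \<in> A \<inter> B}"
      by (simp only:)
    show "A \<inter> B \<subseteq> orbit_of W ` S" using A by blast
  next
    fix \<K>
    assume K: "\<forall>K\<in>\<K>. K \<subseteq> orbit_of W ` S \<and> openin (top_of_set S) {x \<in> S. orbit_of W x \<in> K}"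
    have "{x \<in> S. orbit_of W x \<in> \<Union>\<K>} = (\<Union>K\<in>\<K>. {x \<in> S. orbit_of W x \<in> K})" by auto
    moreover have "openin (top_of_set S) (\<Union>K\<in>\<K>. {x \<in> S. orbit_of W x \<in> K})"
      using K by (intro openin_Union) auto
    ultimately show "openin (top_of_set S) {x \<in> S. orbit_of W x \<in> \<Union>\<K>}"
      by (simp only:)
    show "\<Union>\<K> \<subseteq> orbit_of W ` S" using K by blast
  qed
  then show ?thesis by (simp add: orbit_space_def)
qed

lemma quotient_map_orbit_of: "quotient_map (top_of_set S) (orbit_space W S) (orbit_of W)"
proof -
  have "{x \<in> S. orbit_of W x \<in> orbit_of W ` S} = S" by blast
  then have "openin (orbit_space W S) (orbit_of W ` S)"
    by (simp add: openin_orbit_space)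
  then have "orbit_of W ` S \<subseteq> topspace (orbit_space W S)"
    by (rule openin_subset)
  moreover have "topspace (orbit_space W S) \<subseteq> orbit_of W ` S"
    using openin_topspace [of "orbit_space W S"] unfolding openin_orbit_space by (rule conjunct1)
  ultimately have "topspace (orbit_space W S) = orbit_of W ` S"
    by (rule subset_antisym [rotated])
  then show ?thesis
    by (simp add: quotient_map_def openin_orbit_space)
qed

text \<open>For \<open>W0 \<subseteq> W\<close>, the map sending the \<open>W0\<close>-orbit of a point to its \<open>W\<close>-orbit.\<close>

definition orbit_map :: "(complex ^ 'n ^ 'n) set \<Rightarrow> (complex ^ 'n) set \<Rightarrow> (complex ^ 'n) set" where
  "orbit_map W c = (\<Union>x\<in>c. orbit_of W x)"


section \<open>Fundamental groups of abstract topological spaces\<close>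

text \<open>
  Elements are sets of functions on \<open>real\<close>; values outside \<open>{0..1}\<close> are irrelevant, since two
  paths that agree on \<open>{0..1}\<close> lie in the same class. The library's \<open>homotopic_paths\<close> and
  \<open>joinpaths\<close> only apply to subsets of types of class \<open>topological_space\<close>.
\<close>

definition homotopic_pathsin :: "'a topology \<Rightarrow> (real \<Rightarrow> 'a) \<Rightarrow> (real \<Rightarrow> 'a) \<Rightarrow> bool" where
  "homotopic_pathsin T p q \<longleftrightarrow>
     homotopic_with (\<lambda>r. r 0 = p 0 \<and> r 1 = p 1) (top_of_set {0..1}) T p q"

definition path_class :: "'a topology \<Rightarrow> (real \<Rightarrow> 'a) \<Rightarrow> (real \<Rightarrow> 'a) set" where
  "path_class T p = {q. homotopic_pathsin T p q}"

definition concat_paths :: "(real \<Rightarrow> 'a) \<Rightarrow> (real \<Rightarrow> 'a) \<Rightarrow> real \<Rightarrow> 'a" where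
  "concat_paths p q = (\<lambda>t. if t \<le> 1/2 then p (2 * t) else q (2 * t - 1))"

text \<open>Products are read from right to left: \<open>a \<otimes> b\<close> runs through \<open>b\<close> first.\<close>

definition fundamental_group :: "'a topology \<Rightarrow> 'a \<Rightarrow> (real \<Rightarrow> 'a) set monoid" where
  "fundamental_group T z =
     \<lparr>carrier = {path_class T p | p. pathin T p \<and> p 0 = z \<and> p 1 = z},
      mult = (\<lambda>a b. \<Union>p\<in>a. \<Union>q\<in>b. path_class T (concat_paths q p)),
      one = path_class T (\<lambda>_. z)\<rparr>"

definition induced_map :: "'b topology \<Rightarrow> ('a \<Rightarrow> 'b) \<Rightarrow> (real \<Rightarrow> 'a) set \<Rightarrow> (real \<Rightarrow> 'b) set" where
  "induced_map T f c = (\<Union>p\<in>c. path_class T (f \<circ> p))"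

text \<open>The isomorphism from the group based at \<open>d 0\<close> to the group based at \<open>d 1\<close> given by a path \<open>d\<close>.\<close>

definition change_base :: "'a topology \<Rightarrow> (real \<Rightarrow> 'a) \<Rightarrow> (real \<Rightarrow> 'a) set \<Rightarrow> (real \<Rightarrow> 'a) set" where
  "change_base T d c =
     (\<Union>p\<in>c. path_class T (concat_paths (\<lambda>t. d (1 - t)) (concat_paths p d)))"

text \<open>
  The embedding of \<open>\<pi>\<^sub>1(X0/W0)\<close> into \<open>\<pi>\<^sub>1(X/W)\<close>, based at the orbits of \<open>x2 \<in> X \<inter> \<Omega>\<close>: the inverse of
  the isomorphism \<open>\<pi>\<^sub>1((X \<inter> \<Omega>)/W0) \<rightarrow> \<pi>\<^sub>1(X0/W0)\<close>, followed by \<open>\<pi>\<^sub>1((X \<inter> \<Omega>)/W0) \<rightarrow> \<pi>\<^sub>1(X/W)\<close>. The space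
  \<open>(X \<inter> \<Omega>)/W0\<close> includes into \<open>X0/W0\<close> by the identity on orbits.
\<close>

definition local_embedding ::
  "(complex ^ 'n ^ 'n) set \<Rightarrow> (complex ^ 'n) set \<Rightarrow> (complex ^ 'n ^ 'n) set \<Rightarrow> (complex ^ 'n) set \<Rightarrow>
   (complex ^ 'n) set \<Rightarrow> complex ^ 'n \<Rightarrow>
   (real \<Rightarrow> (complex ^ 'n) set) set \<Rightarrow> (real \<Rightarrow> (complex ^ 'n) set) set" where
  "local_embedding W X W0 X0 \<Omega> x2 =
     induced_map (orbit_space W X) (orbit_map W) \<circ>
     inv_into (carrier (fundamental_group (orbit_space W0 (X \<inter> \<Omega>)) (orbit_of W0 x2)))
       (induced_map (orbit_space W0 X0) (\<lambda>c. c))"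


section \<open>Connections and monodromy\<close>

text \<open>
  A 1-form on an open set of \<open>E\<close> is a function of a point \<open>x\<close> and a tangent vector \<open>v\<close>. The
  differential of a linear form \<open>b\<close> is \<open>b\<close> itself.
\<close>

definition log_form :: "(complex ^ 'n \<Rightarrow> complex) \<Rightarrow> complex ^ 'n \<Rightarrow> complex ^ 'n \<Rightarrow> complex" where
  "log_form b x v = (1 / (\<i> * of_real pi)) * (b v / b x)"

definition residue_form ::
  "('s \<Rightarrow> complex ^ 'n \<Rightarrow> complex) \<Rightarrow> ('s \<Rightarrow> complex ^ 'm ^ 'm) \<Rightarrow> 's set \<Rightarrow>
   complex ^ 'n \<Rightarrow> complex ^ 'n \<Rightarrow> complex ^ 'm ^ 'm" where
  "residue_form b t R x v = (\<Sum>s\<in>R. map_matrix (\<lambda>a. log_form (b s) x v * a) (t s))"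

definition wedge ::
  "('e \<Rightarrow> 'e \<Rightarrow> complex ^ 'm ^ 'm) \<Rightarrow> ('e \<Rightarrow> 'e \<Rightarrow> complex ^ 'm ^ 'm) \<Rightarrow> 'e \<Rightarrow> 'e \<Rightarrow> 'e \<Rightarrow> complex ^ 'm ^ 'm" where
  "wedge \<alpha> \<beta> x u v = \<alpha> x u ** \<beta> x v - \<alpha> x v ** \<beta> x u"

definition integrable_form :: "'e set \<Rightarrow> ('e \<Rightarrow> 'e \<Rightarrow> complex ^ 'm ^ 'm) \<Rightarrow> bool" where
  "integrable_form X \<theta> \<longleftrightarrow> (\<forall>x\<in>X. \<forall>u v. wedge \<theta> \<theta> x u v = 0)"

text \<open>The formal parameter \<open>h\<close> is \<open>fps_X\<close>; \<open>End (V \<otimes> \<complex>[[h]])\<close> is \<open>complex fps ^ 'm ^ 'm\<close>.\<close>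

definition h_times ::
  "('e \<Rightarrow> 'e \<Rightarrow> complex ^ 'm ^ 'm) \<Rightarrow> 'e \<Rightarrow> 'e \<Rightarrow> complex fps ^ 'm ^ 'm" where
  "h_times \<theta> x v = map_matrix (\<lambda>a. fps_X * fps_const a) (\<theta> x v)"

text \<open>Solutions on an open set, the differential being taken coefficientwise in \<open>h\<close>.\<close>

definition solution_on ::
  "('e::real_normed_vector) set \<Rightarrow> ('e \<Rightarrow> 'e \<Rightarrow> complex fps ^ 'm ^ 'm) \<Rightarrow> ('e \<Rightarrow> complex fps ^ 'm ^ 'm) \<Rightarrow> bool" where
  "solution_on U \<omega> F \<longleftrightarrow>
     (\<forall>x\<in>U. \<forall>i j k. ((\<lambda>y. fps_nth (F y $ i $ j) k) has_derivative
                     (\<lambda>v. fps_nth ((\<omega> x v ** F x) $ i $ j) k)) (at x))"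

text \<open>Solutions along a continuous path: near each parameter they come from a local solution.\<close>

definition solution_along ::
  "('e::real_normed_vector) set \<Rightarrow> ('e \<Rightarrow> 'e \<Rightarrow> complex fps ^ 'm ^ 'm) \<Rightarrow> (real \<Rightarrow> 'e) \<Rightarrow>
   (real \<Rightarrow> complex fps ^ 'm ^ 'm) \<Rightarrow> bool" where
  "solution_along X \<omega> \<gamma> \<Phi> \<longleftrightarrow>
     (\<forall>\<tau>\<in>{0..1}. \<exists>U F \<delta>. open U \<and> U \<subseteq> X \<and> solution_on U \<omega> F \<and> \<delta> > 0 \<and>
        (\<forall>\<sigma>\<in>{0..1}. \<bar>\<sigma> - \<tau>\<bar> < \<delta> \<longrightarrow> \<gamma> \<sigma> \<in> U \<and> \<Phi> \<sigma> = F (\<gamma> \<sigma>)))"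

definition transport ::
  "('e::real_normed_vector) set \<Rightarrow> ('e \<Rightarrow> 'e \<Rightarrow> complex fps ^ 'm ^ 'm) \<Rightarrow> (real \<Rightarrow> 'e) \<Rightarrow> complex fps ^ 'm ^ 'm" where
  "transport X \<omega> \<gamma> = (THE M. \<exists>\<Phi>. solution_along X \<omega> \<gamma> \<Phi> \<and> \<Phi> 0 = mat 1 \<and> \<Phi> 1 = M)"

text \<open>
  The monodromy of \<open>\<omega>\<close>, defined on \<open>\<pi>\<^sub>1(X/W)\<close> based at the orbit of \<open>z\<close>, with values in the
  matrices over \<open>\<complex>((h))\<close>; \<open>r\<close> is the action of \<open>W\<close> on \<open>V\<close>.
\<close>

definition monodromy ::
  "(complex ^ 'n) set \<Rightarrow> (complex ^ 'n ^ 'n) set \<Rightarrow> (complex ^ 'n ^ 'n \<Rightarrow> complex ^ 'm ^ 'm) \<Rightarrow>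
   (complex ^ 'n \<Rightarrow> complex ^ 'n \<Rightarrow> complex fps ^ 'm ^ 'm) \<Rightarrow> complex ^ 'n \<Rightarrow>
   (real \<Rightarrow> (complex ^ 'n) set) set \<Rightarrow> complex fls ^ 'm ^ 'm" where
  "monodromy X W r \<omega> z c =
     (THE M. \<exists>\<gamma> w. w \<in> W \<and> path \<gamma> \<and> path_image \<gamma> \<subseteq> X \<and>
        pathstart \<gamma> = z \<and> pathfinish \<gamma> = matrix_inv w *v z \<and> orbit_of W \<circ> \<gamma> \<in> c \<and>
        M = map_matrix fps_to_fls (map_matrix fps_const (r w) ** transport X \<omega> \<gamma>))"

definition isomorphic_reps ::
  "('g, 'k) monoid_scheme \<Rightarrow> ('g \<Rightarrow> 'a::field ^ 'm ^ 'm) \<Rightarrow> ('g \<Rightarrow> 'a ^ 'm ^ 'm) \<Rightarrow> bool" where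
  "isomorphic_reps G \<rho> \<sigma> \<longleftrightarrow> (\<exists>Q. invertible Q \<and> (\<forall>g\<in>carrier G. Q ** \<rho> g = \<sigma> g ** Q))"

end

theory Submission
  imports Defs
begin

text \<open>
  Near \<open>x1\<close> the forms \<open>\<omega>\<close> and \<open>\<omega>0\<close> differ by a form without poles. On a neighbourhood of
  \<open>X \<inter> \<Omega>\<close> in \<open>X\<close> one solves \<open>dK = \<omega>0 K - K \<omega>\<close> with \<open>K\<close> congruent to \<open>1\<close> modulo \<open>h\<close>, order by
  order in \<open>h\<close>: each coefficient is an integral along the rays from \<open>x1\<close>, and it tends to \<open>0\<close> at
  \<open>x1\<close>, so that the residues of \<open>\<omega>0\<close> cause no divergence although \<open>x1\<close> lies on their hyperplanes.
  Uniqueness of \<open>K\<close> makes it \<open>W0\<close>-equivariant, hence it intertwines the monodromies of \<open>\<omega>\<close> and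
  \<open>\<omega>0\<close> along paths in \<open>X \<inter> \<Omega>\<close>; a loop in \<open>X0/W0\<close> is moved there by a radial retraction.
  The form \<open>\<omega>0\<close> is flat because it is the limit of \<open>\<omega>\<close> under contraction towards \<open>x1\<close>.

  Monodromy is well defined because \<open>W\<close> acts freely on \<open>X\<close> (Steinberg), so that \<open>X \<rightarrow> X/W\<close> is a
  covering. For \<open>X0\<close> this follows by moving a point of \<open>X0\<close> towards \<open>x1\<close> until it lies in \<open>X\<close>.
\<close>

text \<open>The obstacle is that the centre of the rays is singular. Two facts remove the
  divergence. At order one the coefficient \<open>mat 1\<close> commutes with every residue, so the
  poles through \<open>x1\<close>, which \<open>\<omega>\<close> and \<open>\<omega>0\<close> share,
  cancel. At higher orders each coefficient carries a factor \<open>l\<close> along the ray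
  \<open>p + l *\<^sub>R (x - p)\<close>, and a linear form vanishing at \<open>x1\<close> is itself
  proportional to \<open>l\<close> there, so their quotient has a limit at the start. No logarithm
  arises: \<open>K\<close> is single-valued although its domain need not be simply connected. The
  same construction with an empty second set of poles and a regular centre gives the local
  fundamental solutions. Paths are merely continuous, so continuation along them is expressed
  through these solutions. The intertwiner of the two representations is \<open>K x2\<close>, moved
  to the base points by transport on either side. The embedding of \<open>B0\<close> picks some
  preimage of a class; any such preimage lifts to a path in \<open>X \<inter> \<Omega>\<close> that
  is homotopic in \<open>X0\<close> to the given one, which is what the comparison of transports
  uses.\<close>

no_notation fps_nth (infixl "$" 75)

section \<open>Linear forms and their kernels\<close>

lemma linear_formI:
  assumes "\<And>x y. b (x + y) = b x + b y" "\<And>c x. b (c *s x) = c * b x"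
  shows "linear_form b"
  unfolding linear_form_def
  by unfold_locales (use assms in \<open>auto simp: algebra_simps\<close>)

lemma linear_formD:
  assumes "linear_form b"
  shows linear_form_add: "b (x + y) = b x + b y"
    and linear_form_scale: "b (c *s x) = c * b x"
    and linear_form_diff: "b (x - y) = b x - b y"
    and linear_form_zero: "b 0 = 0"
proof -
  interpret b: Vector_Spaces.linear "(*s)" "(*)" b
    using assms by (simp add: linear_form_def)
  show "b (x + y) = b x + b y" "b (c *s x) = c * b x" "b (x - y) = b x - b y" "b 0 = 0"
    by (simp_all add: b.add b.scale b.diff b.zero)
qed

lemma scaleR_eq_vector_scalar: "a *\<^sub>R (x :: complex ^ 'n) = complex_of_real a *s x"
  by (simp add: vec_eq_iff scaleR_conv_of_real[where 'a=complex])

lemma linear_form_scaleR: "linear_form b \<Longrightarrow> b (a *\<^sub>R x) = of_real a * b x"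
  by (simp only: scaleR_eq_vector_scalar linear_form_scale)

lemma linear_form_bounded_linear:
  assumes "linear_form b" shows "bounded_linear b"
proof -
  have "linear b"
    by (rule linearI) (simp_all add: linear_form_add[OF assms] linear_form_scaleR[OF assms] scaleR_conv_of_real[where 'a=complex])
  then show ?thesis by (simp add: linear_conv_bounded_linear)
qed

lemma linear_form_has_derivative: "linear_form b \<Longrightarrow> (b has_derivative b) F"
  using bounded_linear_imp_has_derivative linear_form_bounded_linear by blast

lemma linear_form_comp_matrix:
  assumes "linear_form b" shows "linear_form (\<lambda>x. b (A *v x))"
  by (rule linear_formI)
     (simp_all add: linear_formD[OF assms] matrix_vector_right_distrib vec.scale)

lemma linear_form_nth: "linear_form (\<lambda>x. x $ i)"
  by (intro linear_formI) auto

text \<open>Subtracting a suitable multiple of \<open>e\<close> moves \<open>x\<close> into the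
  kernel of \<open>b\<close>, where \<open>l\<close> vanishes. It serves twice: for
  \<open>l - l \<circ> s\<close> with a reflection \<open>s\<close>, and for comparing the forms of
  conjugate reflections.\<close>

lemma linear_form_multiple:
  assumes l: "linear_form l" and b: "linear_form b" "b e \<noteq> 0" and ker: "\<And>x. b x = 0 \<Longrightarrow> l x = 0"
  shows "l x = l e / b e * b x"
proof -
  have "b (x - (b x / b e) *s e) = 0"
    using b(2) by (simp add: linear_formD[OF b(1)])
  then have "l (x - (b x / b e) *s e) = 0"
    by (rule ker)
  then show ?thesis
    using b(2) by (simp add: linear_formD[OF l])
qed

section \<open>Finite matrix groups\<close>

lemma group_GL: "group (GL :: ('a::field ^ 'n ^ 'n) monoid)"
proof (rule groupI)
  fix A :: "'a ^ 'n ^ 'n" assume "A \<in> carrier GL"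
  then obtain A' where "A ** A' = mat 1" "A' ** A = mat 1"
    by (auto simp: GL_def invertible_def)
  then show "\<exists>B\<in>carrier GL. B \<otimes>\<^bsub>GL\<^esub> A = \<one>\<^bsub>GL\<^esub>"
    by (intro bexI[of _ A']) (auto simp: GL_def invertible_def)
next
  show "\<one>\<^bsub>GL\<^esub> \<in> carrier (GL :: ('a ^ 'n ^ 'n) monoid)"
    unfolding GL_def invertible_def by (auto intro: exI[of _ "mat 1"])
qed (auto simp: GL_def invertible_mult matrix_mul_assoc)

lemma matrix_inverse:
  assumes "invertible (A :: 'a::semiring_1 ^ 'n ^ 'n)"
  shows matrix_mult_inv: "A ** matrix_inv A = mat 1" and matrix_inv_mult: "matrix_inv A ** A = mat 1"
  using assms unfolding invertible_def matrix_inv_def by (metis (mono_tags, lifting) someI_ex)+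

lemma inv_GL: "invertible A \<Longrightarrow> inv\<^bsub>GL\<^esub> A = matrix_inv A"
  using matrix_inverse[of A]
  by (intro group.inv_equality[OF group_GL]) (auto simp: GL_def invertible_def[of "matrix_inv A"])

locale matrix_group =
  fixes W :: "(complex ^ 'n ^ 'n) set"
  assumes finite_W: "finite W" and subgroup_W: "subgroup W GL"
begin

lemma W_invertible: "w \<in> W \<Longrightarrow> invertible w"
  using subgroup.subset[OF subgroup_W] by (auto simp: GL_def)

lemma W_one: "mat 1 \<in> W"
  using subgroup.one_closed[OF subgroup_W] by (simp add: GL_def)

lemma W_mult: "v \<in> W \<Longrightarrow> w \<in> W \<Longrightarrow> v ** w \<in> W"
  using subgroup.m_closed[OF subgroup_W] by (simp add: GL_def)

lemma W_inv: "w \<in> W \<Longrightarrow> matrix_inv w \<in> W"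
  using subgroup.m_inv_closed[OF subgroup_W] inv_GL W_invertible by metis

lemma W_inverse:
  assumes "w \<in> W"
  shows "w ** matrix_inv w = mat 1" "matrix_inv w ** w = mat 1"
    "w *v (matrix_inv w *v x) = x" "matrix_inv w *v (w *v x) = x"
  using matrix_inverse[OF W_invertible[OF assms]] by (simp_all add: matrix_vector_mul_assoc)

lemma inj_W: "w \<in> W \<Longrightarrow> w *v x = w *v y \<longleftrightarrow> x = y"
  using W_inverse(4) by metis

lemma orbit_of_self: "x \<in> orbit_of W x"
  unfolding orbit_of_def using W_one by (metis image_eqI matrix_vector_mul_lid)

lemma orbit_of_act: "w \<in> W \<Longrightarrow> orbit_of W (w *v x) = orbit_of W x"
proof -
  have *: "orbit_of W (w *v x) \<subseteq> orbit_of W x" if "w \<in> W" for w x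
  proof
    fix y assume "y \<in> orbit_of W (w *v x)"
    then obtain v where "v \<in> W" "y = (v ** w) *v x"
      by (auto simp: orbit_of_def matrix_vector_mul_assoc)
    then show "y \<in> orbit_of W x"
      using that W_mult[of v w] unfolding orbit_of_def by blast
  qed
  assume w: "w \<in> W"
  show "orbit_of W (w *v x) = orbit_of W x"
    using *[OF w, of x] *[OF W_inv[OF w], of "w *v x"] unfolding W_inverse(4)[OF w] by blast
qed

lemma orbit_of_eq_iff: "orbit_of W x = orbit_of W y \<longleftrightarrow> (\<exists>w\<in>W. y = w *v x)"
proof
  assume "orbit_of W x = orbit_of W y"
  then have "y \<in> orbit_of W x"
    using orbit_of_self by metis
  then show "\<exists>w\<in>W. y = w *v x"
    by (auto simp: orbit_of_def)
qed (auto simp: orbit_of_act)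

lemma refls_conj:
  assumes "w \<in> W" "s \<in> refls W"
  shows "w ** s ** matrix_inv w \<in> refls W"
    and "fixed_space (w ** s ** matrix_inv w) = (*v) w ` fixed_space s"
proof -
  have s: "s \<in> W" "s ** s = mat 1" "is_hyperplane (fixed_space s)"
    using assms by (auto simp: refls_def is_reflection_def)
  note inv = W_inverse[OF assms(1)]
  show fs: "fixed_space (w ** s ** matrix_inv w) = (*v) w ` fixed_space s"
  proof (intro equalityI subsetI)
    fix x assume "x \<in> fixed_space (w ** s ** matrix_inv w)"
    then have "w *v (s *v (matrix_inv w *v x)) = x"
      by (simp add: fixed_space_def matrix_vector_mul_assoc matrix_mul_assoc)
    then have "matrix_inv w *v x = s *v (matrix_inv w *v x)"
      using inv(4)[of "s *v (matrix_inv w *v x)"] by simp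
    then have "matrix_inv w *v x \<in> fixed_space s"
      by (simp add: fixed_space_def)
    then show "x \<in> (*v) w ` fixed_space s"
      using inv(3)[of x] by (intro image_eqI[of _ _ "matrix_inv w *v x"]) simp_all
  next
    fix x assume "x \<in> (*v) w ` fixed_space s"
    then obtain y where y: "s *v y = y" "x = w *v y"
      by (auto simp: fixed_space_def)
    then show "x \<in> fixed_space (w ** s ** matrix_inv w)"
      by (simp add: fixed_space_def inv flip: matrix_vector_mul_assoc)
  qed
  have "w ** s ** matrix_inv w ** (w ** s ** matrix_inv w)
      = w ** (s ** ((matrix_inv w ** w) ** s)) ** matrix_inv w"
    by (simp only: matrix_mul_assoc)
  also have "\<dots> = mat 1"
    using s inv by simp
  finally have 1: "w ** s ** matrix_inv w ** (w ** s ** matrix_inv w) = mat 1" .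
  have "vec.dim ((*v) w ` fixed_space s) = vec.dim (fixed_space s)"
    by (rule vec.dim_image_eq) (auto simp: inj_on_def inj_W[OF assms(1)])
  moreover have "vec.subspace ((*v) w ` fixed_space s)"
    using s by (intro vec.subspace_image) (auto simp: is_hyperplane_def)
  ultimately have "is_hyperplane (fixed_space (w ** s ** matrix_inv w))"
    using s(3) unfolding fs is_hyperplane_def by auto
  then show "w ** s ** matrix_inv w \<in> refls W"
    using 1 s assms W_mult W_inv by (auto simp: refls_def is_reflection_def)
qed

end

section \<open>Free action on the complement of the hyperplanes\<close>

text \<open>Polynomial functions of degree at most \<open>d\<close>. The index is an upper bound
  that drops by one under division by a linear form, which drives the induction in the proof of
  freeness.\<close>

inductive poly_fun :: "nat \<Rightarrow> (complex ^ 'n \<Rightarrow> complex) \<Rightarrow> bool" where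
  const: "poly_fun d (\<lambda>x. c)"
| add: "poly_fun d f \<Longrightarrow> poly_fun d g \<Longrightarrow> poly_fun d (\<lambda>x. f x + g x)"
| mult: "linear_form l \<Longrightarrow> poly_fun d f \<Longrightarrow> poly_fun (Suc d) (\<lambda>x. l x * f x)"

lemma poly_fun_Suc: "poly_fun d f \<Longrightarrow> poly_fun (Suc d) f"
proof (induction rule: poly_fun.induct)
  case (add d f g)
  then show ?case by (intro poly_fun.add)
qed (auto intro: poly_fun.const poly_fun.mult)

lemma poly_fun_scale: "poly_fun d f \<Longrightarrow> poly_fun d (\<lambda>x. c * f x)"
proof (induction rule: poly_fun.induct)
  case (mult l d f)
  then have "poly_fun (Suc d) (\<lambda>x. l x * (c * f x))"
    by (intro poly_fun.mult)
  then show ?case by (simp add: mult.left_commute)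
next
  case (add d f g)
  then have "poly_fun d (\<lambda>x. c * f x + c * g x)"
    by (intro poly_fun.add)
  then show ?case by (simp add: distrib_left)
qed (rule poly_fun.const)

lemma poly_fun_comp_matrix: "poly_fun d f \<Longrightarrow> poly_fun d (\<lambda>x. f (A *v x))"
proof (induction rule: poly_fun.induct)
  case (add d f g)
  then show ?case by (intro poly_fun.add)
next
  case (mult l d f)
  then show ?case by (intro poly_fun.mult linear_form_comp_matrix)
qed (rule poly_fun.const)

lemma poly_fun_affine:
  assumes "linear_form l" "poly_fun d f"
  shows "poly_fun (Suc d) (\<lambda>x. (l x - c) * f x)"
proof -
  have "poly_fun (Suc d) (\<lambda>x. l x * f x + (- c) * f x)"
    using assms by (intro poly_fun.add poly_fun.mult poly_fun_scale poly_fun_Suc)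
  then show ?thesis by (simp add: left_diff_distrib)
qed

lemma poly_fun_differentiable: "poly_fun d f \<Longrightarrow> f differentiable (at x)"
proof (induction rule: poly_fun.induct)
  case (mult l d f)
  then show ?case
    using linear_form_has_derivative differentiableI by (intro differentiable_mult) blast+
qed simp_all

lemma poly_fun_0: "poly_fun d f \<Longrightarrow> d = 0 \<Longrightarrow> \<exists>c. f = (\<lambda>x. c)"
  by (induction rule: poly_fun.induct) auto

text \<open>The polynomial is a product of affine functions, one for each \<open>p\<close> in
  \<open>P\<close>, in a coordinate where \<open>p\<close> and \<open>x\<close> differ.\<close>

lemma poly_fun_interpolate:
  assumes "finite P" "x \<notin> P"
  shows "\<exists>d f. poly_fun d f \<and> (\<forall>p\<in>P. f p = 0) \<and> f x \<noteq> 0"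
  using assms
proof (induction P rule: finite_induct)
  case empty
  show ?case by (intro exI[of _ 0] exI[of _ "\<lambda>x. 1"]) (auto intro: poly_fun.const)
next
  case (insert p P)
  then obtain d f where f: "poly_fun d f" "\<forall>p\<in>P. f p = 0" "f x \<noteq> 0"
    by auto
  obtain i where "x $ i \<noteq> p $ i"
    using insert.prems by (auto simp: vec_eq_iff)
  with f show ?case
    by (intro exI[of _ "Suc d"] exI[of _ "\<lambda>y. (y $ i - p $ i) * f y"])
       (auto intro: poly_fun_affine linear_form_nth)
qed

text \<open>For a linear form \<open>l\<close>, the difference \<open>l - l \<circ> s\<close>
  vanishes on the kernel of \<open>b\<close> and so is a multiple of \<open>b\<close>. Products
  follow from the twisted Leibniz rule \<open>l f - (l f) \<circ> s = (l - l \<circ> s) f + (l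
  \<circ> s) (f - f \<circ> s)\<close>. The case distinction on \<open>d\<close> stands for degree
  \<open>d - 1\<close>: at bound 0 the function is constant and its quotient is zero.\<close>

lemma poly_fun_divided_difference:
  assumes b: "linear_form b" "b e \<noteq> 0" and s: "\<And>x. b x = 0 \<Longrightarrow> s *v x = x"
  assumes "poly_fun d f"
  shows "\<exists>h. (\<forall>x. f x - f (s *v x) = b x * h x) \<and> (case d of 0 \<Rightarrow> h = (\<lambda>x. 0) | Suc d' \<Rightarrow> poly_fun d' h)"
  using assms(4)
proof (induction rule: poly_fun.induct)
  case (const d c)
  show ?case by (intro exI[of _ "\<lambda>x. 0"]) (auto split: nat.splits intro: poly_fun.const)
next
  case (add d f g)
  then obtain h k where hk: "\<And>x. f x - f (s *v x) = b x * h x" "\<And>x. g x - g (s *v x) = b x * k x"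
    and d: "case d of 0 \<Rightarrow> h = (\<lambda>x. 0) | Suc d' \<Rightarrow> poly_fun d' h"
    and d': "case d of 0 \<Rightarrow> k = (\<lambda>x. 0) | Suc d' \<Rightarrow> poly_fun d' k"
    by auto
  have "f x + g x - (f (s *v x) + g (s *v x)) = b x * (h x + k x)" for x
    using hk[of x] by (simp only: add_diff_add distrib_left)
  with d d' show ?case
    by (intro exI[of _ "\<lambda>x. h x + k x"]) (auto split: nat.splits intro: poly_fun.add)
next
  case (mult l d f)
  then obtain h where h: "\<And>x. f x - f (s *v x) = b x * h x"
    and hd: "case d of 0 \<Rightarrow> h = (\<lambda>x. 0) | Suc d' \<Rightarrow> poly_fun d' h"
    by auto
  define c where "c = (l e - l (s *v e)) / b e"
  have l': "linear_form (\<lambda>x. l (s *v x))"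
    using mult by (intro linear_form_comp_matrix)
  have l0: "linear_form (\<lambda>x. l x - l (s *v x))"
    by (rule linear_formI)
       (simp_all add: linear_form_add[OF mult.hyps(1)] linear_form_add[OF l']
          linear_form_scale[OF mult.hyps(1)] linear_form_scale[OF l'] right_diff_distrib
          del: matrix_vector_mul_assoc)
  have c: "l x - l (s *v x) = c * b x" for x
    unfolding c_def by (rule linear_form_multiple[OF l0 b]) (simp only: s diff_self)
  have "poly_fun d (\<lambda>x. c * f x + l (s *v x) * h x)"
  proof (cases d)
    case 0
    then obtain a where "f = (\<lambda>x. a)"
      using poly_fun_0[OF mult.hyps(2)] by auto
    then show ?thesis
      using hd 0 poly_fun.const[of 0 "c * a"] by simp
  next
    case (Suc d')
    then show ?thesis
      using hd mult.hyps(2) by (auto intro!: poly_fun.add poly_fun.mult poly_fun_scale l')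
  qed
  moreover have "l x * f x - l (s *v x) * f (s *v x) = b x * (c * f x + l (s *v x) * h x)" for x
  proof -
    have "l x * f x - l (s *v x) * f (s *v x)
        = (l x - l (s *v x)) * f x + l (s *v x) * (f x - f (s *v x))"
      by (simp add: algebra_simps)
    then show ?thesis by (simp only: c h) (simp add: algebra_simps)
  qed
  ultimately show ?case by auto
qed

context matrix_group
begin

lemma regular_stable:
  assumes forms: "\<And>s. s \<in> refls W \<Longrightarrow> {x. b s x = 0} = fixed_space s"
    and x: "\<And>s. s \<in> refls W \<Longrightarrow> b s x \<noteq> 0" and w: "w \<in> W" and s: "s \<in> refls W"
  shows "b s (w *v x) \<noteq> 0"
proof
  assume "b s (w *v x) = 0"
  then have "w *v x \<in> fixed_space s"
    using forms[OF s] by blast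
  then have "matrix_inv w *v (w *v x) \<in> fixed_space (matrix_inv w ** s ** matrix_inv (matrix_inv w))"
    using refls_conj(2)[OF W_inv[OF w] s] by blast
  then show False
    using forms[OF refls_conj(1)[OF W_inv[OF w] s]] x[OF refls_conj(1)[OF W_inv[OF w] s]] W_inverse[OF w]
    by auto
qed

text \<open>
  Induction on the degree: \<open>f - f \<circ> s\<close> is \<open>b s\<close> times a polynomial of smaller degree that again
  vanishes on the orbit of the regular point \<open>x\<close>. So, on directions \<open>g *v v - v\<close>, the differential of \<open>f\<close>
  at \<open>x\<close> is that of the average of \<open>f\<close> over \<open>W\<close>, which vanishes there because the average is invariant.
\<close>

lemma derivative_fixed_direction:
  assumes gen: "generate GL (refls W) = W"
    and forms: "\<And>s. s \<in> refls W \<Longrightarrow> linear_form (b s) \<and> {x. b s x = 0} = fixed_space s"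
    and x: "\<And>s. s \<in> refls W \<Longrightarrow> b s x \<noteq> 0" and g: "g \<in> W" "g *v x = x"
    and "poly_fun d f" "\<And>w. w \<in> W \<Longrightarrow> f (w *v x) = 0" "(f has_derivative f') (at x)"
  shows "f' (g *v v - v) = 0"
  using assms(6-8)
proof (induction d arbitrary: f f' rule: less_induct)
  case (less d)
  define u where "u = g *v v - v"
  have D: "\<exists>f'. (f has_derivative f') (at x)" if "poly_fun d f" for d f
    using poly_fun_differentiable[OF that] by (auto simp: differentiable_def)
  \<comment> \<open>A single reflection: in the product rule for \<open>b s * h\<close> at
    \<open>x\<close>, one term has the factor \<open>h x\<close>, which is zero since
    \<open>h\<close> vanishes on the orbit, the other the factor \<open>h' u\<close>, which is zero
    by induction on the degree.\<close>
  have refl: "f1' u = f2' u" if f1: "poly_fun d f1" "\<And>w. w \<in> W \<Longrightarrow> f1 (w *v x) = 0"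
    and s: "s \<in> refls W" and f1': "(f1 has_derivative f1') (at x)"
    and f2': "((\<lambda>y. f1 (s *v y)) has_derivative f2') (at x)" for f1 s f1' f2'
  proof -
    have bs: "linear_form (b s)" "b s x \<noteq> 0" and fixs: "{x. b s x = 0} = fixed_space s" and sW: "s \<in> W"
      using forms[OF s] x[OF s] s by (auto simp: refls_def)
    have "\<And>y. b s y = 0 \<Longrightarrow> s *v y = y"
      using fixs by (auto simp: fixed_space_def)
    then obtain h where h: "\<And>y. f1 y - f1 (s *v y) = b s y * h y"
      and hd: "case d of 0 \<Rightarrow> h = (\<lambda>x. 0) | Suc d' \<Rightarrow> poly_fun d' h"
      using poly_fun_divided_difference[OF bs _ f1(1), of s] by blast
    have h0: "h (w *v x) = 0" if "w \<in> W" for w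
    proof -
      have "b s (w *v x) * h (w *v x) = 0"
        using h[of "w *v x"] f1(2)[OF that] f1(2)[OF W_mult[OF sW that]] by (simp add: matrix_vector_mul_assoc)
      moreover have "b s (w *v x) \<noteq> 0"
        using regular_stable[of b x w s] forms x that s by blast
      ultimately show ?thesis by simp
    qed
    obtain h' where h': "(h has_derivative h') (at x)" "h' u = 0"
    proof (cases d)
      case 0
      then have "h = (\<lambda>x. 0)"
        using hd by simp
      then show thesis
        by (intro that[of "\<lambda>x. 0"]) auto
    next
      case (Suc d')
      then have "poly_fun d' h"
        using hd by simp
      then obtain h' where "(h has_derivative h') (at x)"
        using D by blast
      then show thesis
        using less.IH[of d' h h'] \<open>poly_fun d' h\<close> h0 Suc that by (auto simp: u_def)
    qed
    have "((\<lambda>y. b s y * h y) has_derivative (\<lambda>u. b s x * h' u + b s u * h x)) (at x)"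
      by (rule has_derivative_mult[OF linear_form_has_derivative[OF bs(1)] h'(1)])
    moreover have "((\<lambda>y. b s y * h y) has_derivative (\<lambda>u. f1' u - f2' u)) (at x)"
      using has_derivative_diff[OF f1' f2'] by (simp add: h)
    ultimately have "(\<lambda>u. b s x * h' u + b s u * h x) = (\<lambda>u. f1' u - f2' u)"
      by (rule has_derivative_unique)
    then have "f1' u - f2' u = b s x * h' u + b s u * h x"
      by metis
    then show ?thesis
      using h'(2) h0[OF W_one] by simp
  qed
  \<comment> \<open>The claim is quantified over \<open>f1\<close>, because for a product
    \<open>g1 g2\<close> the second induction hypothesis is applied to
    \<open>f1 \<circ> g1\<close>.\<close>
  have gen_eq: "\<forall>f1 f1' f2'. poly_fun d f1 \<longrightarrow> (\<forall>w\<in>W. f1 (w *v x) = 0) \<longrightarrow> (f1 has_derivative f1') (at x)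
      \<longrightarrow> ((\<lambda>y. f1 (w *v y)) has_derivative f2') (at x) \<longrightarrow> f1' u = f2' u" if "w \<in> generate GL (refls W)" for w
    using that
  proof (induction rule: generate.induct)
    case one
    show ?case
      by (simp add: GL_def) (metis has_derivative_unique)
  next
    case (incl s)
    then show ?case using refl by blast
  next
    case (inv s)
    then have "s ** s = mat 1" "s \<in> W"
      by (auto simp: refls_def is_reflection_def)
    then have "inv\<^bsub>GL\<^esub> s = s"
      using inv_GL[OF W_invertible] W_inverse[of s] by (metis matrix_mul_assoc matrix_mul_lid matrix_mul_rid)
    then show ?case using refl[OF _ _ inv] by simp
  next
    case (eng g1 g2)
    have gW: "g1 \<in> W" "g2 \<in> W"
      using eng gen by auto
    show ?case
    proof (intro allI impI)
      fix f1 f1' f2'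
      assume f1: "poly_fun d f1" "\<forall>w\<in>W. f1 (w *v x) = 0" "(f1 has_derivative f1') (at x)"
        "((\<lambda>y. f1 ((g1 \<otimes>\<^bsub>GL\<^esub> g2) *v y)) has_derivative f2') (at x)"
      have p: "poly_fun d (\<lambda>y. f1 (g1 *v y))"
        using f1 poly_fun_comp_matrix by blast
      then obtain f3' where f3': "((\<lambda>y. f1 (g1 *v y)) has_derivative f3') (at x)"
        using D by blast
      have "f1' u = f3' u"
        using eng.IH(1) f1 f3' by blast
      also have "f3' u = f2' u"
        using eng.IH(2)[rule_format, OF p _ f3', of f2'] f1(2,4) W_mult[OF gW(1)]
        by (simp add: GL_def matrix_vector_mul_assoc)
      finally show "f1' u = f2' u" .
    qed
  qed
  define F where "F = (\<lambda>y. \<Sum>w\<in>W. f (w *v y))"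
  have "\<forall>w. \<exists>fw'. ((\<lambda>y. f (w *v y)) has_derivative fw') (at x)"
    using D poly_fun_comp_matrix[OF less.prems(1)] by blast
  then obtain fw where fw: "\<And>w. ((\<lambda>y. f (w *v y)) has_derivative fw w) (at x)"
    by metis
  define F' where "F' = (\<lambda>u. \<Sum>w\<in>W. fw w u)"
  have F': "(F has_derivative F') (at x)"
    unfolding F_def F'_def by (intro has_derivative_sum fw)
  have "fw w u = f' u" if "w \<in> W" for w
    using gen_eq[of w] that gen less.prems fw[of w] by metis
  then have Fu: "F' u = of_nat (card W) * f' u"
    unfolding F'_def by (simp cong: sum.cong)
  have inv: "F (g *v y) = F y" for y
  proof -
    have "bij_betw (\<lambda>w. w ** g) W W"
    proof (rule bij_betw_byWitness[where f' = "\<lambda>w. w ** matrix_inv g"])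
      show "\<forall>w\<in>W. w ** g ** matrix_inv g = w" "\<forall>w\<in>W. w ** matrix_inv g ** g = w"
        using W_inverse[OF g(1)] by (simp_all flip: matrix_mul_assoc)
    qed (use g W_mult W_inv in auto)
    then show ?thesis
      unfolding F_def matrix_vector_mul_assoc
      using sum.reindex_bij_betw[of "\<lambda>w. w ** g" W W "\<lambda>w. f (w *v y)"] by simp
  qed
  have lin: "((\<lambda>y. g *v y) has_derivative (\<lambda>y. g *v y)) (at x)"
    by (rule bounded_linear_imp_has_derivative) simp
  \<comment> \<open>Here \<open>g *v x = x\<close> enters: both \<open>F\<close> and
    \<open>F \<circ> g = F\<close> are differentiated at the same point \<open>x\<close>, so the
    derivative is invariant under \<open>g\<close>.\<close>
  have "((\<lambda>y. F (g *v y)) has_derivative (\<lambda>u. F' (g *v u))) (at x)"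
    using has_derivative_compose[OF lin, of F F'] F' g(2) by simp
  then have "F' (g *v v) = F' v"
    using has_derivative_unique[OF F'] unfolding inv by metis
  then have "F' u = 0"
    unfolding u_def using linear_diff[OF has_derivative_linear[OF F']] by simp
  moreover have "card W \<noteq> 0"
    using finite_W W_one by (auto simp: card_eq_0_iff)
  ultimately show ?case
    using Fu by (simp add: u_def)
qed

text \<open>If \<open>g\<close> moved some \<open>v\<close>, a coordinate \<open>j\<close> of
  \<open>g *v v - v\<close> would be nonzero. The polynomial \<open>q\<close> vanishes on the whole
  orbit, at \<open>x\<close> because of its affine factor and elsewhere because of \<open>f\<close>;
  yet its derivative at \<open>x\<close> along \<open>g *v v - v\<close> is that coordinate times
  \<open>f x\<close>, in conflict with \<open>derivative_fixed_direction\<close>.\<close>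

theorem free_action:
  assumes gen: "generate GL (refls W) = W"
    and forms: "\<And>s. s \<in> refls W \<Longrightarrow> linear_form (b s) \<and> {x. b s x = 0} = fixed_space s"
    and x: "\<And>s. s \<in> refls W \<Longrightarrow> b s x \<noteq> 0" and g: "g \<in> W" "g *v x = x"
  shows "g = mat 1"
proof (rule ccontr)
  assume "g \<noteq> mat 1"
  then obtain v where v: "g *v v \<noteq> v"
    by (metis matrix_eq matrix_vector_mul_lid)
  then obtain j where j: "(g *v v - v) $ j \<noteq> 0"
    by (metis eq_iff_diff_eq_0 vec_eq_iff zero_index)
  have "finite (orbit_of W x - {x})"
    using finite_W by (auto simp: orbit_of_def)
  from poly_fun_interpolate[OF this, of x] obtain d f
    where f: "poly_fun d f" "\<And>p. p \<in> orbit_of W x - {x} \<Longrightarrow> f p = 0" "f x \<noteq> 0"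
    by auto
  obtain f' where f': "(f has_derivative f') (at x)"
    using poly_fun_differentiable[OF f(1)] by (auto simp: differentiable_def)
  define q where "q = (\<lambda>y. (y $ j - x $ j) * f y)"
  have "poly_fun (Suc d) q"
    unfolding q_def by (intro poly_fun_affine linear_form_nth f)
  moreover have "q (w *v x) = 0" if "w \<in> W" for w
    using f(2)[of "w *v x"] that by (cases "w *v x = x") (auto simp: q_def orbit_of_def)
  moreover have "(q has_derivative (\<lambda>u. (x $ j - x $ j) * f' u + (u $ j - 0) * f x)) (at x)"
    unfolding q_def
    by (intro has_derivative_mult has_derivative_diff f' linear_form_has_derivative linear_form_nth
        has_derivative_const)
  ultimately have "(\<lambda>u. (x $ j - x $ j) * f' u + (u $ j - 0) * f x) (g *v v - v) = 0"
    using derivative_fixed_direction[of b x g "Suc d" q] gen forms x g by blast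
  then show False
    using j f(3) by simp
qed

end

section \<open>Path classes\<close>

lemma homotopic_pathsin_refl: "pathin T p \<Longrightarrow> homotopic_pathsin T p p"
  by (simp add: homotopic_pathsin_def pathin_def)

lemma homotopic_pathsin_ends: "homotopic_pathsin T p q \<Longrightarrow> q 0 = p 0 \<and> q 1 = p 1"
  unfolding homotopic_pathsin_def by (drule homotopic_with_imp_property) simp

lemma homotopic_pathsin_sym:
  assumes "homotopic_pathsin T p q" shows "homotopic_pathsin T q p"
  using assms homotopic_pathsin_ends[OF assms] unfolding homotopic_pathsin_def
  by (auto intro: homotopic_with_symD)

lemma homotopic_pathsin_trans:
  assumes "homotopic_pathsin T p q" "homotopic_pathsin T q r" shows "homotopic_pathsin T p r"
proof -
  have "homotopic_with (\<lambda>r. r 0 = p 0 \<and> r 1 = p 1) (top_of_set {0..1}) T q r"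
    using assms(2) homotopic_pathsin_ends[OF assms(1)] by (simp add: homotopic_pathsin_def)
  with assms(1) show ?thesis
    unfolding homotopic_pathsin_def by (rule homotopic_with_trans)
qed

lemma homotopic_pathsin_imp_pathin: "homotopic_pathsin T p q \<Longrightarrow> pathin T p \<and> pathin T q"
  unfolding homotopic_pathsin_def pathin_def by (rule homotopic_with_imp_continuous_maps)

lemma homotopic_pathsin_eq:
  assumes "pathin T p" "\<And>t. t \<in> {0..1} \<Longrightarrow> p t = q t"
  shows "homotopic_pathsin T p q"
  using assms unfolding homotopic_pathsin_def pathin_def
  by (intro homotopic_with_equal) auto

lemma path_class_eq: "homotopic_pathsin T p q \<Longrightarrow> path_class T p = path_class T q"
  unfolding path_class_def using homotopic_pathsin_sym homotopic_pathsin_trans by blast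

lemma path_class_self: "pathin T p \<Longrightarrow> p \<in> path_class T p"
  by (simp add: path_class_def homotopic_pathsin_refl)

text \<open>All members of a class have homotopic images, so the union in \<open>induced_map\<close>
  is the union of one repeated set.\<close>

lemma induced_map_path_class:
  assumes "continuous_map T T' f" "pathin T p"
  shows "induced_map T' f (path_class T p) = path_class T' (f \<circ> p)"
proof -
  have "path_class T' (f \<circ> q) = path_class T' (f \<circ> p)" if "q \<in> path_class T p" for q
  proof (rule path_class_eq[symmetric])
    show "homotopic_pathsin T' (f \<circ> p) (f \<circ> q)"
      using that assms(1) unfolding path_class_def homotopic_pathsin_def mem_Collect_eq
      by (elim homotopic_with_compose_continuous_map_left) auto
  qed
  then show ?thesis
    unfolding induced_map_def using path_class_self[OF assms(2)] by blast
qed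

lemma homotopic_paths_iff_pathsin: "homotopic_paths S p q \<longleftrightarrow> homotopic_pathsin (top_of_set S) p q"
  by (simp add: homotopic_paths_def homotopic_pathsin_def pathstart_def pathfinish_def)

section \<open>Lifting paths and homotopies from orbit spaces\<close>

text \<open>The library's covering space theory needs a normed base space: orbits are sent to their
  truncated distance functions.\<close>

definition orbit_dist :: "('a::metric_space) set \<Rightarrow> 'a \<Rightarrow>\<^sub>C real" where
  "orbit_dist A = Bcontfun (\<lambda>y. min 1 (infdist y A))"

lemma orbit_dist_apply: "apply_bcontfun (orbit_dist A) y = min 1 (infdist y A)"
  unfolding orbit_dist_def
  by (subst Bcontfun_inverse)
     (auto intro!: bcontfun_normI[where b = 1] continuous_intros simp: infdist_nonneg)

lemma topspace_orbit_space: "topspace (orbit_space W S) = orbit_of W ` S"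
  using quotient_imp_surjective_map[OF quotient_map_orbit_of[of S W]] by simp

locale regular_set = matrix_group W for W :: "(complex ^ 'n ^ 'n) set" +
  fixes S :: "(complex ^ 'n) set"
  assumes open_S: "open S"
    and stable: "w \<in> W \<Longrightarrow> x \<in> S \<Longrightarrow> w *v x \<in> S"
    and free: "w \<in> W \<Longrightarrow> x \<in> S \<Longrightarrow> w *v x = x \<Longrightarrow> w = mat 1"
begin

lemma orbit_of_nonempty: "orbit_of W x \<noteq> {}"
  using orbit_of_self by blast

lemma orbit_of_closed: "closed (orbit_of W x)"
  unfolding orbit_of_def by (intro finite_imp_closed finite_imageI finite_W)

text \<open>A closed set is the zero set of its distance function, and truncation at 1 does not
  change the zero set.\<close>

lemma orbit_dist_inj: "orbit_dist (orbit_of W x) = orbit_dist (orbit_of W y) \<Longrightarrow> orbit_of W x = orbit_of W y"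
proof -
  assume "orbit_dist (orbit_of W x) = orbit_dist (orbit_of W y)"
  then have "min 1 (infdist x (orbit_of W x)) = min 1 (infdist x (orbit_of W y))"
    using orbit_dist_apply by metis
  moreover have "infdist x (orbit_of W x) = 0"
    using orbit_of_self by (rule infdist_zero)
  ultimately have "infdist x (orbit_of W y) = 0"
    by (simp add: min_def split: if_splits)
  then have "x \<in> orbit_of W y"
    using in_closed_iff_infdist_zero[OF orbit_of_closed orbit_of_nonempty] by blast
  then show "orbit_of W x = orbit_of W y"
    using orbit_of_act by (fastforce simp: orbit_of_def[of W y])
qed

lemma continuous_orbit_dist: "continuous_on A (\<lambda>x. orbit_dist (orbit_of W x))"
proof -
  \<comment> \<open>A common bound for the operator norms of all elements of \<open>W\<close>; the
    summand 1 makes it positive, so that it can be divided by.\<close>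
  define C where "C = (\<Sum>w\<in>W. onorm ((*v) w)) + 1"
  have onorm_nn: "0 \<le> onorm ((*v) w)" for w :: "complex ^ 'n ^ 'n"
    by (intro onorm_pos_le) simp
  then have C: "C > 0"
    unfolding C_def by (intro add_nonneg_pos sum_nonneg) auto
  have bound: "norm (w *v v) \<le> C * norm v" if "w \<in> W" for w v
  proof -
    have "norm (w *v v) \<le> onorm ((*v) w) * norm v"
      by (rule onorm) simp
    also have "onorm ((*v) w) \<le> C"
      unfolding C_def using member_le_sum[OF that _ finite_W, of "\<lambda>w. onorm ((*v) w)"] onorm_nn by simp
    finally show ?thesis by (simp add: mult_right_mono)
  qed
  have half: "infdist y (orbit_of W x') \<le> infdist y (orbit_of W x) + C * dist x x'" for y x x'
  proof -
    obtain a where "a \<in> orbit_of W x" "infdist y (orbit_of W x) = dist y a"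
      using infdist_attains_inf[OF orbit_of_closed orbit_of_nonempty] by metis
    then obtain w where w: "w \<in> W" "infdist y (orbit_of W x) = dist y (w *v x)"
      by (auto simp: orbit_of_def)
    have "infdist y (orbit_of W x') \<le> dist y (w *v x')"
      using w by (intro infdist_le) (auto simp: orbit_of_def)
    also have "\<dots> \<le> dist y (w *v x) + dist (w *v x) (w *v x')"
      by (rule dist_triangle)
    also have "dist (w *v x) (w *v x') \<le> C * dist x x'"
      using bound[OF w(1), of "x - x'"] by (simp add: dist_norm matrix_vector_mult_diff_distrib)
    finally show ?thesis using w by simp
  qed
  have lip: "dist (orbit_dist (orbit_of W x)) (orbit_dist (orbit_of W x')) \<le> C * dist x x'" for x x'
  proof (rule dist_bound)
    fix y
    show "dist (apply_bcontfun (orbit_dist (orbit_of W x)) y)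
               (apply_bcontfun (orbit_dist (orbit_of W x')) y) \<le> C * dist x x'"
      using half[of y x' x] half[of y x x']
      by (auto simp: orbit_dist_apply dist_real_def dist_commute min_def abs_if)
  qed
  show ?thesis
    unfolding continuous_on_iff
  proof (intro ballI allI impI)
    fix x and e :: real assume "e > 0"
    show "\<exists>d>0. \<forall>x'\<in>A. dist x' x < d \<longrightarrow> dist (orbit_dist (orbit_of W x')) (orbit_dist (orbit_of W x)) < e"
    proof (intro exI[of _ "e / C"] conjI ballI impI)
      fix x' assume "dist x' x < e / C"
      then have "C * dist x' x < e"
        using C by (simp add: field_simps)
      with lip[of x' x] show "dist (orbit_dist (orbit_of W x')) (orbit_dist (orbit_of W x)) < e"
        by linarith
    qed (use \<open>e > 0\<close> C in simp)
  qed
qed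

lemma open_act_image:
  assumes "w \<in> W" "open U" shows "open ((*v) w ` U)"
proof -
  have "(*v) w ` U = (*v) (matrix_inv w) -` U"
    using W_inverse[OF assms(1)] by (auto simp: image_iff) metis
  moreover have "continuous_on UNIV ((*v) (matrix_inv w))"
    by (intro linear_continuous_on) simp
  ultimately show ?thesis
    using assms(2) by (simp add: open_vimage)
qed

text \<open>Evaluation at the point \<open>x\<close> suffices: if the distance function of the orbit
  of \<open>x'\<close> is close to that of the orbit of \<open>x\<close>, it is small at
  \<open>x\<close>, so some translate of \<open>x'\<close> is close to \<open>x\<close>.\<close>

lemma orbit_dist_open_map:
  assumes "open U" "U \<subseteq> S"
  shows "openin (top_of_set ((\<lambda>x. orbit_dist (orbit_of W x)) ` S)) ((\<lambda>x. orbit_dist (orbit_of W x)) ` U)"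
  unfolding openin_euclidean_subtopology_iff
proof (intro conjI ballI)
  let ?p = "\<lambda>x. orbit_dist (orbit_of W x)"
  show "?p ` U \<subseteq> ?p ` S" using assms by blast
  fix a assume "a \<in> ?p ` U"
  then obtain x where x: "x \<in> U" "a = ?p x" by blast
  then obtain d where d: "d > 0" "ball x d \<subseteq> U"
    using assms(1) open_contains_ball by metis
  show "\<exists>e>0. \<forall>a'\<in>?p ` S. dist a' a < e \<longrightarrow> a' \<in> ?p ` U"
  \<comment> \<open>A radius of at most 1 ensures that the truncated distance at \<open>x\<close> is
    the true one.\<close>
  proof (intro exI[of _ "min 1 d"] conjI ballI impI)
    fix a' assume "a' \<in> ?p ` S" and a': "dist a' a < min 1 d"
    then obtain x' where x': "x' \<in> S" "a' = ?p x'" by blast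
    have "dist (apply_bcontfun a' x) (apply_bcontfun a x) < min 1 d"
      using dist_fun_lt_imp_dist_val_lt[OF a'] .
    moreover have "infdist x (orbit_of W x) = 0"
      using orbit_of_self by (rule infdist_zero)
    moreover have "infdist x (orbit_of W x') \<ge> 0"
      by (rule infdist_nonneg)
    ultimately have "infdist x (orbit_of W x') < d"
      using x x' by (auto simp: orbit_dist_apply dist_real_def min_def split: if_splits)
    moreover obtain y where "y \<in> orbit_of W x'" "infdist x (orbit_of W x') = dist x y"
      using infdist_attains_inf[OF orbit_of_closed orbit_of_nonempty] by metis
    ultimately obtain w where w: "w \<in> W" "w *v x' \<in> U"
      using d by (auto simp: orbit_of_def)
    have "a' = ?p (w *v x')"
      using x' w by (simp add: orbit_of_act)
    with w show "a' \<in> ?p ` U" by blast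
  qed (use d in simp)
qed

text \<open>Freeness makes \<open>x\<close> differ from its finitely many other translates;
  separating \<open>x\<close> from each of them and intersecting gives \<open>U\<close>.\<close>

lemma exists_disjoint_translates:
  assumes "x \<in> S"
  obtains U where "open U" "x \<in> U" "U \<subseteq> S" "\<And>w u. w \<in> W \<Longrightarrow> u \<in> U \<Longrightarrow> w *v u \<in> U \<Longrightarrow> w = mat 1"
proof -
  have "\<forall>w\<in>W - {mat 1}. \<exists>P Q. open P \<and> open Q \<and> x \<in> P \<and> w *v x \<in> Q \<and> P \<inter> Q = {}"
  proof
    fix w assume "w \<in> W - {mat 1}"
    then have "x \<noteq> w *v x"
      using free[of w x] assms by auto
    then show "\<exists>P Q. open P \<and> open Q \<and> x \<in> P \<and> w *v x \<in> Q \<and> P \<inter> Q = {}"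
      by (rule hausdorff)
  qed
  then obtain P Q where PQ: "\<And>w. w \<in> W - {mat 1} \<Longrightarrow>
      open (P w) \<and> open (Q w) \<and> x \<in> P w \<and> w *v x \<in> Q w \<and> P w \<inter> Q w = {}"
    by metis
  define U where "U = S \<inter> (\<Inter>w\<in>W - {mat 1}. P w \<inter> (*v) w -` Q w)"
  show thesis
  proof (rule that)
    have "continuous_on UNIV ((*v) w)" for w :: "complex ^ 'n ^ 'n"
      by (intro linear_continuous_on) simp
    then show "open U"
      unfolding U_def using PQ finite_W open_S
      by (intro open_Int open_INT ballI) (auto intro: open_vimage)
    show "x \<in> U" using PQ assms by (auto simp: U_def)
    show "U \<subseteq> S" by (auto simp: U_def)
    fix w u assume w: "w \<in> W" "u \<in> U" "w *v u \<in> U"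
    show "w = mat 1"
    proof (rule ccontr)
      assume "w \<noteq> mat 1"
      with w have "w \<in> W - {mat 1}" by blast
      with w have "w *v u \<in> P w" "w *v u \<in> Q w"
        by (auto simp: U_def)
      then show False using PQ[OF \<open>w \<in> W - {mat 1}\<close>] by blast
    qed
  qed
qed

text \<open>The sheets over the image of a small \<open>U\<close> are the translates of
  \<open>U\<close>. If two of them meet, \<open>exists_disjoint_translates\<close> forces the group
  elements to agree, which gives disjointness of the sheets and, within one sheet, injectivity of
  the projection.\<close>

theorem covering_space_orbit_dist:
  "covering_space S (\<lambda>x. orbit_dist (orbit_of W x)) ((\<lambda>x. orbit_dist (orbit_of W x)) ` S)"
proof (rule covering_spaceI)
  let ?p = "\<lambda>x. orbit_dist (orbit_of W x)"
  show "continuous_on S ?p" by (rule continuous_orbit_dist)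
  have p_act: "?p (w *v x) = ?p x" if "w \<in> W" for w x
    using that by (simp add: orbit_of_act)
  fix a assume "a \<in> ?p ` S"
  then obtain x where x: "x \<in> S" "a = ?p x" by blast
  obtain U where U: "open U" "x \<in> U" "U \<subseteq> S"
    and disj: "\<And>w u. w \<in> W \<Longrightarrow> u \<in> U \<Longrightarrow> w *v u \<in> U \<Longrightarrow> w = mat 1"
    by (rule exists_disjoint_translates[OF x(1)]) blast
  have wU: "(*v) w ` U \<subseteq> S" if "w \<in> W" for w
    using U that stable by blast
  define V where "V = (\<lambda>w. (*v) w ` U) ` W"
  have "\<Union>V = S \<inter> ?p -` (?p ` U)"
  proof (intro equalityI subsetI)
    fix y assume "y \<in> \<Union>V"
    then show "y \<in> S \<inter> ?p -` (?p ` U)"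
      unfolding V_def using U stable p_act by auto
  next
    fix y assume y: "y \<in> S \<inter> ?p -` (?p ` U)"
    then obtain u where "u \<in> U" "?p y = ?p u" by blast
    then have "orbit_of W u = orbit_of W y"
      using orbit_dist_inj by metis
    then obtain w where "w \<in> W" "y = w *v u"
      using orbit_of_eq_iff by blast
    then show "y \<in> \<Union>V"
      unfolding V_def using \<open>u \<in> U\<close> by blast
  qed
  moreover have "\<forall>u\<in>V. openin (top_of_set S) u"
    unfolding V_def using wU open_act_image U open_S by (auto simp: openin_open_eq)
  moreover have "pairwise disjnt V"
  proof (rule pairwiseI)
    fix A B assume "A \<in> V" "B \<in> V" "A \<noteq> B"
    then obtain w w' where w: "w \<in> W" "w' \<in> W" "A = (*v) w ` U" "B = (*v) w' ` U"
      by (auto simp: V_def)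
    have "A = B" if u: "u \<in> U" "u' \<in> U" "w *v u = w' *v u'" for u u'
    proof -
      have "(matrix_inv w' ** w) *v u = u'"
        using W_inverse(4)[OF w(2), of u'] u(3) by (simp flip: matrix_vector_mul_assoc)
      then have "matrix_inv w' ** w = mat 1"
        using disj[of "matrix_inv w' ** w" u] u w W_mult W_inv by auto
      then have "w' ** (matrix_inv w' ** w) = w'" by simp
      then have "w = w'"
        using W_inverse(1)[OF w(2)] by (simp add: matrix_mul_assoc)
      then show ?thesis using w by simp
    qed
    with \<open>A \<noteq> B\<close> show "disjnt A B"
      unfolding disjnt_def w by blast
  qed
  moreover have "\<forall>u\<in>V. \<exists>q. homeomorphism u (?p ` U) ?p q"
  proof
    fix A assume "A \<in> V"
    then obtain w where w: "w \<in> W" "A = (*v) w ` U"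
      by (auto simp: V_def)
    have "\<exists>q. homeomorphism A (?p ` U) ?p q"
    proof (rule homeomorphism_injective_open_map)
      show "continuous_on A ?p" by (rule continuous_orbit_dist)
      show img: "?p ` A = ?p ` U"
        using w p_act by (auto simp: image_image)
      show "inj_on ?p A"
      proof (rule inj_onI)
        fix y y' assume y: "y \<in> A" "y' \<in> A" "?p y = ?p y'"
        then obtain u u' where u: "u \<in> U" "u' \<in> U" "y = w *v u" "y' = w *v u'"
          using w by blast
        with y have "?p u = ?p u'" using p_act w by simp
        then have "orbit_of W u = orbit_of W u'"
          by (rule orbit_dist_inj)
        then obtain g where g: "g \<in> W" "u' = g *v u"
          using orbit_of_eq_iff by blast
        with u disj[of g u] have "g = mat 1" by blast
        with g u show "y = y'" by simp
      qed
      fix O' assume "openin (top_of_set A) O'"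
      then have O': "open O'" "O' \<subseteq> A"
        using open_act_image[OF w(1) U(1)] w by (auto simp: openin_open_eq)
      then have "openin (top_of_set (?p ` S)) (?p ` O')"
        using wU w by (intro orbit_dist_open_map) auto
      then show "openin (top_of_set (?p ` U)) (?p ` O')"
      proof (rule openin_subset_trans)
        show "?p ` O' \<subseteq> ?p ` U"
          unfolding img[symmetric] using O'(2) by (rule image_mono)
        show "?p ` U \<subseteq> ?p ` S"
          using U(3) by (rule image_mono)
      qed
    qed blast
    then show "\<exists>q. homeomorphism A (?p ` U) ?p q" .
  qed
  ultimately have "\<exists>v. \<Union>v = S \<inter> ?p -` (?p ` U) \<and> (\<forall>u\<in>v. openin (top_of_set S) u) \<and>
      pairwise disjnt v \<and> (\<forall>u\<in>v. \<exists>q. homeomorphism u (?p ` U) ?p q)"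
    by (intro exI[of _ V] conjI)
  then show "\<exists>T. a \<in> T \<and> openin (top_of_set (?p ` S)) T \<and>
      (\<exists>v. \<Union>v = S \<inter> ?p -` T \<and> (\<forall>u\<in>v. openin (top_of_set S) u) \<and> pairwise disjnt v \<and>
        (\<forall>u\<in>v. \<exists>q. homeomorphism u T ?p q))"
    using orbit_dist_open_map[OF U(1,3)] x(2) U(2) by (intro exI[of _ "?p ` U"] conjI) simp_all
qed simp

lemma continuous_map_orbit_of: "continuous_map (top_of_set S) (orbit_space W S) (orbit_of W)"
  by (rule quotient_imp_continuous_map[OF quotient_map_orbit_of])

lemma continuous_map_orbit_dist:
  "continuous_map (orbit_space W S) (top_of_set ((\<lambda>x. orbit_dist (orbit_of W x)) ` S)) orbit_dist"
  by (rule continuous_compose_quotient_map[OF quotient_map_orbit_of])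
     (use continuous_orbit_dist[of S] in \<open>auto simp: continuous_map_in_subtopology o_def\<close>)

lemma pathin_orbit_of:
  assumes "path g" "path_image g \<subseteq> S" shows "pathin (orbit_space W S) (orbit_of W \<circ> g)"
  using assms continuous_map_orbit_of
  by (intro pathin_compose[of "top_of_set S"]) (auto simp: pathin_canon_iff path_image_def)

lemma homotopic_paths_imp_pathsin:
  assumes "homotopic_paths S g g'"
  shows "homotopic_pathsin (orbit_space W S) (orbit_of W \<circ> g) (orbit_of W \<circ> g')"
  using assms unfolding homotopic_paths_iff_pathsin homotopic_pathsin_def
  by (elim homotopic_with_compose_continuous_map_left[OF _ continuous_map_orbit_of]) auto

text \<open>The path is carried to the normed model by \<open>orbit_dist\<close>, lifted through the
  covering there, and recognised as a lift of \<open>q\<close> by injectivity of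
  \<open>orbit_dist\<close> on orbits.\<close>

lemma lift_pathin:
  assumes q: "pathin (orbit_space W S) q" "q 0 = orbit_of W z" and z: "z \<in> S"
  obtains g where "path g" "path_image g \<subseteq> S" "pathstart g = z" "\<And>t. t \<in> {0..1} \<Longrightarrow> orbit_of W (g t) = q t"
proof -
  let ?p = "\<lambda>x. orbit_dist (orbit_of W x)"
  have "pathin (top_of_set (?p ` S)) (orbit_dist \<circ> q)"
    by (rule pathin_compose[OF q(1) continuous_map_orbit_dist])
  then have "path (orbit_dist \<circ> q)" "path_image (orbit_dist \<circ> q) \<subseteq> ?p ` S"
    unfolding pathin_canon_iff path_image_def by blast+
  moreover have "pathstart (orbit_dist \<circ> q) = ?p z"
    using q by (simp add: pathstart_def)
  ultimately obtain g where g: "path g" "path_image g \<subseteq> S" "pathstart g = z"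
    and pg: "\<And>t. t \<in> {0..1} \<Longrightarrow> ?p (g t) = (orbit_dist \<circ> q) t"
    by (rule covering_space_lift_path_strong[OF covering_space_orbit_dist z]) blast
  have "orbit_of W (g t) = q t" if "t \<in> {0..1}" for t
  proof -
    have "q t \<in> orbit_of W ` S"
      using q(1) that continuous_map_image_subset_topspace[of "top_of_set {0..1}" "orbit_space W S" q]
      by (auto simp: pathin_def topspace_orbit_space)
    then show ?thesis
      using pg[OF that] orbit_dist_inj by (metis comp_apply imageE)
  qed
  with g show thesis by (rule that)
qed

text \<open>The homotopy is carried to the normed model by the continuous map
  \<open>orbit_dist\<close> and lifted there. This is what makes the end point of a lift, hence the
  group element in the monodromy, depend only on the class.\<close>

lemma lift_homotopy:
  assumes hom: "homotopic_pathsin (orbit_space W S) q q'"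
    and g: "path g" "path_image g \<subseteq> S" "\<And>t. t \<in> {0..1} \<Longrightarrow> orbit_of W (g t) = q t"
    and g': "path g'" "path_image g' \<subseteq> S" "\<And>t. t \<in> {0..1} \<Longrightarrow> orbit_of W (g' t) = q' t"
    and start: "pathstart g = pathstart g'"
  shows "homotopic_paths S g g'"
proof -
  let ?p = "\<lambda>x. orbit_dist (orbit_of W x)"
  have hom': "homotopic_paths (?p ` S) (orbit_dist \<circ> q) (orbit_dist \<circ> q')"
    using hom unfolding homotopic_paths_iff_pathsin homotopic_pathsin_def
    by (elim homotopic_with_compose_continuous_map_left[OF _ continuous_map_orbit_dist]) auto
  show ?thesis
    using hom' g g' start homotopic_paths_imp_path[OF hom'] homotopic_paths_imp_subset[OF hom']
    by (intro covering_space_lift_homotopic_paths[OF covering_space_orbit_dist,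
          of "orbit_dist \<circ> q" "orbit_dist \<circ> q'"]) simp_all
qed

text \<open>Members of a path class are arbitrary outside the unit interval, so \<open>q\<close> is only there a composite.\<close>

lemma lift_path_class:
  assumes q: "q \<in> path_class (orbit_space W S) (orbit_of W \<circ> g)" and g: "path g" "path_image g \<subseteq> S"
  obtains g' where "homotopic_paths S g g'" "\<And>t. t \<in> {0..1} \<Longrightarrow> orbit_of W (g' t) = q t"
proof -
  have hom: "homotopic_pathsin (orbit_space W S) (orbit_of W \<circ> g) q"
    using q by (simp add: path_class_def)
  have "q 0 = orbit_of W (pathstart g)"
    using homotopic_pathsin_ends[OF hom] by (simp add: pathstart_def)
  moreover have "pathstart g \<in> S"
    using g pathstart_in_path_image by blast
  ultimately obtain g' where g': "path g'" "path_image g' \<subseteq> S" "pathstart g' = pathstart g"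
      "\<And>t. t \<in> {0..1} \<Longrightarrow> orbit_of W (g' t) = q t"
    using lift_pathin homotopic_pathsin_imp_pathin[OF hom] by metis
  have "homotopic_paths S g g'"
    using hom g g' by (intro lift_homotopy[OF hom]) auto
  with g' that show thesis by blast
qed

lemma path_act: "path g \<Longrightarrow> path (\<lambda>t. w *v g t)" for g :: "real \<Rightarrow> complex ^ 'n"
  unfolding path_def by (intro linear_continuous_on_compose[of _ g "(*v) w"]) simp_all

text \<open>The lift of the path of orbits of \<open>d\<close> that starts at the end
  \<open>v *v x\<close> of \<open>g\<close> is \<open>v *v d\<close>; so the concatenation on the
  right lifts the conjugated loop.\<close>

lemma change_base_path_class:
  assumes g: "path g" "path_image g \<subseteq> S" "pathstart g = x" "pathfinish g = v *v x"
    and d: "path d" "path_image d \<subseteq> S" "pathstart d = x" and v: "v \<in> W"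
  shows "change_base (orbit_space W S) (orbit_of W \<circ> d) (path_class (orbit_space W S) (orbit_of W \<circ> g)) =
         path_class (orbit_space W S) (orbit_of W \<circ> (reversepath d +++ (g +++ (\<lambda>t. v *v d t))))"
proof -
  let ?l = "\<lambda>g. reversepath d +++ (g +++ (\<lambda>t. v *v d t))"
  have vd: "path (\<lambda>t. v *v d t)" "path_image (\<lambda>t. v *v d t) \<subseteq> S" "pathstart (\<lambda>t. v *v d t) = v *v x"
    using d stable[OF v] path_act by (auto simp: path_image_def pathstart_def)
  have "path_class (orbit_space W S) (concat_paths (\<lambda>t. (orbit_of W \<circ> d) (1 - t)) (concat_paths q (orbit_of W \<circ> d)))
      = path_class (orbit_space W S) (orbit_of W \<circ> ?l g)"
    if q: "q \<in> path_class (orbit_space W S) (orbit_of W \<circ> g)" for q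
  proof -
    obtain g' where g': "homotopic_paths S g g'" "\<And>t. t \<in> {0..1} \<Longrightarrow> orbit_of W (g' t) = q t"
      by (rule lift_path_class[OF q g(1,2)]) blast
    have hom: "homotopic_paths S (?l g) (?l g')"
      using g g' d vd
      by (intro homotopic_paths_join homotopic_paths_refl[THEN iffD2]) auto
    have "homotopic_pathsin (orbit_space W S) (orbit_of W \<circ> ?l g')
        (concat_paths (\<lambda>t. (orbit_of W \<circ> d) (1 - t)) (concat_paths q (orbit_of W \<circ> d)))"
    proof (rule homotopic_pathsin_eq)
      show "pathin (orbit_space W S) (orbit_of W \<circ> ?l g')"
        using homotopic_paths_imp_path[OF hom] homotopic_paths_imp_subset[OF hom]
        by (intro pathin_orbit_of) auto
      fix t :: real assume "t \<in> {0..1}"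
      then show "(orbit_of W \<circ> ?l g') t
          = concat_paths (\<lambda>t. (orbit_of W \<circ> d) (1 - t)) (concat_paths q (orbit_of W \<circ> d)) t"
        using g'(2) by (auto simp: concat_paths_def joinpaths_def reversepath_def orbit_of_act[OF v])
    qed
    with homotopic_paths_imp_pathsin[OF hom] show ?thesis
      using path_class_eq by metis
  qed
  moreover have "orbit_of W \<circ> g \<in> path_class (orbit_space W S) (orbit_of W \<circ> g)"
    by (intro path_class_self pathin_orbit_of g)
  ultimately show ?thesis
    unfolding change_base_def by blast
qed

end

section \<open>Primitives of closed forms on a domain that is star-shaped about a boundary point\<close>

text \<open>The centre \<open>p\<close> need not belong to \<open>D\<close>; instead, the coefficients of the form extend
  continuously to the start of every ray that leaves \<open>p\<close>.\<close>

lemma singular_primitive: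
  fixes b :: "'s \<Rightarrow> 'e::real_normed_vector \<Rightarrow> complex" and c :: "'s \<Rightarrow> 'e \<Rightarrow> complex"
  assumes fin: "finite S" and D: "open D"
    and star: "\<And>x l. x \<in> D \<Longrightarrow> 0 < l \<Longrightarrow> l \<le> 1 \<Longrightarrow> p + l *\<^sub>R (x - p) \<in> D"
    and b: "\<And>s. s \<in> S \<Longrightarrow> bounded_linear (b s)"
    and c: "\<And>s x. s \<in> S \<Longrightarrow> x \<in> D \<Longrightarrow> (c s has_derivative c' s x) (at x)"
    and c'_cont: "\<And>s u. s \<in> S \<Longrightarrow> continuous_on D (\<lambda>x. c' s x u)"
    and sym: "\<And>x u v. x \<in> D \<Longrightarrow> (\<Sum>s\<in>S. b s v * c' s x u) = (\<Sum>s\<in>S. b s u * c' s x v)"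
    and C: "\<And>s. s \<in> S \<Longrightarrow> continuous_on ({0..1} \<times> D) (C s)"
    and C_eq: "\<And>s x l. s \<in> S \<Longrightarrow> x \<in> D \<Longrightarrow> 0 < l \<Longrightarrow> l \<le> 1 \<Longrightarrow> C s (l, x) = c s (p + l *\<^sub>R (x - p))"
  defines "f \<equiv> \<lambda>x. integral {0..1} (\<lambda>l. \<Sum>s\<in>S. b s (x - p) * c s (p + l *\<^sub>R (x - p)))"
  shows singular_primitive_derivative:
      "x \<in> D \<Longrightarrow> (f has_derivative (\<lambda>u. \<Sum>s\<in>S. b s u * c s x)) (at x)"
    and singular_primitive_ray:
      "\<exists>\<kappa>. continuous_on ({0..1} \<times> D) \<kappa> \<and>
         (\<forall>x\<in>D. \<forall>l. 0 < l \<and> l \<le> 1 \<longrightarrow> f (p + l *\<^sub>R (x - p)) = of_real l * \<kappa> (l, x))"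
proof -
  have c_cont: "continuous_on D (c s)" if "s \<in> S" for s
    using c[OF that] has_derivative_continuous by (intro continuous_at_imp_continuous_on) blast
  have C_comp: "continuous_on A (\<lambda>a. C s (l a, X a))"
    if "s \<in> S" "continuous_on A l" "continuous_on A X" "\<And>a. a \<in> A \<Longrightarrow> l a \<in> {0..1} \<and> X a \<in> D"
    for A :: "'q::topological_space set" and s l X
    using that by (intro continuous_on_compose2[OF C[OF that(1)]] continuous_intros) auto
  note b_scale = linear_simps(5)[OF b]
  show "\<exists>\<kappa>. continuous_on ({0..1} \<times> D) \<kappa> \<and>
         (\<forall>x\<in>D. \<forall>l. 0 < l \<and> l \<le> 1 \<longrightarrow> f (p + l *\<^sub>R (x - p)) = of_real l * \<kappa> (l, x))"
  proof (intro exI conjI ballI allI impI)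
    \<comment> \<open>The ray integral ending at parameter \<open>l\<close> is the integral over
      \<open>m\<close> at parameters \<open>m * l\<close>; one factor \<open>l\<close> comes out of
      \<open>b s\<close> by linearity.\<close>
    let ?g = "\<lambda>z m. \<Sum>s\<in>S. b s (snd z - p) * C s (m * fst z, snd z)"
    let ?k = "\<lambda>z. integral {0..1} (?g z)"
    have "continuous_on (({0..1} \<times> D) \<times> cbox 0 1) (\<lambda>(z, m::real). ?g z m)"
      unfolding split_beta
      by (intro continuous_intros C_comp
          bounded_linear.continuous_on[OF b]) (auto simp: mult_le_one)
    then show "continuous_on ({0..1} \<times> D) ?k"
      using integral_continuous_on_param[of "{0..1} \<times> D" "0::real" 1 ?g] by simp
    fix x and l :: real assume x: "x \<in> D" and l: "0 < l \<and> l \<le> 1"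
    have "f (p + l *\<^sub>R (x - p)) = integral {0..1} (\<lambda>m. of_real l * ?g (l, x) m)"
      unfolding f_def
    \<comment> \<open>The value at \<open>m = 0\<close> is discarded: there the point is
      \<open>p\<close>, where \<open>C_eq\<close> says nothing.\<close>
    proof (rule integral_spike[of "{0}"])
      fix m :: real assume "m \<in> {0..1} - {0}"
      then have m: "0 < m * l" "m * l \<le> 1"
        using l by (auto simp: mult_le_one)
      show "of_real l * ?g (l, x) m
          = (\<Sum>s\<in>S. b s (p + l *\<^sub>R (x - p) - p) * c s (p + m *\<^sub>R (p + l *\<^sub>R (x - p) - p)))"
        unfolding sum_distrib_left
        using C_eq[OF _ x m] b_scale by (intro sum.cong) (auto simp: scaleR_conv_of_real)
    qed simp
    then show "f (p + l *\<^sub>R (x - p)) = of_real l * ?k (l, x)"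
      by simp
  qed
  show "(f has_derivative (\<lambda>u. \<Sum>s\<in>S. b s u * c s x)) (at x)" if x: "x \<in> D" for x
  proof -
    define A where "A = (\<lambda>x l. \<Sum>s\<in>S. b s (x - p) * C s (l, x))"
    have A_cont: "continuous_on {0..1} (A x)" if "x \<in> D" for x
      unfolding A_def using that by (intro continuous_intros C_comp) auto
    have fA: "f x = integral {0..1} (A x)" if "x \<in> D" for x
      unfolding f_def
      by (rule integral_spike[of "{0}"]) (auto simp: A_def C_eq[OF _ that])
    obtain r where r: "r > 0" "ball x r \<subseteq> D"
      using D x open_contains_ball by metis
    \<comment> \<open>Stokes for the triangle with corners \<open>p\<close>, \<open>x\<close>,
      \<open>y\<close>: the difference of the two ray integrals is the integral of the form over the
      opposite edge. Since \<open>p\<close> may lie outside \<open>D\<close>, the triangle is cut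
      off at parameter \<open>\<delta>\<close> and \<open>\<delta>\<close> then tends to 0.\<close>
    have diff: "f y - f x = integral {0..1} (\<lambda>\<sigma>. \<Sum>s\<in>S. b s (y - x) * c s (x + \<sigma> *\<^sub>R (y - x)))"
      if y: "y \<in> ball x r" for y
    proof -
      define u where "u = y - x"
      define X where "X = (\<lambda>\<sigma>. x + \<sigma> *\<^sub>R u)"
      have XD: "X \<sigma> \<in> D" if "\<sigma> \<in> {0..1}" for \<sigma>
      proof -
        have "\<bar>\<sigma>\<bar> * norm u \<le> 1 * norm u"
          using that by (intro mult_right_mono) auto
        then have "dist x (X \<sigma>) < r"
          using y by (simp add: X_def u_def dist_norm norm_minus_commute)
        then show ?thesis using r by auto
      qed
      have X_cont: "continuous_on T X" for T
        unfolding X_def by (intro continuous_intros)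
      have yD: "y \<in> D" using y r by auto
      \<comment> \<open>A common derivative: \<open>w\<close> is the derivative in
        \<open>\<sigma>\<close> of the radial integrand and, thanks to the closedness
        \<open>sym\<close>, also the derivative in \<open>l\<close> of \<open>l\<close> times the
        transversal integrand.\<close>
      define w where "w = (\<lambda>l \<sigma>. (\<Sum>s\<in>S. b s u * c s (p + l *\<^sub>R (X \<sigma> - p)))
          + of_real l * (\<Sum>s\<in>S. b s (X \<sigma> - p) * c' s (p + l *\<^sub>R (X \<sigma> - p)) u))"
      have dg: "((\<lambda>\<sigma>. \<Sum>s\<in>S. b s (X \<sigma> - p) * c s (p + l *\<^sub>R (X \<sigma> - p))) has_vector_derivative w l \<sigma>) (at \<sigma> within {0..1})"
        if l: "0 < l" "l \<le> 1" and \<sigma>: "\<sigma> \<in> {0..1}" for l \<sigma>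
      proof -
        let ?y = "p + l *\<^sub>R (X \<sigma> - p)"
        have yD: "?y \<in> D" using star[OF XD[OF \<sigma>] l] .
        have 1: "((\<lambda>\<sigma>. b s (X \<sigma> - p)) has_derivative (\<lambda>h. b s (h *\<^sub>R u))) (at \<sigma> within {0..1})"
          if "s \<in> S" for s
          by (rule bounded_linear.has_derivative[OF b[OF that]])
             (auto simp: X_def intro!: derivative_eq_intros)
        have X': "((\<lambda>\<sigma>. p + l *\<^sub>R (X \<sigma> - p)) has_derivative (\<lambda>h. h *\<^sub>R l *\<^sub>R u)) (at \<sigma> within {0..1})"
          by (auto simp: X_def intro!: derivative_eq_intros simp: fun_eq_iff mult.commute)
        have 2: "((\<lambda>\<sigma>. c s (p + l *\<^sub>R (X \<sigma> - p))) has_derivative (\<lambda>h. c' s ?y (h *\<^sub>R l *\<^sub>R u))) (at \<sigma> within {0..1})"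
          if "s \<in> S" for s
          using has_derivative_compose[OF X' c[OF that yD]] .
        have "((\<lambda>\<sigma>. \<Sum>s\<in>S. b s (X \<sigma> - p) * c s (p + l *\<^sub>R (X \<sigma> - p))) has_derivative
            (\<lambda>h. \<Sum>s\<in>S. b s (X \<sigma> - p) * c' s ?y (h *\<^sub>R l *\<^sub>R u) + b s (h *\<^sub>R u) * c s ?y)) (at \<sigma> within {0..1})"
          by (intro has_derivative_sum has_derivative_mult 1 2)
        moreover have "(\<Sum>s\<in>S. b s (X \<sigma> - p) * c' s ?y (h *\<^sub>R l *\<^sub>R u) + b s (h *\<^sub>R u) * c s ?y) = h *\<^sub>R w l \<sigma>" for h
        proof -
          have "c' s ?y (h *\<^sub>R l *\<^sub>R u) = of_real h * (of_real l * c' s ?y u)" if "s \<in> S" for s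
            using linear_simps(5)[OF has_derivative_bounded_linear[OF c[OF that yD]]]
            by (simp add: scaleR_conv_of_real)
          then show ?thesis
            unfolding w_def scaleR_conv_of_real distrib_left sum_distrib_left sum.distrib[symmetric]
            by (intro sum.cong) (auto simp: b_scale scaleR_conv_of_real algebra_simps)
        qed
        ultimately show ?thesis
          by (simp add: has_vector_derivative_def)
      qed
      have dh: "((\<lambda>l. of_real l * (\<Sum>s\<in>S. b s u * c s (p + l *\<^sub>R (X \<sigma> - p)))) has_vector_derivative w l \<sigma>) (at l within T)"
        if l: "0 < l" "l \<le> 1" and \<sigma>: "\<sigma> \<in> {0..1}" for l \<sigma> T
      proof -
        let ?y = "p + l *\<^sub>R (X \<sigma> - p)"
        have yD: "?y \<in> D" using star[OF XD[OF \<sigma>] l] .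
        have X': "((\<lambda>l. p + l *\<^sub>R (X \<sigma> - p)) has_derivative (\<lambda>h. h *\<^sub>R (X \<sigma> - p))) (at l within T)"
          by (auto intro!: derivative_eq_intros)
        have 2: "((\<lambda>l. c s (p + l *\<^sub>R (X \<sigma> - p))) has_derivative (\<lambda>h. c' s ?y (h *\<^sub>R (X \<sigma> - p)))) (at l within T)"
          if "s \<in> S" for s
          using has_derivative_compose[OF X' c[OF that yD]] .
        have "((\<lambda>l. of_real l * (\<Sum>s\<in>S. b s u * c s (p + l *\<^sub>R (X \<sigma> - p)))) has_derivative
            (\<lambda>h. of_real l * (\<Sum>s\<in>S. b s u * c' s ?y (h *\<^sub>R (X \<sigma> - p))) +
                 of_real h * (\<Sum>s\<in>S. b s u * c s ?y))) (at l within T)"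
          by (intro has_derivative_sum has_derivative_mult has_derivative_mult_right has_derivative_of_real has_derivative_ident 2)
        moreover have "of_real l * (\<Sum>s\<in>S. b s u * c' s ?y (h *\<^sub>R (X \<sigma> - p))) +
                 of_real h * (\<Sum>s\<in>S. b s u * c s ?y) = h *\<^sub>R w l \<sigma>" for h
        proof -
          have "c' s ?y (h *\<^sub>R (X \<sigma> - p)) = of_real h * c' s ?y (X \<sigma> - p)" if "s \<in> S" for s
            using linear_simps(5)[OF has_derivative_bounded_linear[OF c[OF that yD]]]
            by (simp add: scaleR_conv_of_real)
          then have "(\<Sum>s\<in>S. b s u * c' s ?y (h *\<^sub>R (X \<sigma> - p))) = of_real h * (\<Sum>s\<in>S. b s u * c' s ?y (X \<sigma> - p))"
            unfolding sum_distrib_left by (intro sum.cong) (auto simp: algebra_simps)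
          then show ?thesis
            unfolding w_def scaleR_conv_of_real sym[OF yD, of u] by (simp add: algebra_simps)
        qed
        ultimately show ?thesis
          by (simp add: has_vector_derivative_def)
      qed
      have w_cont: "continuous_on (cbox (\<delta>, 0) (1, 1)) (\<lambda>(l, \<sigma>). w l \<sigma>)" if "0 < \<delta>" for \<delta>
        unfolding w_def split_beta
        by (intro continuous_intros bounded_linear.continuous_on[OF b]
            continuous_on_compose2[OF c_cont] continuous_on_compose2[OF c'_cont]
            continuous_on_compose2[OF X_cont[of UNIV]])
           (use that in \<open>auto intro!: star XD\<close>)
      define h where "h = (\<lambda>\<delta> \<sigma>. \<Sum>s\<in>S. b s u * C s (\<delta>, X \<sigma>))"
      have h_cont: "continuous_on ({0..1} \<times> {0..1}) (\<lambda>z. h (fst z) (snd z))"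
        unfolding h_def by (intro continuous_intros C_comp continuous_on_compose2[OF X_cont[of UNIV]]) (auto intro!: XD)
      have h_cont': "continuous_on {0..1} (h \<delta>)" if "\<delta> \<in> {0..1}" for \<delta>
        unfolding h_def using that by (intro continuous_intros C_comp X_cont) (auto intro!: XD)
      \<comment> \<open>Integrating \<open>w\<close> over \<open>l\<close> from
        \<open>\<delta>\<close> to 1 in either order gives Stokes on the truncated triangle; the
        edges at \<open>l = 1\<close> and \<open>l = \<delta>\<close> are the boundary
        terms.\<close>
      have swap: "integral {\<delta>..1} (\<lambda>l. A y l - A x l)
          = integral {0..1} (h 1) - of_real \<delta> * integral {0..1} (h \<delta>)" if \<delta>: "0 < \<delta>" "\<delta> \<le> 1" for \<delta>
      proof -
        have "integral {\<delta>..1} (\<lambda>l. A y l - A x l) = integral (cbox \<delta> 1) (\<lambda>l. integral (cbox 0 1) (w l))"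
        proof -
          have "A y l - A x l = integral (cbox 0 1) (w l)" if l: "l \<in> {\<delta>..1}" for l
          proof -
            have l': "0 < l" "l \<le> 1" using \<delta> l by auto
            have "(w l has_integral (\<Sum>s\<in>S. b s (X 1 - p) * c s (p + l *\<^sub>R (X 1 - p))) -
                (\<Sum>s\<in>S. b s (X 0 - p) * c s (p + l *\<^sub>R (X 0 - p)))) {0..1}"
              by (rule fundamental_theorem_of_calculus) (use dg[OF l'] in auto)
            moreover have "X 1 = y" "X 0 = x"
              by (simp_all add: X_def u_def)
            ultimately have "(w l has_integral (A y l - A x l)) {0..1}"
              using C_eq[OF _ yD l'] C_eq[OF _ x l'] by (simp add: A_def)
            then show ?thesis by (simp add: integral_unique)
          qed
          then show ?thesis
            unfolding box_real by (intro integral_cong) auto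
        qed
        also have "\<dots> = integral (cbox 0 1) (\<lambda>\<sigma>. integral (cbox \<delta> 1) (\<lambda>l. w l \<sigma>))"
          by (rule integral_swap_continuous[OF w_cont[OF \<delta>(1)]])
        also have "\<dots> = integral {0..1} (\<lambda>\<sigma>. h 1 \<sigma> - of_real \<delta> * h \<delta> \<sigma>)"
        proof -
          have "integral (cbox \<delta> 1) (\<lambda>l. w l \<sigma>) = h 1 \<sigma> - of_real \<delta> * h \<delta> \<sigma>" if \<sigma>: "\<sigma> \<in> {0..1}" for \<sigma>
          proof -
            have "((\<lambda>l. w l \<sigma>) has_integral of_real 1 * (\<Sum>s\<in>S. b s u * c s (p + 1 *\<^sub>R (X \<sigma> - p)))
                - of_real \<delta> * (\<Sum>s\<in>S. b s u * c s (p + \<delta> *\<^sub>R (X \<sigma> - p)))) {\<delta>..1}"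
              by (rule fundamental_theorem_of_calculus) (use \<delta> dh[OF _ _ \<sigma>] in auto)
            then have "((\<lambda>l. w l \<sigma>) has_integral h 1 \<sigma> - of_real \<delta> * h \<delta> \<sigma>) {\<delta>..1}"
              using C_eq[OF _ XD[OF \<sigma>] \<delta>] C_eq[OF _ XD[OF \<sigma>], of _ 1] by (simp add: h_def)
            then show ?thesis by (simp add: integral_unique)
          qed
          then show ?thesis
            unfolding box_real by (intro integral_cong) auto
        qed
        also have "\<dots> = integral {0..1} (h 1) - of_real \<delta> * integral {0..1} (h \<delta>)"
          using \<delta> by (subst integral_diff) (auto intro!: integrable_continuous_real continuous_intros h_cont')
        finally show ?thesis .
      qed
      have "bounded ((\<lambda>z. h (fst z) (snd z)) ` ({0..1} \<times> {0..1}))"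
        by (intro compact_imp_bounded compact_continuous_image h_cont compact_Times) auto
      then obtain M where M: "\<And>\<delta> \<sigma>. \<delta> \<in> {0..1} \<Longrightarrow> \<sigma> \<in> {0..1} \<Longrightarrow> norm (h \<delta> \<sigma>) \<le> M"
        unfolding bounded_iff by fastforce
      have A'_cont: "continuous_on {0..1} (\<lambda>l. A y l - A x l)"
        using A_cont[OF yD] A_cont[OF x] by (intro continuous_intros)
      then have "bounded ((\<lambda>l. A y l - A x l) ` {0..1})"
        by (intro compact_imp_bounded compact_continuous_image) auto
      then obtain N where N: "\<And>l. l \<in> {0..1} \<Longrightarrow> norm (A y l - A x l) \<le> N"
        unfolding bounded_iff by fastforce
      \<comment> \<open>\<open>N\<close> bounds the radial part that was cut off, of length
        \<open>\<delta>\<close>; \<open>M\<close> bounds the integrand on the short edge, which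
        carries the factor \<open>\<delta>\<close>.\<close>
      have le: "norm (f y - f x - integral {0..1} (h 1)) \<le> (N + M) * \<delta>" if \<delta>: "0 < \<delta>" "\<delta> \<le> 1" for \<delta>
      proof -
        have "f y - f x = integral {0..1} (\<lambda>l. A y l - A x l)"
          unfolding fA[OF x] fA[OF yD]
          by (rule integral_diff[symmetric]) (intro integrable_continuous_real A_cont yD x)+
        also have "\<dots> = integral {0..\<delta>} (\<lambda>l. A y l - A x l) + integral {\<delta>..1} (\<lambda>l. A y l - A x l)"
          using \<delta> A'_cont by (intro Henstock_Kurzweil_Integration.integral_combine[symmetric] integrable_continuous_real) auto
        finally have eq: "f y - f x - integral {0..1} (h 1)
            = integral {0..\<delta>} (\<lambda>l. A y l - A x l) - of_real \<delta> * integral {0..1} (h \<delta>)"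
          using swap[OF \<delta>] by simp
        have n1: "norm (integral {0..\<delta>} (\<lambda>l. A y l - A x l)) \<le> N * (\<delta> - 0)"
          using \<delta> N by (intro integral_bound continuous_on_subset[OF A'_cont]) auto
        have "norm (integral {0..1} (h \<delta>)) \<le> M * (1 - 0)"
          using \<delta> M by (intro integral_bound h_cont') auto
        then have n2: "norm (of_real \<delta> * integral {0..1} (h \<delta>)) \<le> \<delta> * M"
          using \<delta> by (simp add: norm_mult mult_left_mono)
        show ?thesis
          unfolding eq using norm_triangle_ineq4[of "integral {0..\<delta>} (\<lambda>l. A y l - A x l)" "of_real \<delta> * integral {0..1} (h \<delta>)"] n1 n2
          by (simp add: algebra_simps)
      qed
      have "((\<lambda>\<delta>. (N + M) * \<delta>) \<longlongrightarrow> (N + M) * 0) (at_right 0)"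
        by (intro tendsto_intros)
      moreover have "eventually (\<lambda>\<delta>. norm (f y - f x - integral {0..1} (h 1)) \<le> (N + M) * \<delta>) (at_right 0)"
        unfolding eventually_at_right_field using le by (intro exI[of _ 1]) auto
      ultimately have "norm (f y - f x - integral {0..1} (h 1)) \<le> (N + M) * 0"
        by (intro tendsto_lowerbound[where F = "at_right (0::real)"]) auto
      then have "f y - f x = integral {0..1} (h 1)" by simp
      also have "\<dots> = integral {0..1} (\<lambda>\<sigma>. \<Sum>s\<in>S. b s (y - x) * c s (x + \<sigma> *\<^sub>R (y - x)))"
        by (intro integral_cong) (auto simp: h_def C_eq XD[unfolded X_def u_def] X_def u_def)
      finally show ?thesis .
    qed
    obtain K where K: "\<And>s v. s \<in> S \<Longrightarrow> norm (b s v) \<le> K s * norm v" "\<And>s. s \<in> S \<Longrightarrow> 0 \<le> K s"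
      using bounded_linear.nonneg_bounded[OF b] by (metis mult.commute)
    \<comment> \<open>A continuous function, zero at \<open>x\<close>, that controls the change of
      all coefficients of the form at once.\<close>
    define \<phi> where "\<phi> = (\<lambda>z. \<Sum>s\<in>S. K s * norm (c s z - c s x))"
    have "continuous_on D \<phi>"
      unfolding \<phi>_def by (intro continuous_intros c_cont)
    then have \<phi>: "isCont \<phi> x"
      using D x continuous_on_eq_continuous_at by blast
    show ?thesis
      unfolding has_derivative_at_alt
    proof (intro conjI allI impI)
      show "bounded_linear (\<lambda>u. \<Sum>s\<in>S. b s u * c s x)"
        by (intro bounded_linear_sum bounded_linear_mult_const b)
      fix e :: real assume e: "e > 0"
      then obtain d where d: "d > 0" "\<And>z. dist z x < d \<Longrightarrow> dist (\<phi> z) (\<phi> x) < e"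
        using \<phi> unfolding continuous_at by (metis Lim_at dist_self LIM_def dist_nz)
      show "\<exists>d>0. \<forall>y. norm (y - x) < d \<longrightarrow>
          norm (f y - f x - (\<Sum>s\<in>S. b s (y - x) * c s x)) \<le> e * norm (y - x)"
      proof (intro exI[of _ "min d r"] conjI allI impI)
        show "min d r > 0" using d r by simp
        fix y assume y: "norm (y - x) < min d r"
        let ?X = "\<lambda>\<sigma>. x + \<sigma> *\<^sub>R (y - x)"
        have X: "dist (?X \<sigma>) x < min d r" if "\<sigma> \<in> {0..1}" for \<sigma>
        proof -
          have "\<bar>\<sigma>\<bar> * norm (y - x) \<le> 1 * norm (y - x)"
            using that by (intro mult_right_mono) auto
          then show ?thesis using y by (simp add: dist_norm)
        qed
        have XD: "?X \<sigma> \<in> D" if "\<sigma> \<in> {0..1}" for \<sigma>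
          using X[OF that] r by (auto simp: dist_commute)
        have cont: "continuous_on {0..1} (\<lambda>\<sigma>. \<Sum>s\<in>S. b s (y - x) * (c s (?X \<sigma>) - c s x))"
          by (intro continuous_intros continuous_on_compose2[OF c_cont]) (auto intro!: XD)
        have cont': "continuous_on {0..1} (\<lambda>\<sigma>. \<Sum>s\<in>S. b s (y - x) * c s (?X \<sigma>))"
          by (intro continuous_intros continuous_on_compose2[OF c_cont]) (auto intro!: XD)
        have bound: "norm (\<Sum>s\<in>S. b s (y - x) * (c s (?X \<sigma>) - c s x)) \<le> e * norm (y - x)"
          if \<sigma>: "\<sigma> \<in> {0..1}" for \<sigma>
        proof -
          have "norm (\<Sum>s\<in>S. b s (y - x) * (c s (?X \<sigma>) - c s x))
              \<le> (\<Sum>s\<in>S. norm (y - x) * (K s * norm (c s (?X \<sigma>) - c s x)))"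
          proof (rule sum_norm_le)
            fix s assume "s \<in> S"
            then show "norm (b s (y - x) * (c s (?X \<sigma>) - c s x)) \<le> norm (y - x) * (K s * norm (c s (?X \<sigma>) - c s x))"
              using mult_right_mono[OF K(1), of s "norm (c s (?X \<sigma>) - c s x)" "y - x"]
              by (simp add: norm_mult mult.assoc mult.left_commute)
          qed
          also have "\<dots> = norm (y - x) * \<phi> (?X \<sigma>)"
            by (simp add: \<phi>_def sum_distrib_left)
          also have "\<dots> \<le> norm (y - x) * e"
            using d(2)[of "?X \<sigma>"] X[OF \<sigma>] by (intro mult_left_mono) (simp_all add: \<phi>_def dist_real_def)
          finally show ?thesis by (simp only: mult.commute)
        qed
        have "y \<in> ball x r"
          using y by (simp add: dist_norm norm_minus_commute)
        then have "f y - f x - (\<Sum>s\<in>S. b s (y - x) * c s x)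
            = integral {0..1} (\<lambda>\<sigma>. \<Sum>s\<in>S. b s (y - x) * c s (?X \<sigma>))
              - integral {0..1} (\<lambda>\<sigma>::real. \<Sum>s\<in>S. b s (y - x) * c s x)"
          using diff by simp
        also have "\<dots> = integral {0..1} (\<lambda>\<sigma>. (\<Sum>s\<in>S. b s (y - x) * c s (?X \<sigma>)) - (\<Sum>s\<in>S. b s (y - x) * c s x))"
          by (rule integral_diff[symmetric]) (intro integrable_continuous_real cont' continuous_on_const)+
        also have "\<dots> = integral {0..1} (\<lambda>\<sigma>. \<Sum>s\<in>S. b s (y - x) * (c s (?X \<sigma>) - c s x))"
          by (simp add: sum_subtractf right_diff_distrib)
        finally have eq: "f y - f x - (\<Sum>s\<in>S. b s (y - x) * c s x)
            = integral {0..1} (\<lambda>\<sigma>. \<Sum>s\<in>S. b s (y - x) * (c s (?X \<sigma>) - c s x))" .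
        show "norm (f y - f x - (\<Sum>s\<in>S. b s (y - x) * c s x)) \<le> e * norm (y - x)"
          unfolding eq using integral_bound[OF _ cont bound] by simp
      qed
    qed
  qed
qed

section \<open>Matrix-valued calculus\<close>

definition cscale :: "complex \<Rightarrow> complex ^ 'm ^ 'm \<Rightarrow> complex ^ 'm ^ 'm" where
  "cscale c M = map_matrix (\<lambda>a. c * a) M"

lemma cscale_nth [simp]: "cscale c M $ i $ j = c * M $ i $ j"
  by (simp add: cscale_def)

lemma cscale_mult_left: "cscale c M ** N = cscale c (M ** N)"
  by (simp add: vec_eq_iff matrix_matrix_mult_def sum_distrib_left mult.assoc)

lemma cscale_mult_right: "M ** cscale c N = cscale c (M ** N)"
  by (simp add: vec_eq_iff matrix_matrix_mult_def sum_distrib_left mult.left_commute)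

lemma cscale_cscale: "cscale c (cscale d M) = cscale (c * d) M"
  by (simp add: vec_eq_iff mult.assoc)

lemma cscale_diff_right: "cscale c (M - N) = cscale c M - cscale c N"
  and cscale_0_right [simp]: "cscale c 0 = 0"
  and cscale_0_left [simp]: "cscale 0 M = 0"
  by (simp_all add: vec_eq_iff right_diff_distrib)

lemma bounded_bilinear_cscale: "bounded_bilinear (cscale :: complex \<Rightarrow> complex ^ 'm ^ 'm \<Rightarrow> _)"
  unfolding bilinear_conv_bounded_bilinear[symmetric] bilinear_def
  by (auto intro!: linearI simp: vec_eq_iff algebra_simps)

lemma bounded_bilinear_matrix_mult:
  "bounded_bilinear ((**) :: complex ^ 'm ^ 'm \<Rightarrow> complex ^ 'm ^ 'm \<Rightarrow> _)"
  unfolding bilinear_conv_bounded_bilinear[symmetric] bilinear_def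
  by (auto intro!: linearI simp: vec_eq_iff matrix_matrix_mult_def scaleR_sum_right sum.distrib algebra_simps)

lemma matrix_add_mult: "(A + B) ** C = A ** C + B ** (C :: 'a::semiring_1 ^ 'm ^ 'm)"
  by (simp add: vec_eq_iff matrix_matrix_mult_def sum.distrib distrib_right)

lemma matrix_sum_mult: "(\<Sum>s\<in>S. f s) ** (M :: 'a::semiring_1 ^ 'm ^ 'm) = (\<Sum>s\<in>S. f s ** M)"
  by (induction S rule: infinite_finite_induct) (auto simp: matrix_add_mult)

lemma matrix_mult_sum: "(M :: 'a::semiring_1 ^ 'm ^ 'm) ** (\<Sum>s\<in>S. f s) = (\<Sum>s\<in>S. M ** f s)"
  by (induction S rule: infinite_finite_induct) (auto simp: matrix_add_ldistrib)

lemma has_derivative_vec: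
  fixes f :: "'e::euclidean_space \<Rightarrow> ('a::euclidean_space) ^ 'm"
  assumes "\<And>i. ((\<lambda>x. f x $ i) has_derivative (\<lambda>u. f' u $ i)) F"
  shows "(f has_derivative f') F"
proof -
  have lin: "linear (\<lambda>u. f' u $ i)" for i
    using assms has_derivative_linear by blast
  have "linear f'"
    by (rule linearI) (simp_all add: vec_eq_iff linear_add[OF lin] linear_cmul[OF lin])
  moreover have "((\<lambda>y. ((f y - f (Lim F (\<lambda>x. x))) - f' (y - Lim F (\<lambda>x. x))) /\<^sub>R norm (y - Lim F (\<lambda>x. x))) \<longlongrightarrow> 0) F"
    by (rule vec_tendstoI) (use assms in \<open>simp add: has_derivative_def\<close>)
  ultimately show ?thesis
    by (simp add: has_derivative_def linear_conv_bounded_linear)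
qed

lemma has_derivative_matrix_iff:
  fixes f :: "'e::euclidean_space \<Rightarrow> complex ^ 'm ^ 'm"
  shows "(f has_derivative f') F \<longleftrightarrow>
    (\<forall>i j. ((\<lambda>x. f x $ i $ j) has_derivative (\<lambda>u. f' u $ i $ j)) F)"
proof (intro iffI allI)
  fix i j assume "(f has_derivative f') F"
  then show "((\<lambda>x. f x $ i $ j) has_derivative (\<lambda>u. f' u $ i $ j)) F"
    by (intro bounded_linear.has_derivative[OF bounded_linear_vec_nth])
next
  assume "\<forall>i j. ((\<lambda>x. f x $ i $ j) has_derivative (\<lambda>u. f' u $ i $ j)) F"
  then show "(f has_derivative f') F"
    by (intro has_derivative_vec) auto
qed

section \<open>Gauge transformations between residue forms\<close>

lemma residue_form_cscale: "residue_form b t R x v = (\<Sum>s\<in>R. cscale (log_form (b s) x v) (t s))"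
  by (simp add: residue_form_def cscale_def)

lemma integrable_form_commute:
  "integrable_form D \<theta> \<Longrightarrow> x \<in> D \<Longrightarrow> \<theta> x u ** \<theta> x v = \<theta> x v ** \<theta> x u"
  by (simp add: integrable_form_def wedge_def)

text \<open>
  \<open>L\<close> and \<open>R\<close> index the poles of the two forms. They may only differ in hyperplanes that avoid the
  centre \<open>p\<close>. The domain is star-shaped about \<open>p\<close>, which it contains iff no hyperplane passes through \<open>p\<close>.
\<close>

locale gauge =
  fixes S L R :: "'s set" and b :: "'s \<Rightarrow> complex ^ 'n \<Rightarrow> complex" and t :: "'s \<Rightarrow> complex ^ 'm ^ 'm"
    and p :: "complex ^ 'n" and D :: "(complex ^ 'n) set"
  assumes fin: "finite S" and LS: "L \<subseteq> S" and RS: "R \<subseteq> S"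
    and LR: "\<And>s. s \<in> S \<Longrightarrow> b s p = 0 \<Longrightarrow> s \<in> L \<longleftrightarrow> s \<in> R"
    and b_linear: "\<And>s. s \<in> S \<Longrightarrow> linear_form (b s)"
    and D_eq: "D = {x. \<forall>s\<in>S. if b s p = 0 then b s x \<noteq> 0 else norm (b s (x - p)) < norm (b s p)}"
    and flat_L: "integrable_form D (residue_form b t L)"
    and flat_R: "integrable_form D (residue_form b t R)"
begin

abbreviation thL where "thL \<equiv> residue_form b t L"
abbreviation thR where "thR \<equiv> residue_form b t R"

lemma b_bounded_linear: "s \<in> S \<Longrightarrow> bounded_linear (b s)"
  using b_linear linear_form_bounded_linear by blast

lemma b_continuous: "s \<in> S \<Longrightarrow> continuous_on A (b s)"
  using b_bounded_linear by (intro linear_continuous_on)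

lemma open_D: "open D"
proof -
  have o: "open {x. if b s p = 0 then b s x \<noteq> 0 else norm (b s (x - p)) < norm (b s p)}" if "s \<in> S" for s
    using that by (cases "b s p = 0")
      (auto intro!: open_Collect_neq open_Collect_less continuous_intros bounded_linear.continuous_on[OF b_bounded_linear])
  have D_INT: "D = (\<Inter>s\<in>S. {x. if b s p = 0 then b s x \<noteq> 0 else norm (b s (x - p)) < norm (b s p)})"
    unfolding D_eq by blast
  show ?thesis
    unfolding D_INT by (rule open_INT[OF fin]) (use o in blast)
qed

lemma b_ray: "s \<in> S \<Longrightarrow> b s (p + l *\<^sub>R (x - p)) = b s p + of_real l * b s (x - p)"
  using linear_form_add[OF b_linear] linear_form_scaleR[OF b_linear] by simp

lemma b_ray_nonzero:
  assumes "s \<in> S" "b s p \<noteq> 0" "x \<in> D" "0 \<le> l" "l \<le> 1"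
  shows "b s (p + l *\<^sub>R (x - p)) \<noteq> 0"
proof
  assume "b s (p + l *\<^sub>R (x - p)) = 0"
  then have "b s p = - (of_real l * b s (x - p))"
    using assms(1) by (simp add: b_ray eq_neg_iff_add_eq_0)
  then have "norm (b s p) = l * norm (b s (x - p))"
    using assms(4) by (simp add: norm_mult)
  also have "\<dots> \<le> 1 * norm (b s (x - p))"
    using assms(5) by (intro mult_right_mono) auto
  also have "\<dots> < norm (b s p)"
    using assms by (auto simp: D_eq)
  finally show False by simp
qed

lemma b_nonzero: "s \<in> S \<Longrightarrow> x \<in> D \<Longrightarrow> b s x \<noteq> 0"
  using b_ray_nonzero[of s x 1] by (cases "b s p = 0") (auto simp: D_eq)

lemma star_D:
  assumes "x \<in> D" "0 < l" "l \<le> 1"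
  shows "p + l *\<^sub>R (x - p) \<in> D"
  unfolding D_eq
proof (intro CollectI ballI)
  fix s assume s: "s \<in> S"
  show "if b s p = 0 then b s (p + l *\<^sub>R (x - p)) \<noteq> 0 else norm (b s (p + l *\<^sub>R (x - p) - p)) < norm (b s p)"
  proof (cases "b s p = 0")
    case True
    then show ?thesis
      using assms s b_nonzero[of s x] by (simp add: b_ray linear_form_diff[OF b_linear])
  next
    case False
    then have "norm (b s (x - p)) < norm (b s p)"
      using assms s by (auto simp: D_eq)
    moreover have "l * norm (b s (x - p)) \<le> 1 * norm (b s (x - p))"
      using assms by (intro mult_right_mono) auto
    ultimately show ?thesis
      using False assms s by (simp add: linear_form_scaleR[OF b_linear] norm_mult)
  qed
qed

text \<open>Up to the factor \<open>\<kappa>0\<close>, the residue at the hyperplane of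
  \<open>s\<close> of the connection that sends \<open>M\<close> to
  \<open>thL M - M thR\<close>.\<close>

definition residue_act :: "'s \<Rightarrow> complex ^ 'm ^ 'm \<Rightarrow> complex ^ 'm ^ 'm" where
  "residue_act s M = (if s \<in> L then t s ** M else 0) - (if s \<in> R then M ** t s else 0)"

lemma bounded_linear_residue_act: "bounded_linear (residue_act s)"
  unfolding residue_act_def
  using bounded_bilinear.bounded_linear_right[OF bounded_bilinear_matrix_mult, of "t s"]
    bounded_bilinear.bounded_linear_left[OF bounded_bilinear_matrix_mult, of "t s"]
  by (cases "s \<in> L"; cases "s \<in> R") (auto intro!: bounded_linear_sub bounded_linear_zero simp: bounded_linear_minus)

abbreviation \<kappa>0 :: complex where "\<kappa>0 \<equiv> 1 / (\<i> * of_real pi)"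

lemma sum_residue_act:
  "(\<Sum>s\<in>S. cscale (b s v) (cscale (\<kappa>0 / b s x) (residue_act s M))) = thL x v ** M - M ** thR x v"
proof -
  have "(\<Sum>s\<in>S. cscale (b s v) (cscale (\<kappa>0 / b s x) (residue_act s M)))
      = (\<Sum>s\<in>S. (if s \<in> L then cscale (log_form (b s) x v) (t s ** M) else 0)
          - (if s \<in> R then cscale (log_form (b s) x v) (M ** t s) else 0))"
    by (intro sum.cong)
       (auto simp: residue_act_def log_form_def cscale_cscale cscale_diff_right mult.commute)
  also have "\<dots> = (\<Sum>s\<in>L. cscale (log_form (b s) x v) (t s ** M)) - (\<Sum>s\<in>R. cscale (log_form (b s) x v) (M ** t s))"
    using fin LS RS by (simp add: sum_subtractf flip: sum.inter_restrict) (simp add: Int_absorb1)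
  finally show ?thesis
    by (simp add: residue_form_cscale matrix_sum_mult matrix_mult_sum cscale_mult_left cscale_mult_right)
qed

text \<open>The coefficient of \<open>h^k\<close> in the gauge transformation: a primitive of
  \<open>thL coeff - coeff thR\<close> at the previous order, obtained by integration along the ray
  from \<open>p\<close>. The integrand is written as a combination of the constant differentials
  \<open>b s\<close>, the shape that \<open>singular_primitive\<close> treats.\<close>

primrec coeff :: "nat \<Rightarrow> complex ^ 'n \<Rightarrow> complex ^ 'm ^ 'm" where
  "coeff 0 = (\<lambda>x. mat 1)"
| "coeff (Suc k) = (\<lambda>x. \<chi> i j. integral {0..1} (\<lambda>l. \<Sum>s\<in>S. b s (x - p) *
     cscale (\<kappa>0 / b s (p + l *\<^sub>R (x - p))) (residue_act s (coeff k (p + l *\<^sub>R (x - p)))) $ i $ j))"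

definition deriv_coeff :: "nat \<Rightarrow> complex ^ 'n \<Rightarrow> complex ^ 'n \<Rightarrow> complex ^ 'm ^ 'm" where
  "deriv_coeff k x v = (case k of 0 \<Rightarrow> 0 | Suc k' \<Rightarrow> thL x v ** coeff k' x - coeff k' x ** thR x v)"

text \<open>The coefficient of the differential \<open>b s\<close> in the 1-form that is integrated
  to give \<open>coeff (Suc k)\<close>.\<close>

definition pole :: "nat \<Rightarrow> 's \<Rightarrow> complex ^ 'n \<Rightarrow> complex ^ 'm ^ 'm" where
  "pole k s x = cscale (\<kappa>0 / b s x) (residue_act s (coeff k x))"

definition deriv_pole :: "nat \<Rightarrow> 's \<Rightarrow> complex ^ 'n \<Rightarrow> complex ^ 'n \<Rightarrow> complex ^ 'm ^ 'm" where
  "deriv_pole k s x u = cscale (\<kappa>0 / b s x) (residue_act s (deriv_coeff k x u))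
     + cscale (- \<kappa>0 * b s u / (b s x)\<^sup>2) (residue_act s (coeff k x))"

lemma deriv_coeff_Suc: "deriv_coeff (Suc k) x v = (\<Sum>s\<in>S. cscale (b s v) (pole k s x))"
  unfolding deriv_coeff_def pole_def sum_residue_act by simp

lemma has_derivative_pole:
  assumes "(coeff k has_derivative deriv_coeff k x) (at x)" "s \<in> S" "x \<in> D"
  shows "(pole k s has_derivative deriv_pole k s x) (at x)"
proof -
  have "((\<lambda>x. \<kappa>0 / b s x) has_derivative (\<lambda>u. - \<kappa>0 * b s u / (b s x)\<^sup>2)) (at x)"
    using linear_form_has_derivative[OF b_linear[OF assms(2)], of "at x"] b_nonzero[OF assms(2,3)]
    by (auto intro!: derivative_eq_intros simp: power2_eq_square field_simps)
  then have "((\<lambda>x. cscale (\<kappa>0 / b s x) (residue_act s (coeff k x))) has_derivative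
      (\<lambda>u. cscale (\<kappa>0 / b s x) (residue_act s (deriv_coeff k x u))
         + cscale (- \<kappa>0 * b s u / (b s x)\<^sup>2) (residue_act s (coeff k x)))) (at x)"
    by (intro bounded_bilinear.FDERIV[OF bounded_bilinear_cscale]
        bounded_linear.has_derivative[OF bounded_linear_residue_act] assms)
  then show ?thesis
    unfolding pole_def[abs_def] deriv_pole_def[abs_def] .
qed

text \<open>This is closedness of the form to be integrated. The terms from differentiating
  \<open>1 / b s\<close> are symmetric in \<open>u\<close> and \<open>v\<close> one by one. In the
  others, flatness makes the values of \<open>thL\<close> at a point commute with each other,
  likewise those of \<open>thR\<close>, and the two mixed terms are exchanged.\<close>

lemma deriv_pole_symmetric:
  assumes "x \<in> D"
  shows "(\<Sum>s\<in>S. cscale (b s v) (deriv_pole k s x u)) = (\<Sum>s\<in>S. cscale (b s u) (deriv_pole k s x v))"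
proof -
  have eq: "(\<Sum>s\<in>S. cscale (b s v) (deriv_pole k s x u))
      = (thL x v ** deriv_coeff k x u - deriv_coeff k x u ** thR x v)
        + (\<Sum>s\<in>S. cscale (- \<kappa>0 * (b s u * b s v) / (b s x)\<^sup>2) (residue_act s (coeff k x)))" for u v
    unfolding sum_residue_act[symmetric] sum.distrib[symmetric]
    by (intro sum.cong) (auto simp: deriv_pole_def vec_eq_iff algebra_simps)
  have "thL x v ** deriv_coeff k x u - deriv_coeff k x u ** thR x v
      = thL x u ** deriv_coeff k x v - deriv_coeff k x v ** thR x u"
  proof (cases k)
    case (Suc k')
    have l: "thL x u ** (thL x v ** M) = thL x v ** (thL x u ** M)" for M
      using integrable_form_commute[OF flat_L assms, of u v] by (simp add: matrix_mul_assoc)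
    have r: "M ** thR x u ** thR x v = M ** thR x v ** thR x u" for M
      using integrable_form_commute[OF flat_R assms, of u v] by (simp flip: matrix_mul_assoc)
    have diff: "A ** (B - C) = A ** B - A ** C" "(B - C) ** A = B ** A - C ** A"
      for A B C :: "complex ^ 'm ^ 'm"
      by (simp_all add: bounded_bilinear.diff_right[OF bounded_bilinear_matrix_mult]
          bounded_bilinear.diff_left[OF bounded_bilinear_matrix_mult])
    show ?thesis
      unfolding Suc deriv_coeff_def nat.case diff
      using l[of "coeff k' x"] r[of "coeff k' x"] by (simp add: matrix_mul_assoc)
  qed (simp add: deriv_coeff_def)
  then show ?thesis
    unfolding eq by (simp add: mult.commute)
qed

text \<open>The factor \<open>l / b s\<close> on the ray through \<open>x\<close>, continued to the start \<open>l = 0\<close>.\<close>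

definition ray_factor :: "'s \<Rightarrow> real \<times> (complex ^ 'n) \<Rightarrow> complex" where
  "ray_factor s = (\<lambda>(l, x). if b s p = 0 then 1 / b s x else of_real l / b s (p + l *\<^sub>R (x - p)))"

lemma ray_factor_continuous:
  assumes "s \<in> S" shows "continuous_on ({0..1} \<times> D) (ray_factor s)"
proof (cases "b s p = 0")
  case True
  then show ?thesis
    unfolding ray_factor_def split_beta using assms b_nonzero
    by (auto intro!: continuous_intros bounded_linear.continuous_on[OF b_bounded_linear])
next
  case False
  then show ?thesis
    unfolding ray_factor_def split_beta using assms b_ray_nonzero
    by (auto intro!: continuous_intros bounded_linear.continuous_on[OF b_bounded_linear])
qed

lemma ray_factor_eq:
  assumes "s \<in> S" "l > 0" shows "ray_factor s (l, x) = of_real l / b s (p + l *\<^sub>R (x - p))"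
  using assms by (simp add: ray_factor_def b_ray linear_form_diff[OF b_linear])

text \<open>If \<open>b s\<close> vanishes at \<open>p\<close>, then by \<open>LR\<close> the index
  \<open>s\<close> belongs to both pole sets or to neither, and \<open>residue_act s\<close> kills
  the identity matrix. Otherwise \<open>b s\<close> has no zero on the ray, start included.\<close>

lemma pole_ray_0:
  assumes "s \<in> S"
  shows "\<exists>C. continuous_on ({0..1} \<times> D) C \<and>
    (\<forall>x\<in>D. \<forall>l. 0 < l \<and> l \<le> 1 \<longrightarrow> C (l, x) = pole 0 s (p + l *\<^sub>R (x - p)))"
proof (cases "b s p = 0")
  case True
  then have "residue_act s (mat 1) = 0"
    using LR assms by (auto simp: residue_act_def)
  then show ?thesis
    by (intro exI[of _ "\<lambda>z. 0"]) (auto simp: pole_def)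
next
  case False
  then show ?thesis
    using assms b_ray_nonzero
    by (intro exI[of _ "\<lambda>z. cscale (\<kappa>0 / b s (p + fst z *\<^sub>R (snd z - p))) (residue_act s (mat 1))"])
       (auto simp: pole_def intro!: bounded_bilinear.continuous_on[OF bounded_bilinear_cscale]
          continuous_intros bounded_linear.continuous_on[OF b_bounded_linear])
qed

text \<open>The factor \<open>l\<close> of the coefficient joins \<open>1 / b s\<close> to form
  \<open>ray_factor\<close>, which is continuous up to the start of the ray.\<close>

lemma pole_ray_Suc:
  assumes "s \<in> S" and \<kappa>: "continuous_on ({0..1} \<times> D) \<kappa>"
    "\<And>x l. x \<in> D \<Longrightarrow> 0 < l \<Longrightarrow> l \<le> 1 \<Longrightarrow> coeff k (p + l *\<^sub>R (x - p)) = cscale (of_real l) (\<kappa> (l, x))"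
  shows "\<exists>C. continuous_on ({0..1} \<times> D) C \<and>
    (\<forall>x\<in>D. \<forall>l. 0 < l \<and> l \<le> 1 \<longrightarrow> C (l, x) = pole k s (p + l *\<^sub>R (x - p)))"
proof (intro exI conjI ballI allI impI)
  let ?C = "\<lambda>z. cscale (\<kappa>0 * ray_factor s z) (residue_act s (\<kappa> z))"
  show "continuous_on ({0..1} \<times> D) ?C"
    by (intro bounded_bilinear.continuous_on[OF bounded_bilinear_cscale] continuous_intros
        bounded_linear.continuous_on[OF bounded_linear_residue_act] \<kappa> ray_factor_continuous assms)
  fix x l assume x: "x \<in> D" and l: "(0::real) < l \<and> l \<le> 1"
  have "residue_act s (cscale c M) = cscale c (residue_act s M)" for c M
    by (simp add: residue_act_def cscale_mult_left cscale_mult_right cscale_diff_right)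
  then show "?C (l, x) = pole k s (p + l *\<^sub>R (x - p))"
    using \<kappa>(2)[OF x] l by (simp add: pole_def ray_factor_eq[OF assms(1)] cscale_cscale)
qed

text \<open>The clauses support each other: derivative, continuity and extension of the poles to the
  start of rays are what \<open>singular_primitive\<close> takes at order \<open>k\<close>; it
  returns the derivative and the factor \<open>l\<close> at order \<open>Suc k\<close>, and this
  factor extends the next poles. At order 0 the coefficient is the identity and has no such factor,
  hence the condition \<open>k > 0\<close>, with \<open>pole_ray_0\<close> starting the
  induction.\<close>

lemma coeff_properties:
  "(\<forall>x\<in>D. (coeff k has_derivative deriv_coeff k x) (at x)) \<and>
   (\<forall>u. continuous_on D (\<lambda>x. deriv_coeff k x u)) \<and>
   (\<forall>s\<in>S. \<exists>C. continuous_on ({0..1} \<times> D) C \<and>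
      (\<forall>x\<in>D. \<forall>l. 0 < l \<and> l \<le> 1 \<longrightarrow> C (l, x) = pole k s (p + l *\<^sub>R (x - p)))) \<and>
   (k > 0 \<longrightarrow> (\<exists>\<kappa>. continuous_on ({0..1} \<times> D) \<kappa> \<and>
      (\<forall>x\<in>D. \<forall>l. 0 < l \<and> l \<le> 1 \<longrightarrow> coeff k (p + l *\<^sub>R (x - p)) = cscale (of_real l) (\<kappa> (l, x)))))"
proof (induction k)
  case 0
  then show ?case
    using pole_ray_0 by (auto simp: deriv_coeff_def)
next
  case (Suc k)
  then have der: "\<And>x. x \<in> D \<Longrightarrow> (coeff k has_derivative deriv_coeff k x) (at x)"
    and cont: "\<And>u. continuous_on D (\<lambda>x. deriv_coeff k x u)"
    and ray: "\<forall>s\<in>S. \<exists>C. continuous_on ({0..1} \<times> D) C \<and>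
      (\<forall>x\<in>D. \<forall>l. 0 < l \<and> l \<le> 1 \<longrightarrow> C (l, x) = pole k s (p + l *\<^sub>R (x - p)))"
    by auto
  obtain C where C: "\<And>s. s \<in> S \<Longrightarrow> continuous_on ({0..1} \<times> D) (C s)"
    "\<And>s x l. s \<in> S \<Longrightarrow> x \<in> D \<Longrightarrow> 0 < l \<Longrightarrow> l \<le> 1 \<Longrightarrow> C s (l, x) = pole k s (p + l *\<^sub>R (x - p))"
    using bchoice[OF ray] by auto
  have coeff_cont: "continuous_on D (coeff k)"
    using der has_derivative_continuous by (intro continuous_at_imp_continuous_on) blast
  have pole_der: "s \<in> S \<Longrightarrow> x \<in> D \<Longrightarrow> (pole k s has_derivative deriv_pole k s x) (at x)" for s x
    using has_derivative_pole der by blast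
  then have pole_cont: "s \<in> S \<Longrightarrow> continuous_on D (pole k s)" for s
    using has_derivative_continuous by (intro continuous_at_imp_continuous_on) blast
  have nth_cont: "continuous_on A (\<lambda>z. f z $ i $ j)" if "continuous_on A f"
    for A and f :: "'q::topological_space \<Rightarrow> complex ^ 'm ^ 'm" and i j
    using that by (intro bounded_linear.continuous_on[OF bounded_linear_vec_nth])
  have deriv_pole_cont: "continuous_on D (\<lambda>x. deriv_pole k s x u)" if "s \<in> S" for s u
    unfolding deriv_pole_def using that b_nonzero
    by (intro continuous_intros bounded_bilinear.continuous_on[OF bounded_bilinear_cscale]
        bounded_linear.continuous_on[OF bounded_linear_residue_act] b_continuous coeff_cont cont) auto
  have sym: "(\<Sum>s\<in>S. b s v * deriv_pole k s x u $ i $ j)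
      = (\<Sum>s\<in>S. b s u * deriv_pole k s x v $ i $ j)" if "x \<in> D" for x u v i j
    using arg_cong[OF deriv_pole_symmetric[OF that, of v k u], of "\<lambda>M. M $ i $ j"]
    by simp
  note prim = fin open_D star_D b_bounded_linear has_derivative_matrix_iff[THEN iffD1, rule_format, OF pole_der]
    nth_cont[OF deriv_pole_cont] sym nth_cont[OF C(1)]
    arg_cong[where f = "\<lambda>M. M $ _ $ _", OF C(2)]
  have coeff_Suc: "coeff (Suc k) x $ i $ j
      = integral {0..1} (\<lambda>l. \<Sum>s\<in>S. b s (x - p) * pole k s (p + l *\<^sub>R (x - p)) $ i $ j)" for x i j
    by (simp add: pole_def)
  have der': "(coeff (Suc k) has_derivative deriv_coeff (Suc k) x) (at x)" if x: "x \<in> D" for x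
    unfolding has_derivative_matrix_iff coeff_Suc
  proof (intro allI)
    fix i j
    have "(\<lambda>u. deriv_coeff (Suc k) x u $ i $ j)
        = (\<lambda>u. \<Sum>s\<in>S. b s u * pole k s x $ i $ j)"
      by (simp add: deriv_coeff_Suc)
    then show "((\<lambda>x. integral {0..1} (\<lambda>l. \<Sum>s\<in>S. b s (x - p) * pole k s (p + l *\<^sub>R (x - p)) $ i $ j))
        has_derivative (\<lambda>u. deriv_coeff (Suc k) x u $ i $ j)) (at x)"
      using singular_primitive_derivative[OF prim x, of i j] by simp
  qed
  have "\<exists>\<kappa>. continuous_on ({0..1} \<times> D) \<kappa> \<and> (\<forall>x\<in>D. \<forall>l. 0 < l \<and> l \<le> 1 \<longrightarrow>
      coeff (Suc k) (p + l *\<^sub>R (x - p)) $ i $ j = of_real l * \<kappa> (l, x))" for i j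
    unfolding coeff_Suc by (rule singular_primitive_ray[OF prim])
  then obtain \<kappa> where \<kappa>: "\<And>i j. continuous_on ({0..1} \<times> D) (\<kappa> i j)"
    "\<And>x l i j. x \<in> D \<Longrightarrow> 0 < l \<Longrightarrow> l \<le> 1 \<Longrightarrow>
      coeff (Suc k) (p + l *\<^sub>R (x - p)) $ i $ j = of_real l * \<kappa> i j (l, x)"
    by metis
  have ray': "continuous_on ({0..1} \<times> D) (\<lambda>z. \<chi> i j. \<kappa> i j z)"
    "\<And>x l. x \<in> D \<Longrightarrow> 0 < l \<Longrightarrow> l \<le> 1 \<Longrightarrow>
      coeff (Suc k) (p + l *\<^sub>R (x - p)) = cscale (of_real l) (\<chi> i j. \<kappa> i j (l, x))"
    using \<kappa> by (auto intro!: continuous_intros simp: vec_eq_iff simp del: coeff.simps)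
  have cont': "continuous_on D (\<lambda>x. deriv_coeff (Suc k) x u)" for u
    unfolding deriv_coeff_Suc
    by (intro continuous_on_sum bounded_bilinear.continuous_on[OF bounded_bilinear_cscale] continuous_on_const pole_cont)
  have "\<forall>x\<in>D. (coeff (Suc k) has_derivative deriv_coeff (Suc k) x) (at x)"
    and "\<forall>u. continuous_on D (\<lambda>x. deriv_coeff (Suc k) x u)"
    and "\<forall>s\<in>S. \<exists>C. continuous_on ({0..1} \<times> D) C \<and>
      (\<forall>x\<in>D. \<forall>l. 0 < l \<and> l \<le> 1 \<longrightarrow> C (l, x) = pole (Suc k) s (p + l *\<^sub>R (x - p)))"
    using der' cont' pole_ray_Suc[OF _ ray'] by blast+
  moreover have "\<exists>\<kappa>. continuous_on ({0..1} \<times> D) \<kappa> \<and>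
      (\<forall>x\<in>D. \<forall>l. 0 < l \<and> l \<le> 1 \<longrightarrow> coeff (Suc k) (p + l *\<^sub>R (x - p)) = cscale (of_real l) (\<kappa> (l, x)))"
    by (intro exI[of _ "\<lambda>z. \<chi> i j. \<kappa> i j z"] conjI ballI allI impI ray'(1)) (rule ray'(2), auto)
  ultimately show ?case
    by blast
qed

theorem gauge_exists:
  obtains K :: "nat \<Rightarrow> complex ^ 'n \<Rightarrow> complex ^ 'm ^ 'm"
  where "K 0 = (\<lambda>x. mat 1)"
    and "\<And>k x. x \<in> D \<Longrightarrow> (K (Suc k) has_derivative (\<lambda>v. thL x v ** K k x - K k x ** thR x v)) (at x)"
    and "\<And>k x. x \<in> D \<Longrightarrow> ((\<lambda>l. K (Suc k) (p + l *\<^sub>R (x - p))) \<longlongrightarrow> 0) (at_right 0)"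
proof (rule that[of coeff])
  show "coeff 0 = (\<lambda>x. mat 1)" by simp
  fix k x assume x: "x \<in> D"
  have "(coeff (Suc k) has_derivative deriv_coeff (Suc k) x) (at x)"
    using coeff_properties[of "Suc k"] x by blast
  moreover have "deriv_coeff (Suc k) x = (\<lambda>v. thL x v ** coeff k x - coeff k x ** thR x v)"
    by (simp add: fun_eq_iff deriv_coeff_def)
  ultimately show "(coeff (Suc k) has_derivative (\<lambda>v. thL x v ** coeff k x - coeff k x ** thR x v)) (at x)"
    by simp
  obtain \<kappa> where \<kappa>: "continuous_on ({0..1} \<times> D) \<kappa>"
    "\<And>l. 0 < l \<Longrightarrow> l \<le> 1 \<Longrightarrow> coeff (Suc k) (p + l *\<^sub>R (x - p)) = cscale (of_real l) (\<kappa> (l, x))"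
    using coeff_properties[of "Suc k"] x by blast
  have "continuous_on {0..1} (\<lambda>l. cscale (of_real l) (\<kappa> (l, x)))"
    using x by (intro bounded_bilinear.continuous_on[OF bounded_bilinear_cscale] continuous_intros
        continuous_on_compose2[OF \<kappa>(1)]) auto
  then have "((\<lambda>l. cscale (of_real l) (\<kappa> (l, x))) \<longlongrightarrow> cscale (of_real 0) (\<kappa> (0, x))) (at 0 within {0..1})"
    unfolding continuous_on_def by (rule bspec) simp
  then have "((\<lambda>l. cscale (of_real l) (\<kappa> (l, x))) \<longlongrightarrow> 0) (at_right 0)"
    by (simp add: at_within_Icc_at_right)
  then show "((\<lambda>l. coeff (Suc k) (p + l *\<^sub>R (x - p))) \<longlongrightarrow> 0) (at_right 0)"
  proof (rule Lim_transform_eventually)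
    show "\<forall>\<^sub>F l in at_right 0. cscale (of_real l) (\<kappa> (l, x)) = coeff (Suc k) (p + l *\<^sub>R (x - p))"
      unfolding eventually_at_right_field using \<kappa>(2) by (intro exI[of _ 1]) auto
  qed
qed

end

lemma matrix_mult_zero [simp]:
  "(0 :: complex ^ 'a ^ 'b) ** M = 0" "M ** (0 :: complex ^ 'a ^ 'b) = 0"
  by (simp_all add: vec_eq_iff matrix_matrix_mult_def)

section \<open>Flat sections with values in matrices of power series\<close>

definition hcoeff :: "nat \<Rightarrow> complex fps ^ 'm ^ 'm \<Rightarrow> complex ^ 'm ^ 'm" where
  "hcoeff k M = map_matrix (\<lambda>a. fps_nth a k) M"

lemma hcoeff_nth [simp]: "hcoeff k M $ i $ j = fps_nth (M $ i $ j) k"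
  by (simp add: hcoeff_def)

lemma hcoeff_eqI: "(\<And>k. hcoeff k M = hcoeff k N) \<Longrightarrow> M = N"
  by (auto simp: vec_eq_iff fps_eq_iff)

lemma hcoeff_mult: "hcoeff k (M ** N) = (\<Sum>i=0..k. hcoeff i M ** hcoeff (k - i) N)"
proof -
  have "hcoeff k (M ** N) $ i $ j = (\<Sum>i'=0..k. hcoeff i' M ** hcoeff (k - i') N) $ i $ j" for i j
    by (simp add: matrix_matrix_mult_def fps_sum_nth fps_mult_nth) (rule sum.swap)
  then show ?thesis by (simp add: vec_eq_iff)
qed

lemma hcoeff_mat_1: "hcoeff k (mat 1) = (if k = 0 then mat 1 else 0)"
  by (simp add: vec_eq_iff mat_def)

lemma hcoeff_h_times_mult:
  "hcoeff 0 (h_times \<theta> x v ** M) = 0"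
  "hcoeff (Suc k) (h_times \<theta> x v ** M) = \<theta> x v ** hcoeff k M"
  by (simp_all add: vec_eq_iff matrix_matrix_mult_def h_times_def fps_sum_nth mult.assoc)

text \<open>The equation \<open>dF = h (\<theta> F - F \<theta>')\<close> sorted by powers of
  \<open>h\<close>. With \<open>zero_form\<close> on the right its sections are the solutions of
  \<open>dF = h \<theta> F\<close>, with two forms they are gauge transformations; so uniqueness and
  products are treated once for both.\<close>

definition gauge_on ::
  "(complex ^ 'n) set \<Rightarrow> (complex ^ 'n \<Rightarrow> complex ^ 'n \<Rightarrow> complex ^ 'm ^ 'm) \<Rightarrow>
   (complex ^ 'n \<Rightarrow> complex ^ 'n \<Rightarrow> complex ^ 'm ^ 'm) \<Rightarrow> (complex ^ 'n \<Rightarrow> complex fps ^ 'm ^ 'm) \<Rightarrow> bool" where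
  "gauge_on U \<theta> \<theta>' F \<longleftrightarrow> (\<forall>x\<in>U. ((\<lambda>y. hcoeff 0 (F y)) has_derivative (\<lambda>v. 0)) (at x) \<and>
     (\<forall>k. ((\<lambda>y. hcoeff (Suc k) (F y)) has_derivative
        (\<lambda>v. \<theta> x v ** hcoeff k (F x) - hcoeff k (F x) ** \<theta>' x v)) (at x)))"

abbreviation zero_form :: "complex ^ 'n \<Rightarrow> complex ^ 'n \<Rightarrow> complex ^ 'm ^ 'm" where
  "zero_form \<equiv> \<lambda>x v. 0"

lemma gauge_on_subset: "gauge_on U \<theta> \<theta>' F \<Longrightarrow> V \<subseteq> U \<Longrightarrow> gauge_on V \<theta> \<theta>' F"
  unfolding gauge_on_def by blast

lemma solution_on_iff_gauge_on: "solution_on U (h_times \<theta>) F \<longleftrightarrow> gauge_on U \<theta> zero_form F"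
proof -
  have split: "(\<forall>k. P k) \<longleftrightarrow> P 0 \<and> (\<forall>k. P (Suc k))" for P :: "nat \<Rightarrow> bool"
    by (metis nat.exhaust)
  have "(\<forall>i j k. ((\<lambda>y. fps_nth (F y $ i $ j) k) has_derivative
           (\<lambda>v. fps_nth ((h_times \<theta> x v ** F x) $ i $ j) k)) (at x))
      \<longleftrightarrow> (\<forall>k. ((\<lambda>y. hcoeff k (F y)) has_derivative (\<lambda>v. hcoeff k (h_times \<theta> x v ** F x))) (at x))" for x
    unfolding has_derivative_matrix_iff hcoeff_nth by blast
  moreover have "(\<forall>k. ((\<lambda>y. hcoeff k (F y)) has_derivative (\<lambda>v. hcoeff k (h_times \<theta> x v ** F x))) (at x))
      \<longleftrightarrow> ((\<lambda>y. hcoeff 0 (F y)) has_derivative (\<lambda>v. 0)) (at x) \<and>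
     (\<forall>k. ((\<lambda>y. hcoeff (Suc k) (F y)) has_derivative (\<lambda>v. \<theta> x v ** hcoeff k (F x) - hcoeff k (F x) ** 0)) (at x))" for x
    by (subst split) (simp only: hcoeff_h_times_mult matrix_mult_zero diff_zero)
  ultimately show ?thesis
    unfolding solution_on_def gauge_on_def by simp
qed

text \<open>In the product rule the two contributions of the middle form \<open>\<theta>'\<close>
  cancel.\<close>

lemma gauge_on_mult:
  assumes F: "gauge_on U \<theta> \<theta>' F" and G: "gauge_on U \<theta>' \<theta>'' G"
  shows "gauge_on U \<theta> \<theta>'' (\<lambda>x. F x ** G x)"
  unfolding gauge_on_def
proof (intro ballI conjI allI)
  fix x assume x: "x \<in> U"
  define DF where "DF = (\<lambda>k v. case k of 0 \<Rightarrow> 0 | Suc k \<Rightarrow> \<theta> x v ** hcoeff k (F x) - hcoeff k (F x) ** \<theta>' x v)"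
  define DG where "DG = (\<lambda>k v. case k of 0 \<Rightarrow> 0 | Suc k \<Rightarrow> \<theta>' x v ** hcoeff k (G x) - hcoeff k (G x) ** \<theta>'' x v)"
  have dF: "((\<lambda>y. hcoeff k (F y)) has_derivative DF k) (at x)" for k
    using F x by (cases k) (auto simp: gauge_on_def DF_def)
  have dG: "((\<lambda>y. hcoeff k (G y)) has_derivative DG k) (at x)" for k
    using G x by (cases k) (auto simp: gauge_on_def DG_def)
  have d: "((\<lambda>y. hcoeff k (F y ** G y)) has_derivative
      (\<lambda>v. \<Sum>i=0..k. hcoeff i (F x) ** DG (k - i) v + DF i v ** hcoeff (k - i) (G x))) (at x)" for k
    unfolding hcoeff_mult
    by (intro has_derivative_sum bounded_bilinear.FDERIV[OF bounded_bilinear_matrix_mult] dF dG)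
  show "((\<lambda>y. hcoeff 0 (F y ** G y)) has_derivative (\<lambda>v. 0)) (at x)"
    using d[of 0] by (simp add: DF_def DG_def)
  fix k
  have "(\<Sum>i=0..Suc k. hcoeff i (F x) ** DG (Suc k - i) v + DF i v ** hcoeff (Suc k - i) (G x))
      = \<theta> x v ** hcoeff k (F x ** G x) - hcoeff k (F x ** G x) ** \<theta>'' x v" for v
  proof -
    have diff: "A ** (B - C) = A ** B - A ** C" "(B - C) ** A = B ** A - C ** A"
      for A B C :: "complex ^ 'm ^ 'm"
      by (simp_all add: bounded_bilinear.diff_right[OF bounded_bilinear_matrix_mult]
          bounded_bilinear.diff_left[OF bounded_bilinear_matrix_mult])
    \<comment> \<open>Coefficient 0 has derivative zero. So the last term drops out here and the
      first term in the companion sum, after which both range over \<open>0..k\<close>.\<close>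
    have 1: "(\<Sum>i=0..Suc k. hcoeff i (F x) ** DG (Suc k - i) v)
        = (\<Sum>i=0..k. hcoeff i (F x) ** (\<theta>' x v ** hcoeff (k - i) (G x) - hcoeff (k - i) (G x) ** \<theta>'' x v))"
      unfolding sum.atLeast0_atMost_Suc
      by (simp add: DG_def) (intro sum.cong refl, simp add: Suc_diff_le)
    have 2: "(\<Sum>i=0..Suc k. DF i v ** hcoeff (Suc k - i) (G x))
        = (\<Sum>i=0..k. (\<theta> x v ** hcoeff i (F x) - hcoeff i (F x) ** \<theta>' x v) ** hcoeff (k - i) (G x))"
      by (subst sum.atLeast0_atMost_Suc_shift) (simp add: DF_def)
    show ?thesis
      unfolding sum.distrib 1 2 hcoeff_mult matrix_mult_sum matrix_sum_mult diff
      by (simp add: sum_subtractf matrix_mul_assoc)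
  qed
  then show "((\<lambda>y. hcoeff (Suc k) (F y ** G y)) has_derivative
      (\<lambda>v. \<theta> x v ** hcoeff k (F x ** G x) - hcoeff k (F x ** G x) ** \<theta>'' x v)) (at x)"
    using d[of "Suc k"] by simp
qed

lemma gauge_on_const:
  assumes "\<And>x v. x \<in> U \<Longrightarrow> \<theta> x v ** A = A ** \<theta>' x v"
  shows "gauge_on U \<theta> \<theta>' (\<lambda>_. map_matrix fps_const A)"
proof -
  have "hcoeff k (map_matrix fps_const A) = (if k = 0 then A else 0)" for k
    by (simp add: vec_eq_iff)
  then show ?thesis
    using assms by (auto simp: gauge_on_def)
qed

lemma gauge_on_zero_const: "gauge_on U zero_form zero_form (\<lambda>_. C)"
  by (simp add: gauge_on_def)

lemma gauge_on_mult_const: "gauge_on U \<theta> zero_form F \<Longrightarrow> gauge_on U \<theta> zero_form (\<lambda>x. F x ** C)"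
  by (rule gauge_on_mult[OF _ gauge_on_zero_const])

lemma gauge_on_pullback:
  assumes "gauge_on U \<theta> \<theta>' F"
  shows "gauge_on ((*v) w -` U) (\<lambda>x v. \<theta> (w *v x) (w *v v)) (\<lambda>x v. \<theta>' (w *v x) (w *v v)) (\<lambda>x. F (w *v x))"
proof -
  have lin: "((*v) w has_derivative (*v) w) (at x)" for x
    by (rule bounded_linear_imp_has_derivative) simp
  show ?thesis
    using assms has_derivative_compose[OF lin] unfolding gauge_on_def by fastforce
qed

text \<open>The derivative of the coefficient of order \<open>k\<close> involves only the
  coefficient of order \<open>k - 1\<close>; this is the step in both uniqueness proofs, which run
  by induction on the order.\<close>

lemma gauge_on_diff:
  assumes "gauge_on U \<theta> \<theta>' F" "gauge_on U \<theta> \<theta>' G" "x \<in> U"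
    and "\<And>j. j < k \<Longrightarrow> hcoeff j (F x) = hcoeff j (G x)"
  shows "((\<lambda>y. hcoeff k (F y) - hcoeff k (G y)) has_derivative (\<lambda>v. 0)) (at x)"
proof (cases k)
  case 0
  then show ?thesis
    using has_derivative_diff[of "\<lambda>y. hcoeff 0 (F y)" "\<lambda>v. 0" "at x" "\<lambda>y. hcoeff 0 (G y)" "\<lambda>v. 0"] assms
    by (simp add: gauge_on_def)
next
  case (Suc j)
  let ?D = "\<lambda>v. \<theta> x v ** hcoeff j (F x) - hcoeff j (F x) ** \<theta>' x v"
  have "hcoeff j (F x) = hcoeff j (G x)"
    using assms(4) Suc by simp
  then have "((\<lambda>y. hcoeff k (F y)) has_derivative ?D) (at x)" "((\<lambda>y. hcoeff k (G y)) has_derivative ?D) (at x)"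
    using assms(1)[unfolded gauge_on_def, rule_format, OF assms(3), THEN conjunct2, rule_format, of j]
      assms(2)[unfolded gauge_on_def, rule_format, OF assms(3), THEN conjunct2, rule_format, of j] Suc
    by (simp_all only:)
  from has_derivative_diff[OF this] show ?thesis
    by simp
qed

lemma gauge_on_unique:
  assumes F: "gauge_on U \<theta> \<theta>' F" and G: "gauge_on U \<theta> \<theta>' G" and U: "convex U" "q \<in> U" and eq: "F q = G q"
  shows "x \<in> U \<Longrightarrow> F x = G x"
proof (rule hcoeff_eqI)
  fix k
  have "\<forall>x\<in>U. hcoeff k (F x) = hcoeff k (G x)"
  proof (induction k rule: less_induct)
    case (less k)
    have "\<exists>c. \<forall>x\<in>U. hcoeff k (F x) - hcoeff k (G x) = c"
    proof (rule has_derivative_zero_constant[OF U(1)])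
      fix x assume "x \<in> U"
      then show "((\<lambda>y. hcoeff k (F y) - hcoeff k (G y)) has_derivative (\<lambda>v. 0)) (at x within U)"
        using less by (auto intro: gauge_on_diff[OF F G, THEN has_derivative_at_withinI])
    qed
    then obtain c where c: "\<And>x. x \<in> U \<Longrightarrow> hcoeff k (F x) - hcoeff k (G x) = c"
      by blast
    have "c = 0"
      using c[OF U(2)] eq by simp
    then show ?case using c by simp
  qed
  then show "x \<in> U \<Longrightarrow> hcoeff k (F x) = hcoeff k (G x)"
    by blast
qed

text \<open>Uniqueness with the initial condition placed at \<open>p\<close>, which may lie outside
  \<open>U\<close>: order by order, the difference is constant on each ray and tends to 0 at its
  start.\<close>

lemma gauge_on_unique_ray:
  assumes F: "gauge_on U \<theta> \<theta>' F" and G: "gauge_on U \<theta> \<theta>' G"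
    and star: "\<And>x l. x \<in> U \<Longrightarrow> 0 < l \<Longrightarrow> l \<le> 1 \<Longrightarrow> p + l *\<^sub>R (x - p) \<in> U"
    and lim: "\<And>k x. x \<in> U \<Longrightarrow> ((\<lambda>l. hcoeff k (F (p + l *\<^sub>R (x - p))) - hcoeff k (G (p + l *\<^sub>R (x - p)))) \<longlongrightarrow> 0) (at_right 0)"
  shows "x \<in> U \<Longrightarrow> F x = G x"
proof (rule hcoeff_eqI)
  fix k
  have "\<forall>x\<in>U. hcoeff k (F x) = hcoeff k (G x)"
  proof (induction k rule: less_induct)
    case (less k)
    show ?case
    proof
      fix x assume x: "x \<in> U"
      let ?E = "\<lambda>y. hcoeff k (F y) - hcoeff k (G y)"
      have "\<exists>c. \<forall>l\<in>{0<..1}. ?E (p + l *\<^sub>R (x - p)) = c"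
      proof (rule has_derivative_zero_constant)
        fix l :: real assume "l \<in> {0<..1}"
        then have y: "p + l *\<^sub>R (x - p) \<in> U"
          using star[OF x] by simp
        have "((\<lambda>l. p + l *\<^sub>R (x - p)) has_derivative (\<lambda>h. h *\<^sub>R (x - p))) (at l within {0<..1})"
          by (auto intro!: derivative_eq_intros)
        moreover have "(?E has_derivative (\<lambda>v. 0)) (at (p + l *\<^sub>R (x - p)))"
          by (rule gauge_on_diff[OF F G y]) (simp add: less y)
        ultimately show "((\<lambda>l. ?E (p + l *\<^sub>R (x - p))) has_derivative (\<lambda>v. 0)) (at l within {0<..1})"
          by (rule has_derivative_compose)
      qed simp
      then obtain c where c: "\<And>l. l \<in> {0<..1} \<Longrightarrow> ?E (p + l *\<^sub>R (x - p)) = c"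
        by blast
      have "((\<lambda>l. c) \<longlongrightarrow> 0) (at_right (0::real))"
      proof (rule Lim_transform_eventually[OF lim[OF x, of k]])
        show "\<forall>\<^sub>F l in at_right 0. ?E (p + l *\<^sub>R (x - p)) = c"
          unfolding eventually_at_right_field using c by (intro exI[of _ 1]) auto
      qed
      then have "c = 0"
        by (simp add: tendsto_const_iff)
      then show "hcoeff k (F x) = hcoeff k (G x)"
        using c[of 1] by simp
    qed
  qed
  then show "x \<in> U \<Longrightarrow> hcoeff k (F x) = hcoeff k (G x)"
    by blast
qed

lemma (in gauge) gauge_on_exists:
  obtains K where "gauge_on D thL thR K" "\<And>x. hcoeff 0 (K x) = mat 1"
    "\<And>k x. x \<in> D \<Longrightarrow> ((\<lambda>l. hcoeff (Suc k) (K (p + l *\<^sub>R (x - p)))) \<longlongrightarrow> 0) (at_right 0)"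
proof -
  obtain C where C: "C 0 = (\<lambda>x. mat 1)"
    "\<And>k x. x \<in> D \<Longrightarrow> (C (Suc k) has_derivative (\<lambda>v. thL x v ** C k x - C k x ** thR x v)) (at x)"
    "\<And>k x. x \<in> D \<Longrightarrow> ((\<lambda>l. C (Suc k) (p + l *\<^sub>R (x - p))) \<longlongrightarrow> 0) (at_right 0)"
    using gauge_exists by blast
  define K where "K = (\<lambda>x. \<chi> i j. Abs_fps (\<lambda>k. C k x $ i $ j))"
  have "hcoeff k (K x) = C k x" for k x
    by (simp add: vec_eq_iff K_def)
  with C that[of K] show thesis
    by (simp add: gauge_on_def)
qed

section \<open>Parallel transport of a flat residue form\<close>

locale connection =
  fixes S :: "'s set" and b :: "'s \<Rightarrow> complex ^ 'n \<Rightarrow> complex" and t :: "'s \<Rightarrow> complex ^ 'm ^ 'm"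
    and X :: "(complex ^ 'n) set"
  assumes fin: "finite S" and b_linear: "\<And>s. s \<in> S \<Longrightarrow> linear_form (b s)"
    and X_eq: "X = {x. \<forall>s\<in>S. b s x \<noteq> 0}"
    and flat: "integrable_form X (residue_form b t S)"
begin

abbreviation \<theta> where "\<theta> \<equiv> residue_form b t S"

text \<open>For regular \<open>p\<close> this is the domain of \<open>gauge\<close> centred at
  \<open>p\<close>. It avoids every hyperplane, and it is convex, so that solutions on it and on
  intersections of such sets are determined by one value.\<close>

definition nbhd :: "complex ^ 'n \<Rightarrow> (complex ^ 'n) set" where
  "nbhd p = {x. \<forall>s\<in>S. norm (b s (x - p)) < norm (b s p)}"

lemma nbhd_self: "p \<in> X \<Longrightarrow> p \<in> nbhd p"
  using linear_form_zero[OF b_linear] by (auto simp: nbhd_def X_eq)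

lemma nbhd_subset: "nbhd p \<subseteq> X"
proof
  fix x assume "x \<in> nbhd p"
  then have "norm (b s x - b s p) < norm (b s p)" if "s \<in> S" for s
    using that linear_form_diff[OF b_linear[OF that]] by (auto simp: nbhd_def)
  then show "x \<in> X"
    unfolding X_eq by fastforce
qed

lemma b_bounded_linear: "s \<in> S \<Longrightarrow> bounded_linear (b s)"
  using b_linear linear_form_bounded_linear by blast

lemma nbhd_INT: "nbhd p = (\<Inter>s\<in>S. {x. norm (b s (x - p)) < norm (b s p)})"
  by (auto simp: nbhd_def)

lemma open_nbhd: "open (nbhd p)"
  unfolding nbhd_INT using fin
  by (intro open_INT ballI open_Collect_less continuous_intros bounded_linear.continuous_on[OF b_bounded_linear]) auto

lemma convex_nbhd: "convex (nbhd p)"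
proof -
  have "{x. norm (b s (x - p)) < norm (b s p)} = b s -` ball (b s p) (norm (b s p))" if "s \<in> S" for s
    using linear_form_diff[OF b_linear[OF that]] by (auto simp: dist_norm norm_minus_commute)
  moreover have "convex (b s -` ball (b s p) (norm (b s p)))" if "s \<in> S" for s
    using b_bounded_linear[OF that] by (intro convex_linear_vimage bounded_linear.linear convex_ball)
  ultimately show ?thesis
    unfolding nbhd_INT by (intro convex_INT) simp
qed

lemma open_X: "open X"
proof -
  have "X = (\<Union>p\<in>X. nbhd p)"
    using nbhd_self nbhd_subset by blast
  then show ?thesis using open_nbhd by (metis open_UN)
qed

text \<open>A gauge transformation from the given form to the zero form, with empty second pole set,
  is a fundamental solution.\<close>

lemma local_solution_exists:
  assumes "p \<in> X"
  shows "\<exists>F. gauge_on (nbhd p) \<theta> zero_form F \<and> F p = mat 1"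
proof -
  have zero: "residue_form b t {} = zero_form"
    by (simp add: residue_form_def fun_eq_iff)
  interpret gauge S S "{}" b t p "nbhd p"
  proof
    show "nbhd p = {x. \<forall>s\<in>S. if b s p = 0 then b s x \<noteq> 0 else norm (b s (x - p)) < norm (b s p)}"
      using assms by (auto simp: nbhd_def X_eq)
    show "integrable_form (nbhd p) (residue_form b t S)"
      using flat nbhd_subset by (auto simp: integrable_form_def)
    show "integrable_form (nbhd p) (residue_form b t {})"
      by (simp add: zero integrable_form_def wedge_def)
  qed (use fin b_linear assms in \<open>auto simp: X_eq\<close>)
  obtain K where K: "gauge_on (nbhd p) \<theta> (residue_form b t {}) K" "\<And>x. hcoeff 0 (K x) = mat 1"
    "\<And>k x. x \<in> nbhd p \<Longrightarrow> ((\<lambda>l. hcoeff (Suc k) (K (p + l *\<^sub>R (x - p)))) \<longlongrightarrow> 0) (at_right 0)"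
    using gauge_on_exists by blast
  have "hcoeff k (K p) = hcoeff k (mat 1)" for k
  proof (cases k)
    case (Suc k')
    \<comment> \<open>The ray from \<open>p\<close> to \<open>p\<close> is constant, so the limit
      condition says that the higher coefficients vanish at \<open>p\<close> itself.\<close>
    have "((\<lambda>l::real. hcoeff (Suc k') (K p)) \<longlongrightarrow> 0) (at_right 0)"
      using K(3)[OF nbhd_self[OF assms], of k'] by simp
    then show ?thesis
      using Suc by (simp add: tendsto_const_iff hcoeff_mat_1)
  qed (simp add: K(2) hcoeff_mat_1)
  then have "K p = mat 1"
    by (rule hcoeff_eqI)
  with K(1) show ?thesis
    unfolding zero by blast
qed

definition sol :: "complex ^ 'n \<Rightarrow> complex ^ 'n \<Rightarrow> complex fps ^ 'm ^ 'm" where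
  "sol p = (SOME F. gauge_on (nbhd p) \<theta> zero_form F \<and> F p = mat 1)"

lemma sol:
  assumes "p \<in> X" shows "gauge_on (nbhd p) \<theta> zero_form (sol p)" "sol p p = mat 1"
  using someI_ex[OF local_solution_exists[OF assms]] unfolding sol_def by blast+

lemma sol_unique:
  assumes "gauge_on U \<theta> zero_form F" "convex U" "U \<subseteq> nbhd p" "p \<in> X" "q \<in> U" "x \<in> U" "F q = sol p q ** C"
  shows "F x = sol p x ** C"
  by (rule gauge_on_unique[OF assms(1) gauge_on_mult_const[OF gauge_on_subset[OF sol(1)]]])
     (use assms in auto)

text \<open>Both sides solve the equation on the convex set \<open>nbhd p \<inter> nbhd q\<close>
  and agree at \<open>q\<close>.\<close>

lemma sol_cocycle:
  assumes "p \<in> X" "q \<in> nbhd p" "x \<in> nbhd p" "x \<in> nbhd q"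
  shows "sol p x = sol q x ** sol p q"
proof -
  have q: "q \<in> X" using assms nbhd_subset by blast
  show ?thesis
    by (rule sol_unique[of "nbhd p \<inter> nbhd q" _ _ q])
       (use assms q sol nbhd_self gauge_on_subset[OF sol(1)] in \<open>auto intro: convex_Int convex_nbhd\<close>)
qed

lemma sol_inverse:
  assumes "p \<in> X" "q \<in> nbhd p" "p \<in> nbhd q"
  shows "sol q p ** sol p q = mat 1"
  using sol_cocycle[OF assms(1,2) nbhd_self[OF assms(1)] assms(3)] sol(2)[OF assms(1)] by simp

text \<open>Continuation along \<open>g\<close> expressed by the chosen solutions \<open>sol\<close>
  alone, so that no open set or solution has to be picked for each parameter. For paths in
  \<open>X\<close> on the unit interval it agrees with \<open>solution_along\<close>.\<close>

definition along :: "(real \<Rightarrow> complex ^ 'n) \<Rightarrow> real \<Rightarrow> real \<Rightarrow> (real \<Rightarrow> complex fps ^ 'm ^ 'm) \<Rightarrow> bool" where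
  "along g a c \<Phi> \<longleftrightarrow> (\<forall>\<tau>\<in>{a..c}. \<exists>\<delta>>0. \<forall>\<sigma>\<in>{a..c}. \<bar>\<sigma> - \<tau>\<bar> < \<delta> \<longrightarrow> \<Phi> \<sigma> = sol (g \<tau>) (g \<sigma>) ** \<Phi> \<tau>)"

lemma near:
  fixes A :: "real set" and g :: "real \<Rightarrow> complex ^ 'n"
  assumes "continuous_on A g" "\<tau> \<in> A" "open U" "g \<tau> \<in> U"
  shows "\<exists>\<delta>>0. \<forall>\<sigma>\<in>A. \<bar>\<sigma> - \<tau>\<bar> < \<delta> \<longrightarrow> g \<sigma> \<in> U"
proof -
  obtain e where e: "e > 0" "ball (g \<tau>) e \<subseteq> U"
    using assms open_contains_ball by metis
  then obtain d where "d > 0" "\<forall>\<sigma>\<in>A. dist \<sigma> \<tau> < d \<longrightarrow> dist (g \<sigma>) (g \<tau>) < e"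
    using assms unfolding continuous_on_iff by metis
  then show ?thesis
    using e by (intro exI[of _ d]) (auto simp: dist_real_def dist_commute)
qed

text \<open>Closeness is obtained in both directions, because \<open>sol_inverse\<close> inverts a
  solution by the one centred at the other point.\<close>

lemma near_nbhd:
  fixes A :: "real set"
  assumes "continuous_on A g" "\<tau> \<in> A" "g \<tau> \<in> X"
  shows "\<exists>\<delta>>0. \<forall>\<sigma>\<in>A. \<bar>\<sigma> - \<tau>\<bar> < \<delta> \<longrightarrow> g \<sigma> \<in> nbhd (g \<tau>) \<and> g \<tau> \<in> nbhd (g \<sigma>)"
proof -
  have "open {q. g \<tau> \<in> nbhd q}"
  proof -
    have "{q. g \<tau> \<in> nbhd q} = (\<Inter>s\<in>S. {q. norm (b s (g \<tau> - q)) < norm (b s q)})"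
      by (auto simp: nbhd_def)
    then show ?thesis
      using fin by (auto intro!: open_INT open_Collect_less continuous_intros bounded_linear.continuous_on[OF b_bounded_linear])
  qed
  then have "open (nbhd (g \<tau>) \<inter> {q. g \<tau> \<in> nbhd q})"
    using open_nbhd by blast
  from near[OF assms(1,2) this] show ?thesis
    using nbhd_self[OF assms(3)] by auto
qed

text \<open>In terms of the cocycle of local solutions, continuation along paths is local on the parameter
  interval; this is how existence and uniqueness follow from Bolzano's bisection principle.\<close>

lemma along_unique:
  assumes g: "continuous_on {a..c} g" "g ` {a..c} \<subseteq> X" and ac: "a \<le> c"
    and \<Phi>: "along g a c \<Phi>" "along g a c \<Psi>" "\<Phi> a = \<Psi> a"
  shows "\<Phi> c = \<Psi> c"
proof -
  \<comment> \<open>As an equivalence between the two ends, agreement is transitive along the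
    interval and can be tested on both sides of each parameter.\<close>
  define P where "P = (\<lambda>x y. a \<le> x \<and> y \<le> c \<longrightarrow> (\<Phi> x = \<Psi> x \<longleftrightarrow> \<Phi> y = \<Psi> y))"
  have "P a c"
  proof (rule Bolzano[OF ac])
    show "\<And>x y z. P x y \<Longrightarrow> P y z \<Longrightarrow> x \<le> y \<Longrightarrow> y \<le> z \<Longrightarrow> P x z"
      unfolding P_def by auto
    fix \<tau> assume \<tau>: "a \<le> \<tau>" "\<tau> \<le> c"
    then have X: "g \<tau> \<in> X" using g by auto
    obtain \<delta>1 where d1: "\<delta>1 > 0" "\<And>\<sigma>. \<sigma> \<in> {a..c} \<Longrightarrow> \<bar>\<sigma> - \<tau>\<bar> < \<delta>1 \<Longrightarrow> \<Phi> \<sigma> = sol (g \<tau>) (g \<sigma>) ** \<Phi> \<tau>"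
      using \<Phi>(1) \<tau> unfolding along_def by (metis atLeastAtMost_iff)
    obtain \<delta>2 where d2: "\<delta>2 > 0" "\<And>\<sigma>. \<sigma> \<in> {a..c} \<Longrightarrow> \<bar>\<sigma> - \<tau>\<bar> < \<delta>2 \<Longrightarrow> \<Psi> \<sigma> = sol (g \<tau>) (g \<sigma>) ** \<Psi> \<tau>"
      using \<Phi>(2) \<tau> unfolding along_def by (metis atLeastAtMost_iff)
    obtain \<delta>3 where d3: "\<delta>3 > 0" "\<And>\<sigma>. \<sigma> \<in> {a..c} \<Longrightarrow> \<bar>\<sigma> - \<tau>\<bar> < \<delta>3 \<Longrightarrow> g \<sigma> \<in> nbhd (g \<tau>) \<and> g \<tau> \<in> nbhd (g \<sigma>)"
      using near_nbhd[OF g(1) _ X] \<tau> by (metis atLeastAtMost_iff)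
    have local: "\<Phi> \<sigma> = \<Psi> \<sigma> \<longleftrightarrow> \<Phi> \<tau> = \<Psi> \<tau>" if "\<sigma> \<in> {a..c}" "\<bar>\<sigma> - \<tau>\<bar> < min \<delta>1 (min \<delta>2 \<delta>3)" for \<sigma>
    proof
      assume "\<Phi> \<sigma> = \<Psi> \<sigma>"
      then have "sol (g \<sigma>) (g \<tau>) ** (sol (g \<tau>) (g \<sigma>) ** \<Phi> \<tau>) = sol (g \<sigma>) (g \<tau>) ** (sol (g \<tau>) (g \<sigma>) ** \<Psi> \<tau>)"
        using d1(2)[of \<sigma>] d2(2)[of \<sigma>] that by simp
      then show "\<Phi> \<tau> = \<Psi> \<tau>"
        using sol_inverse[OF X, of "g \<sigma>"] d3(2)[of \<sigma>] that by (simp add: matrix_mul_assoc)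
    qed (use d1(2)[of \<sigma>] d2(2)[of \<sigma>] that in simp)
    show "\<exists>d>0. \<forall>x y. x \<le> \<tau> \<and> \<tau> \<le> y \<and> y - x < d \<longrightarrow> P x y"
    proof (intro exI[of _ "min \<delta>1 (min \<delta>2 \<delta>3)"] conjI allI impI)
      fix x y assume "x \<le> \<tau> \<and> \<tau> \<le> y \<and> y - x < min \<delta>1 (min \<delta>2 \<delta>3)"
      then show "P x y"
        unfolding P_def using local[of x] local[of y] \<tau> by auto
    qed (use d1 d2 d3 in simp)
  qed
  then show ?thesis
    using \<Phi>(3) by (simp add: P_def)
qed

lemma along_paste:
  assumes \<Phi>: "along g x y \<Phi>" and \<Psi>: "along g y z \<Psi>" "\<Psi> y = \<Phi> y"
  shows "along g x z (\<lambda>\<tau>. if \<tau> \<le> y then \<Phi> \<tau> else \<Psi> \<tau>)"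
proof -
  define \<Xi> where "\<Xi> = (\<lambda>\<tau>. if \<tau> \<le> y then \<Phi> \<tau> else \<Psi> \<tau>)"
  have \<Xi>2: "\<Xi> \<tau> = \<Psi> \<tau>" if "y \<le> \<tau>" for \<tau>
    using that \<Psi>(2) by (auto simp: \<Xi>_def)
  show "along g x z (\<lambda>\<tau>. if \<tau> \<le> y then \<Phi> \<tau> else \<Psi> \<tau>)"
    unfolding \<Xi>_def[symmetric] along_def
  proof
    fix \<tau> assume \<tau>: "\<tau> \<in> {x..z}"
    obtain d1 where d1: "d1 > 0" "\<And>\<sigma>. \<tau> \<le> y \<Longrightarrow> \<sigma> \<in> {x..y} \<Longrightarrow> \<bar>\<sigma> - \<tau>\<bar> < d1 \<Longrightarrow> \<Phi> \<sigma> = sol (g \<tau>) (g \<sigma>) ** \<Phi> \<tau>"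
    proof (cases "\<tau> \<le> y")
      case True
      then have "\<tau> \<in> {x..y}" using \<tau> by simp
      then show thesis
        using \<Phi> that unfolding along_def by blast
    next
      case False
      then show thesis using that[of 1] by simp
    qed
    obtain d2 where d2: "d2 > 0" "\<And>\<sigma>. y \<le> \<tau> \<Longrightarrow> \<sigma> \<in> {y..z} \<Longrightarrow> \<bar>\<sigma> - \<tau>\<bar> < d2 \<Longrightarrow> \<Psi> \<sigma> = sol (g \<tau>) (g \<sigma>) ** \<Psi> \<tau>"
    proof (cases "y \<le> \<tau>")
      case True
      then have "\<tau> \<in> {y..z}" using \<tau> by simp
      then show thesis
        using \<Psi>(1) that unfolding along_def by blast
    next
      case False
      then show thesis using that[of 1] by simp
    qed
    \<comment> \<open>Unless \<open>\<tau> = y\<close>, the radius is at most the distance from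
      \<open>\<tau>\<close> to the joint, so \<open>\<sigma>\<close> and \<open>\<tau>\<close> lie
      on the same side of \<open>y\<close>.\<close>
    define d where "d = min (min d1 d2) (if \<tau> = y then 1 else \<bar>\<tau> - y\<bar>)"
    show "\<exists>\<delta>>0. \<forall>\<sigma>\<in>{x..z}. \<bar>\<sigma> - \<tau>\<bar> < \<delta> \<longrightarrow> \<Xi> \<sigma> = sol (g \<tau>) (g \<sigma>) ** \<Xi> \<tau>"
    proof (intro exI[of _ d] conjI ballI impI)
      show "d > 0" using d1 d2 by (auto simp: d_def)
      fix \<sigma> assume \<sigma>: "\<sigma> \<in> {x..z}" "\<bar>\<sigma> - \<tau>\<bar> < d"
      consider "\<sigma> \<le> y" "\<tau> \<le> y" | "y \<le> \<sigma>" "y \<le> \<tau>"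
        using \<sigma>(2) unfolding d_def by (cases "\<tau> = y") (auto split: if_splits simp: min_def abs_if)
      then show "\<Xi> \<sigma> = sol (g \<tau>) (g \<sigma>) ** \<Xi> \<tau>"
      proof cases
        case 1
        then show ?thesis
          using d1(2)[of \<sigma>] \<sigma> by (simp add: \<Xi>_def d_def)
      next
        case 2
        then show ?thesis
          using d2(2)[of \<sigma>] \<sigma> \<Xi>2[of \<sigma>] \<Xi>2[of \<tau>] by (simp add: d_def)
      qed
    qed
  qed
qed

lemma along_exists:
  assumes g: "continuous_on {a..c} g" "g ` {a..c} \<subseteq> X" and ac: "a \<le> c"
  shows "\<exists>\<Phi>. along g a c \<Phi> \<and> \<Phi> a = M"
proof -
  \<comment> \<open>All initial values are allowed, so that the second piece can start where the
    first one ends.\<close>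
  define P where "P = (\<lambda>x y. a \<le> x \<and> y \<le> c \<longrightarrow> (\<forall>M. \<exists>\<Phi>. along g x y \<Phi> \<and> \<Phi> x = M))"
  have "P a c"
  proof (rule Bolzano[OF ac])
    fix x y z assume P: "P x y" "P y z" and le: "x \<le> y" "y \<le> z"
    show "P x z"
      unfolding P_def
    proof (intro impI allI)
      fix M assume a: "a \<le> x \<and> z \<le> c"
      obtain \<Phi> where 1: "along g x y \<Phi>" "\<Phi> x = M"
        using P(1) a le unfolding P_def by force
      obtain \<Psi> where 2: "along g y z \<Psi>" "\<Psi> y = \<Phi> y"
        using P(2) a le unfolding P_def by force
      let ?\<Xi> = "\<lambda>\<tau>. if \<tau> \<le> y then \<Phi> \<tau> else \<Psi> \<tau>"
      have "along g x z ?\<Xi>"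
        by (rule along_paste[OF 1(1) 2])
      moreover have "?\<Xi> x = M"
        using 1 le by simp
      ultimately show "\<exists>\<Phi>. along g x z \<Phi> \<and> \<Phi> x = M" by blast
    qed
  next
    fix \<tau> assume \<tau>: "a \<le> \<tau>" "\<tau> \<le> c"
    then have X: "g \<tau> \<in> X" using g by auto
    obtain d where d: "d > 0" "\<And>\<sigma>. \<sigma> \<in> {a..c} \<Longrightarrow> \<bar>\<sigma> - \<tau>\<bar> < d \<Longrightarrow> g \<sigma> \<in> nbhd (g \<tau>) \<and> g \<tau> \<in> nbhd (g \<sigma>)"
      using near_nbhd[OF g(1) _ X] \<tau> by (metis atLeastAtMost_iff)
    show "\<exists>d>0. \<forall>x y. x \<le> \<tau> \<and> \<tau> \<le> y \<and> y - x < d \<longrightarrow> P x y"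
    proof (intro exI[of _ d] conjI allI impI)
      fix x y assume xy: "x \<le> \<tau> \<and> \<tau> \<le> y \<and> y - x < d"
      show "P x y"
        unfolding P_def
      proof (intro impI allI)
        fix M :: "complex fps ^ 'm ^ 'm" assume le: "a \<le> x \<and> y \<le> c"
        have n: "g \<sigma> \<in> nbhd (g \<tau>)" "g \<tau> \<in> nbhd (g \<sigma>)" if "\<sigma> \<in> {x..y}" for \<sigma>
          using d(2)[of \<sigma>] that xy le by auto
        \<comment> \<open>From \<open>x\<close> the value is first carried to \<open>\<tau>\<close>,
          then spread over the interval by the single solution centred at \<open>g \<tau>\<close>;
          at \<open>x\<close> the two factors are inverse to each other.\<close>
        define \<Phi> where "\<Phi> = (\<lambda>\<sigma>. sol (g \<tau>) (g \<sigma>) ** (sol (g x) (g \<tau>) ** M))"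
        have xX: "g x \<in> X" using subsetD[OF nbhd_subset n(1)[of x]] xy by simp
        have "\<Phi> x = M"
          using sol_inverse[OF xX, of "g \<tau>"] n[of x] xy by (simp add: \<Phi>_def matrix_mul_assoc)
        moreover have "along g x y \<Phi>"
          unfolding along_def
        proof
          fix \<rho> assume \<rho>: "\<rho> \<in> {x..y}"
          have "continuous_on {x..y} g"
            by (rule continuous_on_subset[OF g(1)]) (use le in auto)
          then obtain e where e: "e > 0" "\<And>\<sigma>. \<sigma> \<in> {x..y} \<Longrightarrow> \<bar>\<sigma> - \<rho>\<bar> < e \<Longrightarrow> g \<sigma> \<in> nbhd (g \<rho>)"
            using near_nbhd[of "{x..y}" g \<rho>] \<rho> n nbhd_subset by blast
          show "\<exists>\<delta>>0. \<forall>\<sigma>\<in>{x..y}. \<bar>\<sigma> - \<rho>\<bar> < \<delta> \<longrightarrow> \<Phi> \<sigma> = sol (g \<rho>) (g \<sigma>) ** \<Phi> \<rho>"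
          proof (intro exI[of _ e] conjI ballI impI e(1))
            fix \<sigma> assume "\<sigma> \<in> {x..y}" "\<bar>\<sigma> - \<rho>\<bar> < e"
            then show "\<Phi> \<sigma> = sol (g \<rho>) (g \<sigma>) ** \<Phi> \<rho>"
              using sol_cocycle[OF X n(1)[OF \<rho>] n(1) e(2)] by (simp add: \<Phi>_def matrix_mul_assoc)
          qed
        qed
        ultimately show "\<exists>\<Phi>. along g x y \<Phi> \<and> \<Phi> x = M" by blast
      qed
    qed (use d in simp)
  qed
  then show ?thesis by (simp add: P_def)
qed

lemma solution_along_iff:
  assumes "path g" "path_image g \<subseteq> X"
  shows "solution_along X (h_times \<theta>) g \<Phi> \<longleftrightarrow> along g 0 1 \<Phi>"
proof
  have g: "continuous_on {0..1} g" and gX: "\<And>\<tau>. \<tau> \<in> {0..1} \<Longrightarrow> g \<tau> \<in> X"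
    using assms by (auto simp: path_def path_image_def)
  assume sol_along: "solution_along X (h_times \<theta>) g \<Phi>"
  show "along g 0 1 \<Phi>"
    unfolding along_def
  proof
    fix \<tau> :: real assume \<tau>: "\<tau> \<in> {0..1}"
    obtain U F \<delta> where UF: "open U \<and> U \<subseteq> X \<and> solution_on U (h_times \<theta>) F \<and> \<delta> > 0 \<and>
        (\<forall>\<sigma>\<in>{0..1}. \<bar>\<sigma> - \<tau>\<bar> < \<delta> \<longrightarrow> g \<sigma> \<in> U \<and> \<Phi> \<sigma> = F (g \<sigma>))"
      using bspec[OF sol_along[unfolded solution_along_def] \<tau>] by (elim exE) (rule that)
    then have U: "open U" "U \<subseteq> X" "solution_on U (h_times \<theta>) F" "\<delta> > 0"
      and F: "\<And>\<sigma>. \<sigma> \<in> {0..1} \<Longrightarrow> \<bar>\<sigma> - \<tau>\<bar> < \<delta> \<Longrightarrow> g \<sigma> \<in> U \<and> \<Phi> \<sigma> = F (g \<sigma>)"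
      by simp_all
    have \<tau>U: "g \<tau> \<in> U" "\<Phi> \<tau> = F (g \<tau>)" using F[OF \<tau>] U(4) by simp_all
    \<comment> \<open>The open set \<open>U\<close> is arbitrary; a ball inside it is convex, as
      uniqueness of local solutions requires.\<close>
    obtain e where e: "e > 0" "ball (g \<tau>) e \<subseteq> U \<inter> nbhd (g \<tau>)"
      using openE[OF open_Int[OF U(1) open_nbhd], of "g \<tau>" "g \<tau>"] nbhd_self[OF gX[OF \<tau>]] \<tau>U by blast
    obtain d where d: "d > 0" "\<And>\<sigma>. \<sigma> \<in> {0..1} \<Longrightarrow> \<bar>\<sigma> - \<tau>\<bar> < d \<Longrightarrow> g \<sigma> \<in> ball (g \<tau>) e"
      using near[OF g \<tau> open_ball, of "g \<tau>" e] e by auto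
    show "\<exists>\<delta>>0. \<forall>\<sigma>\<in>{0..1}. \<bar>\<sigma> - \<tau>\<bar> < \<delta> \<longrightarrow> \<Phi> \<sigma> = sol (g \<tau>) (g \<sigma>) ** \<Phi> \<tau>"
    proof (intro exI[of _ "min \<delta> d"] conjI ballI impI)
      show "min \<delta> d > 0" using U(4) d(1) by simp
      fix \<sigma> assume \<sigma>: "\<sigma> \<in> {0..1}" "\<bar>\<sigma> - \<tau>\<bar> < min \<delta> d"
      have "F (g \<sigma>) = sol (g \<tau>) (g \<sigma>) ** F (g \<tau>)"
      proof (rule sol_unique[OF _ convex_ball])
        show "gauge_on (ball (g \<tau>) e) \<theta> zero_form F"
          by (rule gauge_on_subset[OF U(3)[unfolded solution_on_iff_gauge_on]]) (use e(2) in blast)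
        show "ball (g \<tau>) e \<subseteq> nbhd (g \<tau>)" using e(2) by blast
        show "g \<tau> \<in> X" by (rule gX[OF \<tau>])
        show "g \<tau> \<in> ball (g \<tau>) e" using e(1) by simp
        show "g \<sigma> \<in> ball (g \<tau>) e" by (rule d(2)) (use \<sigma> in auto)
        show "F (g \<tau>) = sol (g \<tau>) (g \<tau>) ** F (g \<tau>)"
          by (simp only: sol(2)[OF gX[OF \<tau>]] matrix_mul_lid)
      qed
      then show "\<Phi> \<sigma> = sol (g \<tau>) (g \<sigma>) ** \<Phi> \<tau>"
        using F[OF \<sigma>(1)] \<sigma>(2) \<tau>U(2) by (simp only: min_less_iff_conj)
    qed
  qed
next
  have g: "continuous_on {0..1} g" and gX: "\<And>\<tau>. \<tau> \<in> {0..1} \<Longrightarrow> g \<tau> \<in> X"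
    using assms by (auto simp: path_def path_image_def)
  assume al: "along g 0 1 \<Phi>"
  show "solution_along X (h_times \<theta>) g \<Phi>"
    unfolding solution_along_def
  proof
    fix \<tau> :: real assume \<tau>: "\<tau> \<in> {0..1}"
    obtain d where d: "d > 0" "\<And>\<sigma>. \<sigma> \<in> {0..1} \<Longrightarrow> \<bar>\<sigma> - \<tau>\<bar> < d \<Longrightarrow> \<Phi> \<sigma> = sol (g \<tau>) (g \<sigma>) ** \<Phi> \<tau>"
      using al \<tau> unfolding along_def by blast
    obtain e where e: "e > 0" "\<And>\<sigma>. \<sigma> \<in> {0..1} \<Longrightarrow> \<bar>\<sigma> - \<tau>\<bar> < e \<Longrightarrow> g \<sigma> \<in> nbhd (g \<tau>)"
      using near_nbhd[OF g \<tau> gX[OF \<tau>]] by blast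
    show "\<exists>U F \<delta>. open U \<and> U \<subseteq> X \<and> solution_on U (h_times \<theta>) F \<and> \<delta> > 0 \<and>
        (\<forall>\<sigma>\<in>{0..1}. \<bar>\<sigma> - \<tau>\<bar> < \<delta> \<longrightarrow> g \<sigma> \<in> U \<and> \<Phi> \<sigma> = F (g \<sigma>))"
    proof (intro exI conjI ballI impI)
      show "solution_on (nbhd (g \<tau>)) (h_times \<theta>) (\<lambda>x. sol (g \<tau>) x ** \<Phi> \<tau>)"
        unfolding solution_on_iff_gauge_on by (intro gauge_on_mult_const sol gX \<tau>)
      show "min d e > 0" using d(1) e(1) by simp
      fix \<sigma> assume "\<sigma> \<in> {0..1}" "\<bar>\<sigma> - \<tau>\<bar> < min d e"
      then show "g \<sigma> \<in> nbhd (g \<tau>)" "\<Phi> \<sigma> = sol (g \<tau>) (g \<sigma>) ** \<Phi> \<tau>"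
        by (auto intro: d(2) e(2))
    qed (rule open_nbhd nbhd_subset)+
  qed
qed

abbreviation T where "T \<equiv> transport X (h_times \<theta>)"

lemma along_mult:
  assumes "along g a c \<Phi>" shows "along g a c (\<lambda>\<tau>. \<Phi> \<tau> ** C)"
  unfolding along_def
proof
  fix \<tau> assume "\<tau> \<in> {a..c}"
  then obtain d where d: "d > 0" "\<And>\<sigma>. \<sigma> \<in> {a..c} \<Longrightarrow> \<bar>\<sigma> - \<tau>\<bar> < d \<Longrightarrow> \<Phi> \<sigma> = sol (g \<tau>) (g \<sigma>) ** \<Phi> \<tau>"
    using assms unfolding along_def by blast
  show "\<exists>\<delta>>0. \<forall>\<sigma>\<in>{a..c}. \<bar>\<sigma> - \<tau>\<bar> < \<delta> \<longrightarrow> \<Phi> \<sigma> ** C = sol (g \<tau>) (g \<sigma>) ** (\<Phi> \<tau> ** C)"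
  proof (intro exI[of _ d] conjI ballI impI d(1))
    fix \<sigma> assume "\<sigma> \<in> {a..c}" "\<bar>\<sigma> - \<tau>\<bar> < d"
    from d(2)[OF this] show "\<Phi> \<sigma> ** C = sol (g \<tau>) (g \<sigma>) ** (\<Phi> \<tau> ** C)"
      by (simp only: matrix_mul_assoc)
  qed
qed

text \<open>Existence and uniqueness of continuation justify the description operator in
  \<open>transport\<close>; other initial values only contribute a constant factor on the
  right.\<close>

lemma transport_eq:
  assumes g: "path g" "path_image g \<subseteq> X" and \<Phi>: "along g 0 1 \<Phi>"
  shows "\<Phi> 1 = T g ** \<Phi> 0"
proof -
  have g': "continuous_on {0..1} g" "g ` {0..1} \<subseteq> X"
    using g by (auto simp: path_def path_image_def)
  obtain \<Psi> where \<Psi>: "along g 0 1 \<Psi>" "\<Psi> 0 = mat 1"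
    using along_exists[OF g', of "mat 1"] by auto
  have "T g = \<Psi> 1"
    unfolding transport_def
  proof (rule the_equality)
    show "\<exists>\<Phi>. solution_along X (h_times \<theta>) g \<Phi> \<and> \<Phi> 0 = mat 1 \<and> \<Phi> 1 = \<Psi> 1"
      using \<Psi> solution_along_iff[OF g] by blast
    fix M assume "\<exists>\<Phi>. solution_along X (h_times \<theta>) g \<Phi> \<and> \<Phi> 0 = mat 1 \<and> \<Phi> 1 = M"
    then obtain \<Phi> where "along g 0 1 \<Phi>" "\<Phi> 0 = mat 1" "\<Phi> 1 = M"
      unfolding solution_along_iff[OF g] by blast
    then show "M = \<Psi> 1"
      using along_unique[OF g' zero_le_one _ \<Psi>(1)] \<Psi>(2) by metis
  qed
  moreover have "\<Phi> 1 = \<Psi> 1 ** \<Phi> 0"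
    by (rule along_unique[OF g' zero_le_one \<Phi> along_mult[OF \<Psi>(1)]]) (simp add: \<Psi>(2))
  ultimately show ?thesis by simp
qed

lemma transport_obtain:
  assumes g: "path g" "path_image g \<subseteq> X"
  obtains \<Phi> where "along g 0 1 \<Phi>" "\<Phi> 0 = mat 1" "\<Phi> 1 = T g"
proof -
  obtain \<Phi> where "along g 0 1 \<Phi>" "\<Phi> 0 = mat 1"
    using along_exists[of 0 1 g "mat 1"] g by (auto simp: path_def path_image_def)
  with transport_eq[OF g this(1)] that show thesis by simp
qed

end

text \<open>A tube lemma: the maximum over the compact fibre at \<open>s\<close> is negative, and
  uniform continuity keeps neighbouring fibres below zero. It compares neighbouring paths of a
  homotopy.\<close>

lemma eventually_uniformly_negative:
  fixes f :: "real \<times> real \<Rightarrow> real"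
  assumes f: "continuous_on ({0..1} \<times> {0..1}) f" and s: "s \<in> {0..1}" and neg: "\<And>t. t \<in> {0..1} \<Longrightarrow> f (s, t) < 0"
  shows "\<forall>\<^sub>F s' in at s within {0..1}. \<forall>t\<in>{0..1}. f (s', t) < 0"
proof -
  have "continuous_on {0..1} (\<lambda>t. f (s, t))"
    using s by (intro continuous_on_compose2[OF f] continuous_intros) auto
  from continuous_attains_sup[OF compact_Icc _ this]
  obtain t0 where t0: "t0 \<in> {0..1}" "\<And>t. t \<in> {0..1} \<Longrightarrow> f (s, t) \<le> f (s, t0)"
    by auto
  have "uniformly_continuous_on ({0..1} \<times> {0..1}) f"
    using f by (intro compact_uniformly_continuous compact_Times) auto
  then obtain d where d: "d > 0" "\<And>z z'. z \<in> {0..1} \<times> {0..1} \<Longrightarrow> z' \<in> {0..1} \<times> {0..1} \<Longrightarrow>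
      dist z' z < d \<Longrightarrow> dist (f z') (f z) < - f (s, t0)"
    unfolding uniformly_continuous_on_def using neg[OF t0(1)] by (metis neg_0_less_iff_less)
  have "f (s', t) < 0" if "s' \<in> {0..1}" "dist s' s < d" "t \<in> {0..1}" for s' t
    using d(2)[of "(s, t)" "(s', t)"] that s t0(2)[OF that(3)] by (auto simp: dist_Pair_Pair dist_real_def)
  then show ?thesis
    unfolding eventually_at using d(1) by blast
qed

section \<open>Transport along joined, nearby and homotopic paths\<close>

context connection
begin

lemma alongD:
  assumes "along g a c \<Phi>" "\<tau> \<in> {a..c}"
  obtains d where "d > 0" "\<And>\<sigma>. \<sigma> \<in> {a..c} \<Longrightarrow> \<bar>\<sigma> - \<tau>\<bar> < d \<Longrightarrow> \<Phi> \<sigma> = sol (g \<tau>) (g \<sigma>) ** \<Phi> \<tau>"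
  using assms unfolding along_def by blast

lemma along_cong:
  assumes "along g a c \<Phi>" "\<And>\<tau>. \<tau> \<in> {a..c} \<Longrightarrow> g' \<tau> = g \<tau>" "\<And>\<tau>. \<tau> \<in> {a..c} \<Longrightarrow> \<Phi>' \<tau> = \<Phi> \<tau>"
  shows "along g' a c \<Phi>'"
  unfolding along_def
proof
  fix \<tau> assume \<tau>: "\<tau> \<in> {a..c}"
  obtain d where d: "d > 0" "\<And>\<sigma>. \<sigma> \<in> {a..c} \<Longrightarrow> \<bar>\<sigma> - \<tau>\<bar> < d \<Longrightarrow> \<Phi> \<sigma> = sol (g \<tau>) (g \<sigma>) ** \<Phi> \<tau>"
    by (rule alongD[OF assms(1) \<tau>]) blast
  show "\<exists>\<delta>>0. \<forall>\<sigma>\<in>{a..c}. \<bar>\<sigma> - \<tau>\<bar> < \<delta> \<longrightarrow> \<Phi>' \<sigma> = sol (g' \<tau>) (g' \<sigma>) ** \<Phi>' \<tau>"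
  proof (intro exI[of _ d] conjI ballI impI d(1))
    fix \<sigma> assume \<sigma>: "\<sigma> \<in> {a..c}" "\<bar>\<sigma> - \<tau>\<bar> < d"
    show "\<Phi>' \<sigma> = sol (g' \<tau>) (g' \<sigma>) ** \<Phi>' \<tau>"
      unfolding assms(2)[OF \<tau>] assms(2)[OF \<sigma>(1)] assms(3)[OF \<tau>] assms(3)[OF \<sigma>(1)] by (rule d(2)[OF \<sigma>])
  qed
qed

lemma along_affine:
  assumes \<Phi>: "along g a' c' \<Phi>" and m: "m > 0" and range: "\<And>\<tau>. \<tau> \<in> {a..c} \<Longrightarrow> m * \<tau> + k \<in> {a'..c'}"
  shows "along (\<lambda>\<tau>. g (m * \<tau> + k)) a c (\<lambda>\<tau>. \<Phi> (m * \<tau> + k))"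
  unfolding along_def
proof
  fix \<tau> assume \<tau>: "\<tau> \<in> {a..c}"
  obtain d where d: "d > 0" "\<And>\<sigma>. \<sigma> \<in> {a'..c'} \<Longrightarrow> \<bar>\<sigma> - (m * \<tau> + k)\<bar> < d \<Longrightarrow>
      \<Phi> \<sigma> = sol (g (m * \<tau> + k)) (g \<sigma>) ** \<Phi> (m * \<tau> + k)"
    by (rule alongD[OF \<Phi> range[OF \<tau>]]) blast
  show "\<exists>\<delta>>0. \<forall>\<sigma>\<in>{a..c}. \<bar>\<sigma> - \<tau>\<bar> < \<delta> \<longrightarrow>
      \<Phi> (m * \<sigma> + k) = sol (g (m * \<tau> + k)) (g (m * \<sigma> + k)) ** \<Phi> (m * \<tau> + k)"
  proof (intro exI[of _ "d / m"] conjI ballI impI)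
    show "d / m > 0" using d(1) m by simp
    fix \<sigma> assume \<sigma>: "\<sigma> \<in> {a..c}" "\<bar>\<sigma> - \<tau>\<bar> < d / m"
    have "m * \<sigma> + k - (m * \<tau> + k) = m * (\<sigma> - \<tau>)"
      by (simp add: right_diff_distrib)
    then have "\<bar>m * \<sigma> + k - (m * \<tau> + k)\<bar> < d"
      using m \<sigma>(2) by (simp add: abs_mult pos_less_divide_eq mult.commute)
    then show "\<Phi> (m * \<sigma> + k) = sol (g (m * \<tau> + k)) (g (m * \<sigma> + k)) ** \<Phi> (m * \<tau> + k)"
      by (rule d(2)[OF range[OF \<sigma>(1)]])
  qed
qed

lemma transport_join:
  assumes g: "path g" "path_image g \<subseteq> X" and h: "path h" "path_image h \<subseteq> X" and gh: "pathfinish g = pathstart h"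
  shows "T (g +++ h) = T h ** T g"
proof -
  obtain \<Phi> where \<Phi>: "along g 0 1 \<Phi>" "\<Phi> 0 = mat 1" "\<Phi> 1 = T g"
    by (rule transport_obtain[OF g])
  obtain \<Psi> where \<Psi>: "along h 0 1 \<Psi>" "\<Psi> 0 = mat 1" "\<Psi> 1 = T h"
    by (rule transport_obtain[OF h])
  have "along (g +++ h) 0 (1/2) (\<lambda>\<tau>. \<Phi> (2 * \<tau> + 0))"
    by (rule along_cong[OF along_affine[OF \<Phi>(1), where m = 2 and k = 0]]) (auto simp: joinpaths_def)
  moreover have "along (g +++ h) (1/2) 1 (\<lambda>\<tau>. \<Psi> (2 * \<tau> + - 1) ** \<Phi> 1)"
  proof (rule along_cong[OF along_affine[OF along_mult[OF \<Psi>(1)], where m = 2 and k = "- 1"]])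
    fix \<tau> :: real assume "\<tau> \<in> {1/2..1}"
    \<comment> \<open>At \<open>1/2\<close> the joined path takes its value from \<open>g\<close>;
      the condition \<open>gh\<close> identifies it with the start of \<open>h\<close>.\<close>
    then consider "\<tau> = 1/2" | "\<tau> > 1/2" by fastforce
    then show "(g +++ h) \<tau> = h (2 * \<tau> + - 1)"
    proof cases
      case 1
      show ?thesis
        using gh unfolding 1 by (simp add: joinpaths_def pathfinish_def pathstart_def)
    qed (simp add: joinpaths_def)
  qed auto
  ultimately have "along (g +++ h) 0 1 (\<lambda>\<tau>. if \<tau> \<le> 1/2 then \<Phi> (2 * \<tau> + 0) else \<Psi> (2 * \<tau> + - 1) ** \<Phi> 1)"
    by (rule along_paste) (simp add: \<Psi>(2))
  then have "\<Psi> 1 ** \<Phi> 1 = T (g +++ h) ** \<Phi> 0"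
    using transport_eq[of "g +++ h"] g h gh by (fastforce simp: path_image_join)
  then show ?thesis
    by (simp add: \<Phi> \<Psi>)
qed

text \<open>The factor \<open>sol (g \<tau>) (g' \<tau>)\<close> carries a continuation along
  \<open>g\<close> to one along \<open>g'\<close>, by the cocycle identity used in two ways; at the
  common ends it is the identity.\<close>

lemma transport_close:
  assumes g: "path g" "path_image g \<subseteq> X" and g': "path g'" "path_image g' \<subseteq> X"
    and ends: "g' 0 = g 0" "g' 1 = g 1" and close: "\<And>\<tau>. \<tau> \<in> {0..1} \<Longrightarrow> g' \<tau> \<in> nbhd (g \<tau>)"
  shows "T g = T g'"
proof -
  have cont: "continuous_on {0..1} g" "continuous_on {0..1} g'"
    using g g' by (auto simp: path_def)
  have X: "g \<tau> \<in> X" "g' \<tau> \<in> X" if "\<tau> \<in> {0..1}" for \<tau>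
    using g g' that by (auto simp: path_image_def)
  obtain \<Phi> where \<Phi>: "along g 0 1 \<Phi>" "\<Phi> 0 = mat 1" "\<Phi> 1 = T g"
    by (rule transport_obtain[OF g])
  have "along g' 0 1 (\<lambda>\<tau>. sol (g \<tau>) (g' \<tau>) ** \<Phi> \<tau>)"
    unfolding along_def
  proof
    fix \<tau> :: real assume \<tau>: "\<tau> \<in> {0..1}"
    obtain d1 where d1: "d1 > 0" "\<And>\<sigma>. \<sigma> \<in> {0..1} \<Longrightarrow> \<bar>\<sigma> - \<tau>\<bar> < d1 \<Longrightarrow> \<Phi> \<sigma> = sol (g \<tau>) (g \<sigma>) ** \<Phi> \<tau>"
      by (rule alongD[OF \<Phi>(1) \<tau>]) blast
    obtain d2 where d2: "d2 > 0" "\<forall>\<sigma>\<in>{0..1}. \<bar>\<sigma> - \<tau>\<bar> < d2 \<longrightarrow> g \<sigma> \<in> nbhd (g \<tau>)"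
      using near[OF cont(1) \<tau> open_nbhd nbhd_self[OF X(1)[OF \<tau>]]] by blast
    obtain d3 where d3: "d3 > 0" "\<forall>\<sigma>\<in>{0..1}. \<bar>\<sigma> - \<tau>\<bar> < d3 \<longrightarrow> g' \<sigma> \<in> nbhd (g' \<tau>)"
      using near[OF cont(2) \<tau> open_nbhd nbhd_self[OF X(2)[OF \<tau>]]] by blast
    obtain d4 where d4: "d4 > 0" "\<forall>\<sigma>\<in>{0..1}. \<bar>\<sigma> - \<tau>\<bar> < d4 \<longrightarrow> g' \<sigma> \<in> nbhd (g \<tau>)"
      using near[OF cont(2) \<tau> open_nbhd close[OF \<tau>]] by blast
    show "\<exists>\<delta>>0. \<forall>\<sigma>\<in>{0..1}. \<bar>\<sigma> - \<tau>\<bar> < \<delta> \<longrightarrow>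
        sol (g \<sigma>) (g' \<sigma>) ** \<Phi> \<sigma> = sol (g' \<tau>) (g' \<sigma>) ** (sol (g \<tau>) (g' \<tau>) ** \<Phi> \<tau>)"
    proof (intro exI[of _ "min (min d1 d2) (min d3 d4)"] conjI ballI impI)
      show "min (min d1 d2) (min d3 d4) > 0" using d1(1) d2(1) d3(1) d4(1) by simp
      fix \<sigma> :: real assume \<sigma>: "\<sigma> \<in> {0..1}" "\<bar>\<sigma> - \<tau>\<bar> < min (min d1 d2) (min d3 d4)"
      then have n: "g \<sigma> \<in> nbhd (g \<tau>)" "g' \<sigma> \<in> nbhd (g' \<tau>)" "g' \<sigma> \<in> nbhd (g \<tau>)"
        using d2(2) d3(2) d4(2) by simp_all
      have "\<Phi> \<sigma> = sol (g \<tau>) (g \<sigma>) ** \<Phi> \<tau>"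
        by (rule d1(2)) (use \<sigma> in simp_all)
      then have "sol (g \<sigma>) (g' \<sigma>) ** \<Phi> \<sigma> = (sol (g \<sigma>) (g' \<sigma>) ** sol (g \<tau>) (g \<sigma>)) ** \<Phi> \<tau>"
        by (simp only: matrix_mul_assoc)
      also have "sol (g \<sigma>) (g' \<sigma>) ** sol (g \<tau>) (g \<sigma>) = sol (g \<tau>) (g' \<sigma>)"
        by (rule sol_cocycle[symmetric, OF X(1)[OF \<tau>] n(1) n(3) close[OF \<sigma>(1)]])
      also have "\<dots> = sol (g' \<tau>) (g' \<sigma>) ** sol (g \<tau>) (g' \<tau>)"
        by (rule sol_cocycle[OF X(1)[OF \<tau>] close[OF \<tau>] n(3) n(2)])
      finally show "sol (g \<sigma>) (g' \<sigma>) ** \<Phi> \<sigma> = sol (g' \<tau>) (g' \<sigma>) ** (sol (g \<tau>) (g' \<tau>) ** \<Phi> \<tau>)"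
        by (simp only: matrix_mul_assoc)
    qed
  qed
  from transport_eq[OF g' this] show ?thesis
    using sol(2)[OF X(1)[of 0]] sol(2)[OF X(1)[of 1]] by (simp add: ends \<Phi>)
qed

text \<open>Membership in \<open>nbhd\<close> is a finite system of strict inequalities, which
  persists uniformly along the path under a small change of the homotopy parameter. So the transport
  is locally constant in that parameter.\<close>

theorem transport_homotopic:
  assumes "homotopic_paths X g g'" shows "T g = T g'"
proof -
  obtain h :: "real \<times> real \<Rightarrow> complex ^ 'n"
     where h: "continuous_on ({0..1} \<times> {0..1}) h" and hX: "h \<in> ({0..1} \<times> {0..1}) \<rightarrow> X"
       and h0: "\<And>x. h (0, x) = g x" and h1: "\<And>x. h (1, x) = g' x"
       and start: "\<And>t. t \<in> {0..1} \<Longrightarrow> h (t, 0) = g 0" and finish: "\<And>t. t \<in> {0..1} \<Longrightarrow> h (t, 1) = g 1"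
    using assms by (auto simp: homotopic_paths_def homotopic_with_def pathstart_def pathfinish_def image_subset_iff_funcset)
  have path: "path (\<lambda>t. h (s, t))" "path_image (\<lambda>t. h (s, t)) \<subseteq> X" if "s \<in> {0..1}" for s
    using that hX by (auto simp: path_def path_image_def intro!: continuous_on_compose2[OF h] continuous_intros)
  have "T (\<lambda>t. h (0, t)) = T (\<lambda>t. h (1, t))"
  proof (rule connected_local_const[of "{0..1::real}"])
    show "\<forall>s\<in>{0..1}. \<forall>\<^sub>F s' in at s within {0..1}. T (\<lambda>t. h (s, t)) = T (\<lambda>t. h (s', t))"
    proof
      fix s :: real assume s: "s \<in> {0..1}"
      have "\<forall>\<^sub>F s' in at s within {0..1}. \<forall>t\<in>{0..1}. norm (b \<rho> (h (s', t) - h (s, t))) - norm (b \<rho> (h (s, t))) < 0"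
        if \<rho>: "\<rho> \<in> S" for \<rho>
      proof -
        have "continuous_on ({0..1} \<times> {0..1}) (\<lambda>z. norm (b \<rho> (h z - h (s, snd z))) - norm (b \<rho> (h (s, snd z))))"
          using s \<rho> by (intro continuous_intros bounded_linear.continuous_on[OF b_bounded_linear] continuous_on_compose2[OF h]) auto
        from eventually_uniformly_negative[OF this s] show ?thesis
          using hX s \<rho> linear_form_zero[OF b_linear[OF \<rho>]] by (auto simp: X_eq Pi_iff)
      qed
      then have "\<forall>\<^sub>F s' in at s within {0..1}. \<forall>\<rho>\<in>S. \<forall>t\<in>{0..1}.
          norm (b \<rho> (h (s', t) - h (s, t))) - norm (b \<rho> (h (s, t))) < 0"
        using fin by (intro eventually_ball_finite) auto
      moreover have "\<forall>\<^sub>F s' in at s within {0..1}. s' \<in> {0..1}"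
        by (simp add: eventually_at_filter)
      ultimately show "\<forall>\<^sub>F s' in at s within {0..1}. T (\<lambda>t. h (s, t)) = T (\<lambda>t. h (s', t))"
      proof eventually_elim
        case (elim s')
        show ?case
          by (rule transport_close[OF path[OF s] path[OF elim(2)]])
             (use elim s start finish in \<open>simp_all add: nbhd_def\<close>)
      qed
    qed
  qed auto
  then show ?thesis
    by (simp add: h0 h1)
qed

lemma transport_linepath_const: "x \<in> X \<Longrightarrow> T (linepath x x) = mat 1"
proof -
  assume x: "x \<in> X"
  have "along (linepath x x) 0 1 (\<lambda>_. mat 1)"
    unfolding along_def using sol(2)[OF x] by (auto simp: linepath_refl intro: exI[of _ 1])
  from transport_eq[OF _ _ this] x show ?thesis
    by (auto simp: linepath_refl path_image_def path_const)
qed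

lemma transport_reversepath:
  assumes g: "path g" "path_image g \<subseteq> X"
  shows "T (reversepath g) ** T g = mat 1" "T g ** T (reversepath g) = mat 1"
proof -
  have *: "T (reversepath g) ** T g = mat 1" if g: "path g" "path_image g \<subseteq> X" for g
  proof -
    have "T (reversepath g) ** T g = T (g +++ reversepath g)"
      by (rule transport_join[symmetric]) (use g in auto)
    also have "\<dots> = T (linepath (pathstart g) (pathstart g))"
      by (intro transport_homotopic homotopic_paths_rinv g)
    also have "\<dots> = mat 1"
      using g pathstart_in_path_image by (intro transport_linepath_const) blast
    finally show ?thesis .
  qed
  show "T (reversepath g) ** T g = mat 1" "T g ** T (reversepath g) = mat 1"
    using *[OF g] *[of "reversepath g"] g by simp_all
qed

end

text \<open>Transport intertwines two connections along a flat section of the mixed connection; \<open>A\<close> allows for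
  the action of a group element on the base.\<close>

theorem transport_gauge:
  fixes A :: "complex ^ 'n ^ 'n"
  assumes c: "connection S b t X" and c': "connection S' b' t' X'"
    and K: "gauge_on D (\<lambda>x v. residue_form b' t' S' (A *v x) (A *v v)) (residue_form b t S) K" and D: "open D"
    and g: "path g" "path_image g \<subseteq> X" "path_image g \<subseteq> D" "\<And>x. x \<in> path_image g \<Longrightarrow> A *v x \<in> X'"
  shows "K (pathfinish g) ** transport X (h_times (residue_form b t S)) g =
         transport X' (h_times (residue_form b' t' S')) (\<lambda>\<tau>. A *v g \<tau>) ** K (pathstart g)"
proof -
  interpret c: connection S b t X by (rule c)
  interpret c': connection S' b' t' X' by (rule c')
  have cont: "continuous_on {0..1} g" using g by (simp add: path_def)
  have gX: "g \<tau> \<in> X" "g \<tau> \<in> D" "A *v g \<tau> \<in> X'" if "\<tau> \<in> {0..1}" for \<tau>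
    using g that by (auto simp: path_image_def)
  have A_cont: "continuous_on U ((*v) A)" for U :: "(complex ^ 'n) set"
    by (intro linear_continuous_on) simp
  have pA: "path (\<lambda>\<tau>. A *v g \<tau>)" "path_image (\<lambda>\<tau>. A *v g \<tau>) \<subseteq> X'"
    using continuous_on_compose2[OF A_cont[of UNIV] cont] gX by (auto simp: path_def path_image_def)
  obtain \<Phi> where \<Phi>: "c.along g 0 1 \<Phi>" "\<Phi> 0 = mat 1" "\<Phi> 1 = c.T g"
    by (rule c.transport_obtain[OF g(1,2)])
  have "c'.along (\<lambda>\<tau>. A *v g \<tau>) 0 1 (\<lambda>\<tau>. K (g \<tau>) ** \<Phi> \<tau>)"
    unfolding c'.along_def
  proof
    fix \<tau> :: real assume \<tau>: "\<tau> \<in> {0..1}"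
    let ?p = "g \<tau>"
    let ?U = "D \<inter> c.nbhd ?p \<inter> (*v) A -` c'.nbhd (A *v ?p)"
    have "open ?U"
      by (intro open_Int D c.open_nbhd open_vimage c'.open_nbhd A_cont)
    moreover have "?p \<in> ?U"
      using gX[OF \<tau>] c.nbhd_self c'.nbhd_self by blast
    ultimately obtain e where e: "e > 0" "ball ?p e \<subseteq> ?U"
      by (metis openE)
    obtain d1 where d1: "d1 > 0" "\<And>\<sigma>. \<sigma> \<in> {0..1} \<Longrightarrow> \<bar>\<sigma> - \<tau>\<bar> < d1 \<Longrightarrow> \<Phi> \<sigma> = c.sol (g \<tau>) (g \<sigma>) ** \<Phi> \<tau>"
      by (rule c.alongD[OF \<Phi>(1) \<tau>]) blast
    have "?p \<in> ball ?p e" using e(1) by simp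
    from c.near[OF cont \<tau> open_ball this]
    obtain d2 where d2: "d2 > 0" "\<forall>\<sigma>\<in>{0..1}. \<bar>\<sigma> - \<tau>\<bar> < d2 \<longrightarrow> g \<sigma> \<in> ball ?p e"
      by blast
    \<comment> \<open>Near \<open>g \<tau>\<close> both sides are flat for the pulled-back form on
      the left and the zero form on the right, and they agree at the centre.\<close>
    have eq: "K x ** c.sol ?p x = c'.sol (A *v ?p) (A *v x) ** K ?p" if "x \<in> ball ?p e" for x
    proof (rule gauge_on_unique[OF _ _ convex_ball \<open>?p \<in> ball ?p e\<close> _ that])
      show "gauge_on (ball ?p e) (\<lambda>x v. residue_form b' t' S' (A *v x) (A *v v)) zero_form (\<lambda>x. K x ** c.sol ?p x)"
        by (rule gauge_on_mult[OF gauge_on_subset[OF K] gauge_on_subset[OF c.sol(1)[OF gX(1)[OF \<tau>]]]])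
           (use e(2) in auto)
      show "gauge_on (ball ?p e) (\<lambda>x v. residue_form b' t' S' (A *v x) (A *v v)) zero_form
          (\<lambda>x. c'.sol (A *v ?p) (A *v x) ** K ?p)"
        by (rule gauge_on_mult_const[OF gauge_on_subset[OF gauge_on_pullback[OF c'.sol(1)[OF gX(3)[OF \<tau>]]]]])
           (use e(2) in auto)
      show "K ?p ** c.sol ?p ?p = c'.sol (A *v ?p) (A *v ?p) ** K ?p"
        by (simp only: c.sol(2)[OF gX(1)[OF \<tau>]] c'.sol(2)[OF gX(3)[OF \<tau>]] matrix_mul_lid matrix_mul_rid)
    qed
    show "\<exists>\<delta>>0. \<forall>\<sigma>\<in>{0..1}. \<bar>\<sigma> - \<tau>\<bar> < \<delta> \<longrightarrow>
        K (g \<sigma>) ** \<Phi> \<sigma> = c'.sol (A *v ?p) (A *v g \<sigma>) ** (K ?p ** \<Phi> \<tau>)"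
    proof (intro exI[of _ "min d1 d2"] conjI ballI impI)
      show "min d1 d2 > 0" using d1(1) d2(1) by simp
      fix \<sigma> :: real assume \<sigma>: "\<sigma> \<in> {0..1}" "\<bar>\<sigma> - \<tau>\<bar> < min d1 d2"
      have "\<Phi> \<sigma> = c.sol ?p (g \<sigma>) ** \<Phi> \<tau>"
        by (rule d1(2)) (use \<sigma> in simp_all)
      then have "K (g \<sigma>) ** \<Phi> \<sigma> = (K (g \<sigma>) ** c.sol ?p (g \<sigma>)) ** \<Phi> \<tau>"
        by (simp only: matrix_mul_assoc)
      also have "K (g \<sigma>) ** c.sol ?p (g \<sigma>) = c'.sol (A *v ?p) (A *v g \<sigma>) ** K ?p"
        by (rule eq) (use \<sigma> d2(2) in simp)
      finally show "K (g \<sigma>) ** \<Phi> \<sigma> = c'.sol (A *v ?p) (A *v g \<sigma>) ** (K ?p ** \<Phi> \<tau>)"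
        by (simp only: matrix_mul_assoc)
    qed
  qed
  from c'.transport_eq[OF pA this] show ?thesis
    by (simp add: \<Phi> pathstart_def pathfinish_def)
qed

section \<open>Matrices over the Laurent series\<close>

lemma det_hom:
  fixes A :: "'a::comm_ring_1 ^ 'm ^ 'm" and f :: "'a \<Rightarrow> 'b::comm_ring_1"
  assumes f: "\<And>x y. f (x + y) = f x + f y" "\<And>x y. f (x * y) = f x * f y" "f 1 = 1"
  shows "f (det A) = det (map_matrix f A)"
proof -
  have f0: "f 0 = 0" using f(1)[of 0 0] by simp
  have fneg: "f (- x) = - f x" for x
    using f(1)[of x "- x"] f0 by (simp add: eq_neg_iff_add_eq_0 add.commute)
  have fsum: "f (sum g S) = (\<Sum>i\<in>S. f (g i))" for g and S :: "'c set"
    by (induction S rule: infinite_finite_induct) (simp_all add: f f0)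
  have fprod: "f (prod g S) = (\<Prod>i\<in>S. f (g i))" for g and S :: "'c set"
    by (induction S rule: infinite_finite_induct) (simp_all add: f)
  have fsign: "f (of_int (sign p)) = of_int (sign p)" for p :: "'c \<Rightarrow> 'c"
    by (simp add: sign_def f fneg)
  show ?thesis
    by (simp add: det_def fsum f fprod fsign)
qed

lemma map_matrix_mult_hom:
  assumes f: "\<And>x y. f (x + y) = f x + f y" "\<And>x y. f (x * y) = f x * f y" "f 0 = 0"
  shows "map_matrix f (A ** B) = map_matrix f A ** map_matrix f (B :: 'a::semiring_1 ^ 'm ^ 'm)"
proof -
  have fsum: "f (sum g S) = (\<Sum>i\<in>S. f (g i))" for g and S :: "'m set"
    by (induction S rule: infinite_finite_induct) (simp_all add: f)
  show ?thesis
    by (simp add: vec_eq_iff matrix_matrix_mult_def fsum f(2))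
qed

definition to_fls :: "complex fps ^ 'm ^ 'm \<Rightarrow> complex fls ^ 'm ^ 'm" where
  "to_fls = map_matrix fps_to_fls"

lemma to_fls_mult: "to_fls (A ** B) = to_fls A ** to_fls B"
  unfolding to_fls_def by (rule map_matrix_mult_hom) (simp_all add: fls_times_fps_to_fls fps_to_fls_plus)

lemma to_fls_1: "to_fls (mat 1) = mat 1"
  by (simp add: to_fls_def vec_eq_iff mat_def)

lemma invertible_to_fls_inverse: "A ** B = mat 1 \<Longrightarrow> B ** A = mat 1 \<Longrightarrow> invertible (to_fls A)"
  unfolding invertible_def by (metis to_fls_mult to_fls_1)

text \<open>The constant term of \<open>det K\<close> is the determinant of the constant term of
  \<open>K\<close>, that is 1; so the determinant is nonzero in the field of Laurent series.\<close>

lemma invertible_to_fls: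
  fixes K :: "complex fps ^ 'm ^ 'm"
  assumes "hcoeff 0 K = mat 1" shows "invertible (to_fls K)"
proof -
  have "fps_nth (det K) 0 = det (map_matrix (\<lambda>a. fps_nth a 0) K)"
    by (rule det_hom) simp_all
  then have "fps_nth (det K) 0 = 1"
    using assms by (simp add: hcoeff_def)
  then have "det K \<noteq> 0" by auto
  moreover have "det (to_fls K) = fps_to_fls (det K)"
    unfolding to_fls_def by (rule det_hom[symmetric]) (simp_all add: fls_times_fps_to_fls fps_to_fls_plus)
  ultimately show ?thesis
    by (simp add: invertible_det_nz)
qed

section \<open>Reflection representations and equivariant residue forms\<close>

text \<open>It is instantiated for \<open>W\<close> with all reflections on \<open>X\<close> and for
  the parabolic subgroup on \<open>X0\<close>. Freeness of the action is an assumption because it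
  has different reasons in the two cases.\<close>

locale monodromy_data = matrix_group W for W :: "(complex ^ 'n ^ 'n) set" +
  fixes b :: "complex ^ 'n ^ 'n \<Rightarrow> complex ^ 'n \<Rightarrow> complex"
    and t :: "complex ^ 'n ^ 'n \<Rightarrow> complex ^ 'm ^ 'm"
    and r :: "complex ^ 'n ^ 'n \<Rightarrow> complex ^ 'm ^ 'm"
    and R :: "(complex ^ 'n ^ 'n) set" and X :: "(complex ^ 'n) set"
  assumes R_refls: "R \<subseteq> refls W"
    and R_stable: "\<And>w s. w \<in> W \<Longrightarrow> s \<in> R \<Longrightarrow> w ** s ** matrix_inv w \<in> R"
    and forms: "\<And>s. s \<in> R \<Longrightarrow> linear_form (b s) \<and> {x. b s x = 0} = fixed_space s"
    and X_def': "X = {x. \<forall>s\<in>R. b s x \<noteq> 0}"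
    and flat_R: "integrable_form X (residue_form b t R)"
    and free_X: "\<And>w x. w \<in> W \<Longrightarrow> x \<in> X \<Longrightarrow> w *v x = x \<Longrightarrow> w = mat 1"
    and r_mult: "\<And>v w. v \<in> W \<Longrightarrow> w \<in> W \<Longrightarrow> r (v ** w) = r v ** r w"
    and r_inv: "\<And>w. w \<in> W \<Longrightarrow> invertible (r w)"
    and equivariant: "\<And>w s. w \<in> W \<Longrightarrow> s \<in> R \<Longrightarrow> r w ** t s ** matrix_inv (r w) = t (w ** s ** matrix_inv w)"
begin

sublocale connection R b t X
proof
  show "finite R"
    by (rule finite_subset[OF _ finite_W]) (use R_refls in \<open>auto simp: refls_def\<close>)
qed (use forms X_def' flat_R in auto)

text \<open>Both forms have the same kernel, so they are proportional. The factor \<open>c\<close>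
  is left open because logarithmic forms do not see it.\<close>

lemma form_act:
  assumes w: "w \<in> W" and s: "s \<in> R"
  shows "\<exists>c. c \<noteq> 0 \<and> (\<forall>x. b (w ** s ** matrix_inv w) (w *v x) = c * b s x)"
proof -
  let ?s = "w ** s ** matrix_inv w"
  have s': "?s \<in> R" "fixed_space ?s = (*v) w ` fixed_space s"
    using R_stable[OF w s] refls_conj[OF w] s R_refls by auto
  have ker: "b ?s (w *v x) = 0 \<longleftrightarrow> b s x = 0" for x
  proof -
    have "b ?s (w *v x) = 0 \<longleftrightarrow> w *v x \<in> (*v) w ` fixed_space s"
      using forms[OF s'(1)] s'(2) by blast
    also have "\<dots> \<longleftrightarrow> x \<in> fixed_space s"
      using inj_W[OF w] by auto
    also have "\<dots> \<longleftrightarrow> b s x = 0"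
      using forms[OF s] by blast
    finally show ?thesis .
  qed
  have "fixed_space s \<noteq> UNIV"
  proof
    assume "fixed_space s = UNIV"
    then have "vec.dim (UNIV :: (complex ^ 'n) set) + 1 = CARD('n)"
      using s R_refls by (auto simp: refls_def is_reflection_def is_hyperplane_def)
    then show False by (simp add: card_cart_basis)
  qed
  then obtain e where e: "b s e \<noteq> 0"
    using forms[OF s] by blast
  have lf: "linear_form (\<lambda>x. b ?s (w *v x))"
    using forms[OF s'(1)] linear_form_comp_matrix by blast
  have "linear_form (b s)"
    using forms[OF s] by blast
  note mult = linear_form_multiple[OF lf this e ker[THEN iffD2]]
  show ?thesis
  proof (intro exI conjI allI)
    show "b ?s (w *v e) / b s e \<noteq> 0"
      using e ker[of e] by simp
    show "b ?s (w *v x) = b ?s (w *v e) / b s e * b s x" for x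
      by (rule mult)
  qed
qed

lemma X_stable: "w \<in> W \<Longrightarrow> x \<in> X \<Longrightarrow> w *v x \<in> X"
proof -
  assume w: "w \<in> W" and x: "x \<in> X"
  have "b s (w *v x) \<noteq> 0" if s: "s \<in> R" for s
  proof -
    let ?s = "matrix_inv w ** s ** matrix_inv (matrix_inv w)"
    have "?s \<in> R" using R_stable[OF W_inv[OF w] s] .
    have "\<exists>c. c \<noteq> 0 \<and> (\<forall>y. b ?s (matrix_inv w *v y) = c * b s y)"
      by (rule form_act[OF W_inv[OF w] s])
    then obtain c where "b ?s (matrix_inv w *v (w *v x)) = c * b s (w *v x)" by blast
    then show ?thesis
      using x \<open>?s \<in> R\<close> unfolding W_inverse(4)[OF w] by (auto simp: X_def')
  qed
  then show "w *v x \<in> X" by (simp add: X_def')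
qed

sublocale regular_set W X
  by unfold_locales (use open_X X_stable free_X in auto)

text \<open>Conjugation by \<open>w\<close> permutes \<open>R\<close>, the logarithmic forms are
  carried to each other, and the residues are conjugated by \<open>r w\<close>.\<close>

lemma residue_form_equivariant:
  assumes w: "w \<in> W"
  shows "residue_form b t R (w *v x) (w *v v) ** r w = r w ** residue_form b t R x v"
proof -
  let ?c = "\<lambda>s. w ** s ** matrix_inv w"
  have "inj_on ?c R"
  proof (rule inj_onI)
    fix s s' assume "?c s = ?c s'"
    then have "matrix_inv w ** (?c s) ** w = matrix_inv w ** (?c s') ** w" by simp
    moreover have "matrix_inv w ** (?c s) ** w = (matrix_inv w ** w) ** s ** (matrix_inv w ** w)" for s
      by (simp only: matrix_mul_assoc)
    ultimately show "s = s'"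
      using W_inverse(2)[OF w] by simp
  qed
  moreover have "?c ` R \<subseteq> R" using R_stable[OF w] by blast
  ultimately have "bij_betw ?c R R"
    using fin endo_inj_surj[of R ?c] by (simp add: bij_betw_def)
  then have "residue_form b t R (w *v x) (w *v v)
      = (\<Sum>s\<in>R. cscale (log_form (b (?c s)) (w *v x) (w *v v)) (t (?c s)))"
    unfolding residue_form_cscale
    by (rule sum.reindex_bij_betw[symmetric])
  also have "\<dots> = (\<Sum>s\<in>R. cscale (log_form (b s) x v) (r w ** t s ** matrix_inv (r w)))"
  proof (rule sum.cong)
    fix s assume s: "s \<in> R"
    obtain c where "c \<noteq> 0" "\<forall>x. b (?c s) (w *v x) = c * b s x"
      using form_act[OF w s] by blast
    then show "cscale (log_form (b (?c s)) (w *v x) (w *v v)) (t (?c s))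
        = cscale (log_form (b s) x v) (r w ** t s ** matrix_inv (r w))"
      using equivariant[OF w s] by (simp add: log_form_def)
  qed simp
  finally have eq: "residue_form b t R (w *v x) (w *v v)
      = (\<Sum>s\<in>R. cscale (log_form (b s) x v) (r w ** t s ** matrix_inv (r w)))" .
  have "r w ** t s ** matrix_inv (r w) ** r w = r w ** t s" for s
    using matrix_inv_mult[OF r_inv[OF w]] by (simp flip: matrix_mul_assoc)
  then show ?thesis
    unfolding eq matrix_sum_mult cscale_mult_left
    by (simp add: residue_form_cscale matrix_mult_sum cscale_mult_right)
qed

definition rho :: "complex ^ 'n ^ 'n \<Rightarrow> complex fps ^ 'm ^ 'm" where
  "rho w = map_matrix fps_const (r w)"

text \<open>Equivariance says that the constant \<open>r w\<close> is a flat section between the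
  form and its pullback by \<open>w\<close>.\<close>

lemma transport_act:
  assumes w: "w \<in> W" and g: "path g" "path_image g \<subseteq> X"
  shows "rho w ** T g = T (\<lambda>\<tau>. w *v g \<tau>) ** rho w"
  unfolding rho_def
proof (rule transport_gauge[where K = "\<lambda>_. map_matrix fps_const (r w)" and D = UNIV and A = w])
  show "gauge_on UNIV (\<lambda>x v. residue_form b t R (w *v x) (w *v v)) (residue_form b t R)
      (\<lambda>_. map_matrix fps_const (r w))"
    by (intro gauge_on_const residue_form_equivariant w)
  show "connection R b t X" "connection R b t X"
    by unfold_locales
qed (use g X_stable[OF w] in auto)

text \<open>The factor \<open>rho (matrix_inv v)\<close> turns the transport along
  \<open>v *v d\<close> into the transport along \<open>d\<close>; thus a change of base point
  conjugates the monodromy.\<close>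

lemma transport_change_base:
  assumes v: "v \<in> W" and g: "path g" "path_image g \<subseteq> X" "pathstart g = x" "pathfinish g = v *v x"
    and d: "path d" "path_image d \<subseteq> X" "pathstart d = x"
  shows "rho (matrix_inv v) ** T (reversepath d +++ (g +++ (\<lambda>\<tau>. v *v d \<tau>)))
       = T d ** (rho (matrix_inv v) ** T g) ** T (reversepath d)"
proof -
  let ?vd = "\<lambda>\<tau>. v *v d \<tau>"
  have vd: "path ?vd" "path_image ?vd \<subseteq> X" "pathstart ?vd = v *v x"
    using d X_stable[OF v] path_act by (auto simp: path_image_def pathstart_def)
  have "T (reversepath d +++ (g +++ ?vd)) = T (g +++ ?vd) ** T (reversepath d)"
    by (rule transport_join) (use g d vd in \<open>auto simp: path_image_join\<close>)
  also have "T (g +++ ?vd) = T ?vd ** T g"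
    by (rule transport_join) (use g vd in auto)
  finally have "rho (matrix_inv v) ** T (reversepath d +++ (g +++ ?vd))
      = (rho (matrix_inv v) ** T ?vd) ** T g ** T (reversepath d)"
    by (simp only: matrix_mul_assoc)
  also have "rho (matrix_inv v) ** T ?vd = T (\<lambda>\<tau>. matrix_inv v *v (v *v d \<tau>)) ** rho (matrix_inv v)"
    by (rule transport_act[OF W_inv[OF v] vd(1,2)])
  also have "(\<lambda>\<tau>. matrix_inv v *v (v *v d \<tau>)) = d"
    by (simp only: W_inverse(4)[OF v])
  finally show ?thesis
    by (simp only: matrix_mul_assoc)
qed

lemma matrix_inv_inv:
  assumes "w \<in> W" shows "matrix_inv (matrix_inv w) = w"
proof -
  have "matrix_inv (matrix_inv w) = matrix_inv (matrix_inv w) ** (matrix_inv w ** w)"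
    using W_inverse(2)[OF assms] by simp
  also have "\<dots> = w"
    unfolding matrix_mul_assoc W_inverse(2)[OF W_inv[OF assms]] by simp
  finally show ?thesis .
qed

text \<open>Any competing path in the class is homotopic to \<open>g\<close> by homotopy lifting, so
  it has the same transport and the same end point; freeness then forces its group element to be
  \<open>matrix_inv v\<close>.\<close>

lemma monodromy_eq:
  assumes v: "v \<in> W" and g: "path g" "path_image g \<subseteq> X" "pathstart g = z" "pathfinish g = v *v z"
  shows "monodromy X W r (h_times (residue_form b t R)) z (path_class (orbit_space W X) (orbit_of W \<circ> g))
       = to_fls (rho (matrix_inv v) ** T g)"
  unfolding monodromy_def
proof (rule the_equality)
  let ?c = "path_class (orbit_space W X) (orbit_of W \<circ> g)"
  show "\<exists>\<gamma> w. w \<in> W \<and> path \<gamma> \<and> path_image \<gamma> \<subseteq> X \<and> pathstart \<gamma> = z \<and> pathfinish \<gamma> = matrix_inv w *v z \<and>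
      orbit_of W \<circ> \<gamma> \<in> ?c \<and> to_fls (rho (matrix_inv v) ** T g)
        = map_matrix fps_to_fls (map_matrix fps_const (r w) ** T \<gamma>)"
    using g path_class_self[OF pathin_orbit_of[OF g(1,2)]]
    by (intro exI[of _ g] exI[of _ "matrix_inv v"])
       (simp add: W_inv[OF v] matrix_inv_inv[OF v] rho_def to_fls_def)
  fix M assume "\<exists>\<gamma> w. w \<in> W \<and> path \<gamma> \<and> path_image \<gamma> \<subseteq> X \<and> pathstart \<gamma> = z \<and> pathfinish \<gamma> = matrix_inv w *v z \<and>
      orbit_of W \<circ> \<gamma> \<in> ?c \<and> M = map_matrix fps_to_fls (map_matrix fps_const (r w) ** T \<gamma>)"
  then obtain \<gamma> w where w: "w \<in> W" and \<gamma>: "path \<gamma>" "path_image \<gamma> \<subseteq> X" "pathstart \<gamma> = z"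
      "pathfinish \<gamma> = matrix_inv w *v z" "orbit_of W \<circ> \<gamma> \<in> ?c"
    and M: "M = map_matrix fps_to_fls (map_matrix fps_const (r w) ** T \<gamma>)"
    by blast
  have "homotopic_pathsin (orbit_space W X) (orbit_of W \<circ> g) (orbit_of W \<circ> \<gamma>)"
    using \<gamma>(5) by (simp add: path_class_def)
  then have hom: "homotopic_paths X g \<gamma>"
    by (rule lift_homotopy) (use g \<gamma> in auto)
  have zX: "z \<in> X" using g pathstart_in_path_image by blast
  have "v *v z = matrix_inv w *v z"
    using homotopic_paths_imp_pathfinish[OF hom] g \<gamma> by simp
  then have "(w ** v) *v z = z"
    using W_inverse(3)[OF w, of z] by (simp flip: matrix_vector_mul_assoc)
  then have wv: "w ** v = mat 1"
    using free_X[OF W_mult[OF w v] zX] by blast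
  have "w = matrix_inv v"
  proof -
    have "w = w ** (v ** matrix_inv v)"
      using W_inverse(1)[OF v] by simp
    also have "\<dots> = matrix_inv v"
      unfolding matrix_mul_assoc wv by simp
    finally show ?thesis .
  qed
  then show "M = to_fls (rho (matrix_inv v) ** T g)"
    unfolding M transport_homotopic[OF hom] rho_def to_fls_def by simp
qed

end

section \<open>Parabolic subgroups\<close>

lemma eventually_nonzero_on_ray:
  assumes "finite S" and b: "\<And>s. s \<in> S \<Longrightarrow> linear_form (b s)"
  shows "\<forall>\<^sub>F l in at_right (0::real). \<forall>s\<in>S. b s p \<noteq> 0 \<longrightarrow> b s (p + l *\<^sub>R u) \<noteq> 0"
proof (rule eventually_ball_finite[OF assms(1)], rule ballI)
  fix s assume s: "s \<in> S"
  show "\<forall>\<^sub>F l in at_right (0::real). b s p \<noteq> 0 \<longrightarrow> b s (p + l *\<^sub>R u) \<noteq> 0"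
  proof (cases "b s p = 0")
    case False
    have "((\<lambda>l. b s p + of_real l * b s u) \<longlongrightarrow> b s p + of_real 0 * b s u) (at_right (0::real))"
      by (intro tendsto_intros)
    then have "\<forall>\<^sub>F l in at_right (0::real). b s p + of_real l * b s u \<noteq> 0"
      using False by (intro tendsto_imp_eventually_ne[where c = "b s p + of_real 0 * b s u"]) auto
    then show ?thesis
      by (simp add: linear_form_add[OF b[OF s]] linear_form_scaleR[OF b[OF s]])
  qed simp
qed

lemma matrix_vector_scaleR: "A *v (c *\<^sub>R v) = c *\<^sub>R (A *v v)" for A :: "complex ^ 'n ^ 'k"
  by (simp add: scaleR_eq_vector_scalar vec.scale)

lemma hcoeff_const_mult: "hcoeff k (map_matrix fps_const A ** M) = A ** hcoeff k M"
  by (simp add: vec_eq_iff matrix_matrix_mult_def fps_sum_nth)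

lemma hcoeff_mult_const: "hcoeff k (M ** map_matrix fps_const A) = hcoeff k M ** A"
  by (simp add: vec_eq_iff matrix_matrix_mult_def fps_sum_nth)

text \<open>The condition \<open>x1_regular\<close> combines two facts about \<open>x1\<close>: it
  lies on every hyperplane of \<open>W0\<close> and on no other one of the arrangement.\<close>

locale parabolic_setup =
  fixes W W0 :: "(complex ^ 'n ^ 'n) set"
    and b :: "complex ^ 'n ^ 'n \<Rightarrow> complex ^ 'n \<Rightarrow> complex"
    and t r :: "complex ^ 'n ^ 'n \<Rightarrow> complex ^ 'm ^ 'm"
    and I X X0 :: "(complex ^ 'n) set" and x1 :: "complex ^ 'n"
  assumes refl_group: "reflection_group W"
    and action: "r \<in> hom (GL\<lparr>carrier := W\<rparr>) GL"
    and forms: "\<And>s. s \<in> refls W \<Longrightarrow> linear_form (b s) \<and> {x. b s x = 0} = fixed_space s"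
    and X_eq: "X = {x. \<forall>s\<in>refls W. b s x \<noteq> 0}"
    and X0_eq: "X0 = {x. \<forall>s\<in>refls W \<inter> W0. b s x \<noteq> 0}"
    and flat: "integrable_form X (residue_form b t (refls W))"
    and equivariant: "\<And>w s. w \<in> W \<Longrightarrow> s \<in> refls W \<Longrightarrow>
           r w ** t s ** matrix_inv (r w) = t (w ** s ** matrix_inv w)"
    and W0: "W0 = parabolic W I"
    and x1: "x1 \<in> I" and x1_regular: "\<And>s. s \<in> refls W \<Longrightarrow> b s x1 = 0 \<longleftrightarrow> s \<in> W0"
begin

lemma W0_subset: "W0 \<subseteq> W" and W0_fix: "w \<in> W0 \<Longrightarrow> w *v x1 = x1"
  using x1 by (auto simp: W0 parabolic_def)

lemma r_mult: "v \<in> W \<Longrightarrow> w \<in> W \<Longrightarrow> r (v ** w) = r v ** r w"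
  using hom_mult[OF action, of v w] by (simp add: GL_def)

lemma r_inv:
  assumes "w \<in> W" shows "invertible (r w)"
proof -
  have "r w \<in> carrier GL"
    by (rule hom_in_carrier[OF action]) (simp add: assms)
  then show ?thesis by (simp only: GL_def partial_object.simps mem_Collect_eq)
qed

sublocale full: monodromy_data W b t r "refls W" X
proof -
  have W: "finite W" "subgroup W GL" "generate GL (refls W) = W"
    using refl_group unfolding reflection_group_def by blast+
  interpret matrix_group W
    by (rule matrix_group.intro[OF W(1,2)])
  show "monodromy_data W b t r (refls W) X"
  proof (rule monodromy_data.intro[OF matrix_group_axioms], rule monodromy_data_axioms.intro)
    show "\<And>w s. w \<in> W \<Longrightarrow> s \<in> refls W \<Longrightarrow> w ** s ** matrix_inv w \<in> refls W"
      by (rule refls_conj(1))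
    show "w = mat 1" if "w \<in> W" "x \<in> X" "w *v x = x" for w x
    proof (rule free_action[OF _ forms _ that(1,3)])
      show "generate GL (refls W) = W" by (rule W(3))
      show "\<And>s. s \<in> refls W \<Longrightarrow> b s x \<noteq> 0"
        using that(2) by (simp add: X_eq)
    qed
  qed (use forms X_eq flat equivariant r_mult r_inv in auto)
qed

lemma refls_finite: "finite (refls W)"
  by (rule full.fin)

text \<open>Along the ray, forms vanishing at \<open>x1\<close> are \<open>l\<close> times their
  value at \<open>x\<close>, and the other forms stay close to their nonzero value at
  \<open>x1\<close>.\<close>

lemma ray_in_X:
  assumes x: "x \<in> X0"
  shows "\<forall>\<^sub>F l in at_right 0. x1 + l *\<^sub>R (x - x1) \<in> X"
proof -
  have "\<forall>\<^sub>F l in at_right 0. \<forall>s\<in>refls W. b s x1 \<noteq> 0 \<longrightarrow> b s (x1 + l *\<^sub>R (x - x1)) \<noteq> 0"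
    by (rule eventually_nonzero_on_ray[OF refls_finite]) (use forms in blast)
  moreover have "\<forall>\<^sub>F l in at_right (0::real). l > 0"
    by (simp add: eventually_at_right_less)
  ultimately show ?thesis
  proof eventually_elim
    case (elim l)
    have "b s (x1 + l *\<^sub>R (x - x1)) \<noteq> 0" if s: "s \<in> refls W" for s
    proof (cases "b s x1 = 0")
      case True
      then have "b s x \<noteq> 0"
        using x s x1_regular[OF s] by (auto simp: X0_eq)
      then show ?thesis
        using True elim forms[OF s] by (simp add: linear_form_add linear_form_diff linear_form_scaleR)
    qed (use elim s in blast)
    then show ?case by (simp add: X_eq)
  qed
qed

lemma flat_parabolic: "integrable_form X0 (residue_form b t (refls W \<inter> W0))"
  unfolding integrable_form_def
proof (intro ballI allI)
  fix x u v assume x: "x \<in> X0"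
  let ?y = "\<lambda>l::real. x1 + l *\<^sub>R (x - x1)"
  let ?\<theta> = "residue_form b t (refls W)"
  let ?\<theta>' = "residue_form b t (refls W \<inter> W0)"
  \<comment> \<open>The factor \<open>l\<close> cancels exactly against a pole through
    \<open>x1\<close>, whose logarithmic form is homogeneous of degree -1 about \<open>x1\<close>,
    and sends every other summand to 0.\<close>
  have lim: "((\<lambda>l. cscale (of_real l) (?\<theta> (?y l) u)) \<longlongrightarrow> ?\<theta>' x u) (at_right 0)" for u
  proof -
    have "((\<lambda>l. cscale (of_real l * log_form (b s) (?y l) u) (t s)) \<longlongrightarrow>
        (if s \<in> W0 then cscale (log_form (b s) x u) (t s) else 0)) (at_right 0)" if s: "s \<in> refls W" for s
    proof -
      have lf: "linear_form (b s)" using forms[OF s] by blast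
      have y: "b s (?y l) = b s x1 + of_real l * (b s x - b s x1)" for l
        by (simp add: linear_form_add[OF lf] linear_form_scaleR[OF lf] linear_form_diff[OF lf])
      have "((\<lambda>l. of_real l * log_form (b s) (?y l) u) \<longlongrightarrow> (if s \<in> W0 then log_form (b s) x u else 0)) (at_right 0)"
      proof (cases "s \<in> W0")
        case True
        have "\<forall>\<^sub>F l in at_right 0. log_form (b s) x u = of_real l * log_form (b s) (?y l) u"
          using eventually_at_right_less[of "0::real"]
        proof eventually_elim
          case (elim l)
          then show ?case
            using True x1_regular[OF s] unfolding log_form_def y by (simp add: field_simps)
        qed
        then show ?thesis
          using True by (simp add: tendsto_cong[of "\<lambda>l. log_form (b s) x u"] tendsto_eventually eventually_mono)
      next
        case False
        then have "b s x1 \<noteq> 0" using x1_regular[OF s] by blast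
        then have "((\<lambda>l. of_real l * (1 / (\<i> * of_real pi) * (b s u / (b s x1 + of_real l * (b s x - b s x1)))))
            \<longlongrightarrow> of_real 0 * (1 / (\<i> * of_real pi) * (b s u / (b s x1 + of_real 0 * (b s x - b s x1))))) (at_right 0)"
          by (intro tendsto_intros) auto
        then show ?thesis
          using False by (simp add: log_form_def y)
      qed
      from bounded_bilinear.tendsto[OF bounded_bilinear_cscale this tendsto_const[of "t s"]]
      show ?thesis by (simp split: if_splits)
    qed
    then have "((\<lambda>l. \<Sum>s\<in>refls W. cscale (of_real l * log_form (b s) (?y l) u) (t s)) \<longlongrightarrow>
        (\<Sum>s\<in>refls W. if s \<in> W0 then cscale (log_form (b s) x u) (t s) else 0)) (at_right 0)"
      by (rule tendsto_sum)
    moreover have "cscale c (?\<theta> y u) = (\<Sum>s\<in>refls W. cscale (c * log_form (b s) y u) (t s))" for c y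
      by (simp add: residue_form_cscale vec_eq_iff sum_distrib_left mult.assoc)
    moreover have "?\<theta>' x u = (\<Sum>s\<in>refls W. if s \<in> W0 then cscale (log_form (b s) x u) (t s) else 0)"
      unfolding residue_form_cscale by (rule sum.inter_restrict[OF refls_finite])
    ultimately show ?thesis by simp
  qed
  define D where "D = (\<lambda>l. cscale (of_real l) (?\<theta> (?y l) u) ** cscale (of_real l) (?\<theta> (?y l) v)
      - cscale (of_real l) (?\<theta> (?y l) v) ** cscale (of_real l) (?\<theta> (?y l) u))"
  have "(D \<longlongrightarrow> ?\<theta>' x u ** ?\<theta>' x v - ?\<theta>' x v ** ?\<theta>' x u) (at_right 0)"
    unfolding D_def by (intro tendsto_diff bounded_bilinear.tendsto[OF bounded_bilinear_matrix_mult] lim)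
  moreover have "\<forall>\<^sub>F l in at_right 0. D l = 0"
    using ray_in_X[OF x]
  proof eventually_elim
    case (elim l)
    then show ?case
      using integrable_form_commute[OF flat elim, of u v]
      by (simp add: D_def cscale_mult_left cscale_mult_right)
  qed
  ultimately have "?\<theta>' x u ** ?\<theta>' x v - ?\<theta>' x v ** ?\<theta>' x u = 0"
    by (intro tendsto_unique[OF _ _ tendsto_eventually]) auto
  then show "wedge ?\<theta>' ?\<theta>' x u v = 0"
    by (simp add: wedge_def)
qed

lemma W0_inv: "w \<in> W0 \<Longrightarrow> matrix_inv w \<in> W0"
proof -
  assume w: "w \<in> W0"
  then have wW: "w \<in> W" using W0_subset by blast
  have "matrix_inv w *v x = x" if "x \<in> I" for x
  proof -
    have "w *v x = x" using w that by (auto simp: W0 parabolic_def)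
    then show ?thesis using full.W_inverse(4)[OF wW, of x] by simp
  qed
  then show "matrix_inv w \<in> W0"
    using full.W_inv[OF wW] by (simp add: W0 parabolic_def)
qed

lemma W0_mult: "v \<in> W0 \<Longrightarrow> w \<in> W0 \<Longrightarrow> v ** w \<in> W0"
  using full.W_mult by (auto simp: W0 parabolic_def simp flip: matrix_vector_mul_assoc)

lemma matrix_group_W0: "matrix_group W0"
proof (rule matrix_group.intro)
  show "finite W0"
    by (rule finite_subset[OF W0_subset full.finite_W])
  show "subgroup W0 GL"
  proof (rule group.subgroupI[OF group_GL])
    show "W0 \<subseteq> carrier GL"
      using W0_subset full.W_invertible by (auto simp: GL_def)
    have "mat 1 \<in> W0"
      using full.W_one by (simp add: W0 parabolic_def)
    then show "W0 \<noteq> {}" by blast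
    show "inv\<^bsub>GL\<^esub> w \<in> W0" if "w \<in> W0" for w
      using that W0_inv inv_GL full.W_invertible W0_subset by (metis subsetD)
    show "v \<otimes>\<^bsub>GL\<^esub> w \<in> W0" if "v \<in> W0" "w \<in> W0" for v w
      using W0_mult[OF that] by (simp add: GL_def)
  qed
qed

sublocale para: monodromy_data W0 b t r "refls W \<inter> W0" X0
proof (rule monodromy_data.intro[OF matrix_group_W0], rule monodromy_data_axioms.intro)
  show "refls W \<inter> W0 \<subseteq> refls W0"
    by (auto simp: refls_def)
  show "w ** s ** matrix_inv w \<in> refls W \<inter> W0" if "w \<in> W0" "s \<in> refls W \<inter> W0" for w s
  proof
    show "w ** s ** matrix_inv w \<in> refls W"
      by (rule full.refls_conj(1)) (use that W0_subset in auto)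
    show "w ** s ** matrix_inv w \<in> W0"
      using that by (intro W0_mult W0_inv) auto
  qed
  show "w = mat 1" if w: "w \<in> W0" and x: "x \<in> X0" and fix_x: "w *v x = x" for w x
  proof -
    obtain l where "x1 + l *\<^sub>R (x - x1) \<in> X"
      using eventually_happens[OF ray_in_X[OF x]] by auto
    moreover have "w *v (x1 + l *\<^sub>R (x - x1)) = x1 + l *\<^sub>R (x - x1)"
      using fix_x W0_fix[OF w]
      by (simp add: matrix_vector_right_distrib matrix_vector_mult_diff_distrib matrix_vector_scaleR)
    ultimately show ?thesis
      using full.free_X w W0_subset by blast
  qed
  show "r (v ** w) = r v ** r w" if "v \<in> W0" "w \<in> W0" for v w
    using that W0_subset r_mult by blast
  show "invertible (r w)" if "w \<in> W0" for w
    using that W0_subset r_inv by blast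
  show "r w ** t s ** matrix_inv (r w) = t (w ** s ** matrix_inv w)" if "w \<in> W0" "s \<in> refls W \<inter> W0" for w s
    using that W0_subset equivariant by blast
qed (use forms X0_eq flat_parabolic in auto)

lemma X_subset_X0: "X \<subseteq> X0"
  by (auto simp: X_eq X0_eq)

text \<open>The domain of \<open>gauge\<close> with centre \<open>x1\<close>. Being open, it
  supports differentiation at all points of \<open>X \<inter> \<Omega>\<close>, which it
  contains.\<close>

definition near_parabolic :: "(complex ^ 'n) set" where
  "near_parabolic = {x. \<forall>s\<in>refls W. if b s x1 = 0 then b s x \<noteq> 0 else norm (b s (x - x1)) < norm (b s x1)}"

text \<open>Near \<open>x1\<close> the full form differs from the parabolic one by a regular form, so the two are gauge equivalent.\<close>

lemma gauge_near_parabolic: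
  obtains K where "gauge_on near_parabolic (residue_form b t (refls W \<inter> W0)) (residue_form b t (refls W)) K"
    and "\<And>x. hcoeff 0 (K x) = mat 1" and "open near_parabolic" and "near_parabolic \<subseteq> X"
    and "\<And>w x. w \<in> W0 \<Longrightarrow> x \<in> near_parabolic \<Longrightarrow> w *v x \<in> near_parabolic \<Longrightarrow>
           K (w *v x) ** full.rho w = full.rho w ** K x"
proof -
  have sub: "near_parabolic \<subseteq> X"
  proof
    fix x assume x: "x \<in> near_parabolic"
    have "b s x \<noteq> 0" if s: "s \<in> refls W" for s
    proof (cases "b s x1 = 0")
      case False
      then have "norm (b s x - b s x1) < norm (b s x1)"
        using x s forms[OF s] linear_form_diff[of "b s" x x1] by (auto simp: near_parabolic_def)
      then show ?thesis by auto
    qed (use x s in \<open>auto simp: near_parabolic_def\<close>)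
    then show "x \<in> X" by (simp add: X_eq)
  qed
  interpret gauge "refls W" "refls W \<inter> W0" "refls W" b t x1 near_parabolic
  proof
    show "integrable_form near_parabolic (residue_form b t (refls W))"
      using flat sub by (auto simp: integrable_form_def)
    show "integrable_form near_parabolic (residue_form b t (refls W \<inter> W0))"
      using flat_parabolic sub X_subset_X0 by (auto simp: integrable_form_def)
  qed (use refls_finite forms x1_regular in \<open>auto simp: near_parabolic_def\<close>)
  obtain K where K: "gauge_on near_parabolic thL thR K" "\<And>x. hcoeff 0 (K x) = mat 1"
    "\<And>k x. x \<in> near_parabolic \<Longrightarrow> ((\<lambda>l. hcoeff (Suc k) (K (x1 + l *\<^sub>R (x - x1)))) \<longlongrightarrow> 0) (at_right 0)"
    by (rule gauge_on_exists) blast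
  have "K (w *v x) ** full.rho w = full.rho w ** K x"
    if w: "w \<in> W0" and x: "x \<in> near_parabolic" "w *v x \<in> near_parabolic" for w x
  proof -
    \<comment> \<open>The points at which both sides of the equivariance are governed by the
      equation for \<open>K\<close>; since \<open>w\<close> fixes \<open>x1\<close>, this set is
      again star-shaped about \<open>x1\<close>.\<close>
    let ?U = "near_parabolic \<inter> (*v) w -` near_parabolic"
    have wW: "w \<in> W" using w W0_subset by blast
    have ray: "w *v (x1 + l *\<^sub>R (y - x1)) = x1 + l *\<^sub>R (w *v y - x1)" for l y
      using W0_fix[OF w]
      by (simp add: matrix_vector_right_distrib matrix_vector_mult_diff_distrib matrix_vector_scaleR)
    have "gauge_on ?U (\<lambda>x v. thL (w *v x) (w *v v)) thR (\<lambda>x. K (w *v x) ** full.rho w)"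
    proof (rule gauge_on_mult)
      show "gauge_on ?U (\<lambda>x v. thL (w *v x) (w *v v)) (\<lambda>x v. thR (w *v x) (w *v v)) (\<lambda>x. K (w *v x))"
        by (rule gauge_on_subset[OF gauge_on_pullback[OF K(1)]]) blast
      show "gauge_on ?U (\<lambda>x v. thR (w *v x) (w *v v)) thR (\<lambda>x. full.rho w)"
        unfolding full.rho_def by (rule gauge_on_const) (rule full.residue_form_equivariant[OF wW])
    qed
    moreover have "gauge_on ?U (\<lambda>x v. thL (w *v x) (w *v v)) thR (\<lambda>x. full.rho w ** K x)"
    proof (rule gauge_on_mult)
      show "gauge_on ?U (\<lambda>x v. thL (w *v x) (w *v v)) thL (\<lambda>x. full.rho w)"
        unfolding full.rho_def by (rule gauge_on_const) (rule para.residue_form_equivariant[OF w])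
      show "gauge_on ?U thL thR K"
        by (rule gauge_on_subset[OF K(1)]) blast
    qed
    ultimately show ?thesis
    \<comment> \<open>Both sides are flat for the same pair of forms; at order 0 both equal
      \<open>r w\<close>, and at higher orders both tend to 0 at \<open>x1\<close>.\<close>
    proof (rule gauge_on_unique_ray[where p = x1])
      show "x1 + l *\<^sub>R (y - x1) \<in> ?U" if "y \<in> ?U" "0 < l" "l \<le> 1" for y l
        using that star_D by (simp add: ray)
      show "((\<lambda>l. hcoeff k (K (w *v (x1 + l *\<^sub>R (y - x1))) ** full.rho w)
          - hcoeff k (full.rho w ** K (x1 + l *\<^sub>R (y - x1)))) \<longlongrightarrow> 0) (at_right 0)" if y: "y \<in> ?U" for k y
        unfolding full.rho_def hcoeff_const_mult hcoeff_mult_const ray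
      proof (cases k)
        case (Suc k')
        have "((\<lambda>l. hcoeff k (K (x1 + l *\<^sub>R (w *v y - x1))) ** r w - r w ** hcoeff k (K (x1 + l *\<^sub>R (y - x1))))
            \<longlongrightarrow> 0 ** r w - r w ** 0) (at_right 0)"
          unfolding Suc using y
          by (intro tendsto_diff bounded_bilinear.tendsto[OF bounded_bilinear_matrix_mult] tendsto_const K(3)) auto
        then show "((\<lambda>l. hcoeff k (K (x1 + l *\<^sub>R (w *v y - x1))) ** r w - r w ** hcoeff k (K (x1 + l *\<^sub>R (y - x1))))
            \<longlongrightarrow> 0) (at_right 0)"
          by simp
      qed (simp add: K(2))
      show "x \<in> ?U" using x by blast
    qed
  qed
  with K open_D sub that show thesis by blast
qed

end

section \<open>The local embedding\<close>

lemma hermitian_norm_scale: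
  assumes "hermitian_inner B"
  shows "hermitian_norm B (c *s v) = norm c * hermitian_norm B v"
proof -
  have lin: "linear_form (\<lambda>x. B x y)" and conj: "B y x = cnj (B x y)" for x y
    using assms unfolding hermitian_inner_def by blast+
  have "B (c *s v) (c *s v) = c * B v (c *s v)"
    by (rule linear_form_scale[OF lin])
  also have "B v (c *s v) = cnj (B (c *s v) v)"
    by (rule conj)
  also have "B (c *s v) v = c * B v v"
    by (rule linear_form_scale[OF lin])
  also have "c * cnj (c * B v v) = c * cnj c * cnj (B v v)"
    by simp
  also have "cnj (B v v) = B v v"
    by (rule conj[symmetric])
  also have "c * cnj c * B v v = of_real ((norm c)\<^sup>2) * B v v"
    by (simp only: complex_norm_square)
  finally have "Re (B (c *s v) (c *s v)) = (norm c)\<^sup>2 * Re (B v v)"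
    by simp
  then show ?thesis
    by (simp add: hermitian_norm_def real_sqrt_mult)
qed

lemma continuous_hermitian_norm:
  assumes "hermitian_inner B" shows "continuous_on A (hermitian_norm B)"
proof -
  have lin: "linear_form (\<lambda>x. B x y)" and conj: "B y x = cnj (B x y)" for x y
    using assms unfolding hermitian_inner_def by blast+
  have l: "linear (\<lambda>x. B x y)" for y
    using linear_form_bounded_linear[OF lin] bounded_linear.linear by blast
  have "linear (B x)" for x
  proof -
    have "linear (\<lambda>u. cnj (B u x))"
      by (rule linearI) (simp_all add: linear_add[OF l] linear_cmul[OF l])
    moreover have "B x = (\<lambda>u. cnj (B u x))"
      by (rule ext) (rule conj)
    ultimately show ?thesis by (simp only:)
  qed
  with l have "bilinear B"
    by (simp add: bilinear_def)
  then have "bounded_bilinear B"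
    by (simp add: bilinear_conv_bounded_bilinear)
  then have "continuous_on A (\<lambda>x. B x x)"
    by (rule bounded_bilinear.continuous_on) (rule continuous_on_id)+
  then show ?thesis
    unfolding hermitian_norm_def by (intro continuous_intros)
qed

lemma orbit_map_orbit_of:
  assumes "W0 \<subseteq> W" "matrix_group W" "mat 1 \<in> W0"
  shows "orbit_map W (orbit_of W0 x) = orbit_of W x"
proof -
  interpret matrix_group W by (rule assms(2))
  have "orbit_of W y = orbit_of W x" if y: "y \<in> orbit_of W0 x" for y
  proof -
    obtain w where "w \<in> W0" "y = w *v x"
      using y unfolding orbit_of_def by blast
    then show ?thesis
      using orbit_of_act[of w x] assms(1) by blast
  qed
  moreover have "x \<in> orbit_of W0 x"
    unfolding orbit_of_def using assms(3) by (metis image_eqI matrix_vector_mul_lid)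
  ultimately show ?thesis
    unfolding orbit_map_def by blast
qed

locale embedding_setup = parabolic_setup W W0 b t r I X X0 x1
  for W W0 :: "(complex ^ 'n ^ 'n) set"
    and b :: "complex ^ 'n ^ 'n \<Rightarrow> complex ^ 'n \<Rightarrow> complex"
    and t r :: "complex ^ 'n ^ 'n \<Rightarrow> complex ^ 'm ^ 'm"
    and I X X0 :: "(complex ^ 'n) set" and x1 :: "complex ^ 'n" +
  fixes B :: "complex ^ 'n \<Rightarrow> complex ^ 'n \<Rightarrow> complex" and \<epsilon> :: real
    and \<Omega> :: "(complex ^ 'n) set" and x2 :: "complex ^ 'n"
  assumes hermitian: "hermitian_inner B"
    and invariant: "\<And>w x y. w \<in> W \<Longrightarrow> B (w *v x) (w *v y) = B x y"
    and eps: "\<epsilon> > 0" and Omega: "\<Omega> = {x. hermitian_norm B (x - x1) \<le> \<epsilon>}"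
    and Omega_avoids: "\<And>s. s \<in> refls W \<Longrightarrow> s \<notin> W0 \<Longrightarrow> \<Omega> \<inter> fixed_space s = {}"
    and x2: "x2 \<in> X" "hermitian_norm B (x2 - x1) < \<epsilon>"
begin

lemma hermitian_norm_scaleR: "0 \<le> a \<Longrightarrow> hermitian_norm B (a *\<^sub>R v) = a * hermitian_norm B v"
  by (simp add: scaleR_eq_vector_scalar hermitian_norm_scale[OF hermitian])

lemma hermitian_norm_nonneg: "0 \<le> hermitian_norm B v"
proof (cases "v = 0")
  case True
  then have "hermitian_norm B v = hermitian_norm B (0 *\<^sub>R v)" by simp
  then show ?thesis unfolding hermitian_norm_scaleR[OF order_refl] by simp
next
  case False
  then have "Re (B v v) > 0"
    using hermitian unfolding hermitian_inner_def by blast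
  then show ?thesis
    by (simp add: hermitian_norm_def)
qed

lemma hermitian_norm_act:
  assumes "w \<in> W0" shows "hermitian_norm B (w *v x - x1) = hermitian_norm B (x - x1)"
proof -
  have eq: "w *v x - x1 = w *v (x - x1)"
    using W0_fix[OF assms] by (simp add: matrix_vector_mult_diff_distrib)
  have "w \<in> W" using assms W0_subset by blast
  then show ?thesis
    unfolding eq hermitian_norm_def by (simp only: invariant)
qed

lemma Omega_X0_subset: "\<Omega> \<inter> X0 \<subseteq> X"
proof
  fix x assume x: "x \<in> \<Omega> \<inter> X0"
  have "b s x \<noteq> 0" if s: "s \<in> refls W" for s
  proof (cases "s \<in> W0")
    case True
    then show ?thesis using x s by (simp add: X0_eq)
  next
    case False
    then have "x \<notin> fixed_space s"
      using Omega_avoids[OF s] x by blast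
    then show ?thesis using forms[OF s] by blast
  qed
  then show "x \<in> X" by (simp add: X_eq)
qed

text \<open>If \<open>x\<close> were outside, a multiple of \<open>x - x1\<close> of smaller norm would lead from \<open>x1\<close> to a hyperplane.\<close>

lemma Omega_near_parabolic: "\<Omega> \<inter> X \<subseteq> near_parabolic"
proof
  fix x assume x: "x \<in> \<Omega> \<inter> X"
  have "norm (b s (x - x1)) < norm (b s x1)" if s: "s \<in> refls W" "b s x1 \<noteq> 0" for s
  proof (rule ccontr)
    assume not_less: "\<not> ?thesis"
    define \<zeta> where "\<zeta> = b s x1 / b s (x - x1)"
    have nz: "b s (x - x1) \<noteq> 0" using not_less s(2) by auto
    have "norm \<zeta> \<le> 1"
      using not_less nz by (simp add: \<zeta>_def norm_divide divide_le_eq)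
    let ?y = "x1 - \<zeta> *s (x - x1)"
    have lf: "linear_form (b s)" using forms s by blast
    have "b s ?y = b s x1 - \<zeta> * b s (x - x1)"
      by (simp only: linear_form_diff[OF lf, of x1] linear_form_scale[OF lf])
    then have "b s ?y = 0"
      using nz by (simp only: \<zeta>_def) simp
    then have "?y \<in> fixed_space s" using forms s by blast
    moreover have "hermitian_norm B (?y - x1) \<le> \<epsilon>"
    proof -
      have "?y - x1 = (- \<zeta>) *s (x - x1)"
        by (simp add: vec_eq_iff)
      then have "hermitian_norm B (?y - x1) = norm \<zeta> * hermitian_norm B (x - x1)"
        using hermitian_norm_scale[OF hermitian, of "- \<zeta>" "x - x1"] by simp
      also have "\<dots> \<le> 1 * hermitian_norm B (x - x1)"
        using \<open>norm \<zeta> \<le> 1\<close> hermitian_norm_nonneg by (intro mult_right_mono)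
      also have "\<dots> \<le> \<epsilon>" using x by (simp add: Omega)
      finally show ?thesis .
    qed
    ultimately have "\<Omega> \<inter> fixed_space s \<noteq> {}"
      unfolding Omega by blast
    moreover have "s \<notin> W0" using x1_regular s by blast
    ultimately show False using Omega_avoids s by blast
  qed
  then show "x \<in> near_parabolic"
    using x by (simp add: near_parabolic_def X_eq)
qed

text \<open>All hyperplanes of \<open>X0\<close> pass through \<open>x1\<close>, so positive scaling
  about \<open>x1\<close> preserves \<open>X0\<close>, and so does each stage of the linear
  homotopy. The ends have norm below \<open>\<epsilon>\<close>, since \<open>v\<close> preserves the
  distance to \<open>x1\<close>, and are not moved.\<close>

lemma radial_retraction:
  assumes g: "path g" "path_image g \<subseteq> X0" "pathstart g = x2" "pathfinish g = v *v x2" and v: "v \<in> W0"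
  obtains g' where "homotopic_paths X0 g g'" "path_image g' \<subseteq> X \<inter> \<Omega>"
proof -
  define N where "N = (\<lambda>\<tau>. hermitian_norm B (g \<tau> - x1))"
  \<comment> \<open>The factor is 1 inside the ball and pulls outer points back to its boundary
    sphere.\<close>
  define \<mu> where "\<mu> = (\<lambda>\<tau>. \<epsilon> / max \<epsilon> (N \<tau>))"
  define g' where "g' = (\<lambda>\<tau>. x1 + \<mu> \<tau> *\<^sub>R (g \<tau> - x1))"
  have cont: "continuous_on {0..1} g" using g by (simp add: path_def)
  have \<mu>: "0 < \<mu> \<tau>" "\<mu> \<tau> * N \<tau> \<le> \<epsilon>" for \<tau>
  proof -
    have "max \<epsilon> (N \<tau>) > 0" using eps by simp
    then show "0 < \<mu> \<tau>" "\<mu> \<tau> * N \<tau> \<le> \<epsilon>"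
      using eps by (simp_all add: \<mu>_def pos_divide_le_eq mult_left_mono)
  qed
  have "continuous_on {0..1} N"
    unfolding N_def by (intro continuous_on_compose2[OF continuous_hermitian_norm[OF hermitian, of UNIV]] continuous_intros cont) auto
  then have "continuous_on {0..1} \<mu>"
    unfolding \<mu>_def using eps by (intro continuous_intros) (auto simp: max_def)
  then have g'_path: "path g'"
    unfolding path_def g'_def by (intro continuous_intros cont)
  have in_X0: "x1 + c *\<^sub>R (g \<tau> - x1) \<in> X0" if c: "c > 0" and \<tau>: "\<tau> \<in> {0..1}" for c \<tau>
  proof -
    have "b s (x1 + c *\<^sub>R (g \<tau> - x1)) \<noteq> 0" if s: "s \<in> refls W" "s \<in> W0" for s
    proof -
      have lf: "linear_form (b s)" using forms s by blast
      have "g \<tau> \<in> X0" using g(2) \<tau> by (auto simp: path_image_def)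
      then have "b s (g \<tau>) \<noteq> 0" using s by (simp add: X0_eq)
      then show ?thesis
        using c x1_regular[OF s(1)] s(2)
        by (simp add: linear_form_add[OF lf] linear_form_scaleR[OF lf] linear_form_diff[OF lf])
    qed
    then show ?thesis by (simp add: X0_eq)
  qed
  have ends: "g' \<tau> = g \<tau>" if "N \<tau> < \<epsilon>" for \<tau>
    using that eps by (simp add: g'_def \<mu>_def max_def)
  have N0: "N 0 < \<epsilon>" using x2 g by (simp add: N_def pathstart_def)
  have N1: "N 1 < \<epsilon>" using x2 g hermitian_norm_act[OF v] by (simp add: N_def pathfinish_def)
  have "homotopic_paths X0 g g'"
  proof (rule homotopic_paths_linear[OF g(1) g'_path])
    show "pathstart g' = pathstart g" "pathfinish g' = pathfinish g"
      using ends[OF N0] ends[OF N1] by (simp_all add: pathstart_def pathfinish_def)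
    show "closed_segment (g \<tau>) (g' \<tau>) \<subseteq> X0" if \<tau>: "\<tau> \<in> {0..1}" for \<tau>
    proof
      fix y assume "y \<in> closed_segment (g \<tau>) (g' \<tau>)"
      then obtain u where u: "0 \<le> u" "u \<le> 1" "y = (1 - u) *\<^sub>R g \<tau> + u *\<^sub>R g' \<tau>"
        by (auto simp: closed_segment_def)
      have "y = x1 + ((1 - u) + u * \<mu> \<tau>) *\<^sub>R (g \<tau> - x1)"
        unfolding u(3) g'_def by (simp add: algebra_simps)
      moreover have "(1 - u) + u * \<mu> \<tau> > 0"
      proof (cases "u = 1")
        case False
        then have "1 - u > 0" using u(2) by simp
        moreover have "u * \<mu> \<tau> \<ge> 0" using u(1) \<mu>(1)[of \<tau>] by simp
        ultimately show ?thesis by linarith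
      qed (simp add: \<mu>(1))
      ultimately show "y \<in> X0" using in_X0[OF _ \<tau>] by simp
    qed
  qed
  moreover have "path_image g' \<subseteq> X \<inter> \<Omega>"
  proof
    fix y assume "y \<in> path_image g'"
    then obtain \<tau> where \<tau>: "\<tau> \<in> {0..1}" "y = g' \<tau>" by (auto simp: path_image_def)
    have "y \<in> \<Omega>"
      using \<mu>[of \<tau>] by (simp add: Omega \<tau>(2) g'_def hermitian_norm_scaleR less_imp_le N_def)
    moreover have "y \<in> X0"
      unfolding \<tau>(2) g'_def by (rule in_X0[OF \<mu>(1) \<tau>(1)])
    ultimately show "y \<in> X \<inter> \<Omega>" using Omega_X0_subset by blast
  qed
  ultimately show thesis by (rule that)
qed

text \<open>The retraction shows that the class has a preimage, so \<open>inv_into\<close> returns a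
  genuine one. A representative \<open>p\<close> of whatever preimage it returns still represents
  the class of \<open>g\<close> over \<open>X0\<close>, hence lifts to a path \<open>g'\<close>
  homotopic to \<open>g\<close> in \<open>X0\<close>.\<close>

lemma local_embedding_path_class:
  assumes g: "path g" "path_image g \<subseteq> X0" "pathstart g = x2" "pathfinish g = v *v x2" and v: "v \<in> W0"
  obtains g' where "homotopic_paths X0 g g'" "path_image g' \<subseteq> X \<inter> \<Omega>"
    "local_embedding W X W0 X0 \<Omega> x2 (path_class (orbit_space W0 X0) (orbit_of W0 \<circ> g))
       = path_class (orbit_space W X) (orbit_of W \<circ> g')"
proof -
  let ?S = "orbit_space W0 (X \<inter> \<Omega>)"
  let ?c = "path_class (orbit_space W0 X0) (orbit_of W0 \<circ> g)"
  let ?f = "induced_map (orbit_space W0 X0) (\<lambda>c. c)"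
  let ?G = "carrier (fundamental_group ?S (orbit_of W0 x2))"
  have sub: "X \<inter> \<Omega> \<subseteq> X0" using X_subset_X0 by blast
  have cont_S: "continuous_map (top_of_set (X \<inter> \<Omega>)) ?S (orbit_of W0)"
    by (rule quotient_imp_continuous_map[OF quotient_map_orbit_of])
  have cont_id: "continuous_map ?S (orbit_space W0 X0) (\<lambda>c. c)"
  proof (rule continuous_compose_quotient_map[OF quotient_map_orbit_of])
    show "continuous_map (top_of_set (X \<inter> \<Omega>)) (orbit_space W0 X0) ((\<lambda>c. c) \<circ> orbit_of W0)"
      using continuous_map_from_subtopology_mono[OF para.continuous_map_orbit_of sub] by (simp add: comp_def)
  qed
  have orbit: "orbit_map W (orbit_of W0 x) = orbit_of W x" for x
    by (rule orbit_map_orbit_of[OF W0_subset full.matrix_group_axioms para.W_one])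
  have cont_W: "continuous_map ?S (orbit_space W X) (orbit_map W)"
  proof (rule continuous_compose_quotient_map[OF quotient_map_orbit_of])
    have "continuous_map (top_of_set (X \<inter> \<Omega>)) (orbit_space W X) (orbit_of W)"
      by (rule continuous_map_from_subtopology_mono[OF full.continuous_map_orbit_of]) blast
    then show "continuous_map (top_of_set (X \<inter> \<Omega>)) (orbit_space W X) (orbit_map W \<circ> orbit_of W0)"
      by (simp add: comp_def orbit)
  qed
  obtain g2 where g2: "homotopic_paths X0 g g2" "path_image g2 \<subseteq> X \<inter> \<Omega>"
    by (rule radial_retraction[OF g v])
  have pg2: "pathin ?S (orbit_of W0 \<circ> g2)"
  proof (rule pathin_compose[OF _ cont_S])
    show "pathin (top_of_set (X \<inter> \<Omega>)) g2"
      using g2 homotopic_paths_imp_path[OF g2(1)] by (auto simp: pathin_canon_iff path_image_def)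
  qed
  have "path_class ?S (orbit_of W0 \<circ> g2) \<in> ?G"
  proof -
    have "(orbit_of W0 \<circ> g2) 0 = orbit_of W0 x2" "(orbit_of W0 \<circ> g2) 1 = orbit_of W0 x2"
      using homotopic_paths_imp_pathstart[OF g2(1)] homotopic_paths_imp_pathfinish[OF g2(1)] g
        para.orbit_of_act[OF v] by (simp_all add: pathstart_def pathfinish_def)
    with pg2 show ?thesis
      unfolding fundamental_group_def by auto
  qed
  moreover have "?f (path_class ?S (orbit_of W0 \<circ> g2)) = ?c"
    using induced_map_path_class[OF cont_id pg2] path_class_eq[OF para.homotopic_paths_imp_pathsin[OF g2(1)]]
    by (simp add: comp_def)
  ultimately have img: "?c \<in> ?f ` ?G" by (metis image_eqI)
  define e where "e = inv_into ?G ?f ?c"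
  have "e \<in> ?G" and fe: "?f e = ?c"
    unfolding e_def using inv_into_into[OF img] f_inv_into_f[OF img] by simp_all
  then obtain p where p: "pathin ?S p" "e = path_class ?S p"
    unfolding fundamental_group_def by auto
  have "path_class (orbit_space W0 X0) p = ?c"
    using fe induced_map_path_class[OF cont_id p(1)] unfolding p(2) by (simp add: comp_def)
  moreover have "pathin (orbit_space W0 X0) p"
    using pathin_compose[OF p(1) cont_id] by (simp add: comp_def)
  ultimately have "p \<in> ?c"
    using path_class_self by metis
  then obtain g' where g': "homotopic_paths X0 g g'" "\<And>\<tau>. \<tau> \<in> {0..1} \<Longrightarrow> orbit_of W0 (g' \<tau>) = p \<tau>"
    by (rule para.lift_path_class[OF _ g(1,2)]) blast
  \<comment> \<open>The lift was taken in \<open>X0\<close>, but \<open>p\<close> runs through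
    orbits of points of \<open>X \<inter> \<Omega>\<close>, and this set is stable under
    \<open>W0\<close>.\<close>
  have g'_in: "path_image g' \<subseteq> X \<inter> \<Omega>"
  proof
    fix y assume "y \<in> path_image g'"
    then obtain \<tau> where \<tau>: "\<tau> \<in> {0..1}" "y = g' \<tau>" by (auto simp: path_image_def)
    have "p \<tau> \<in> orbit_of W0 ` (X \<inter> \<Omega>)"
      using p(1) \<tau>(1) continuous_map_image_subset_topspace[of "top_of_set {0..1}" ?S p]
      by (auto simp: pathin_def topspace_orbit_space)
    then obtain x where x: "x \<in> X" "x \<in> \<Omega>" "orbit_of W0 x = orbit_of W0 y"
      using g'(2)[OF \<tau>(1)] \<tau>(2) by auto
    then obtain w where w: "w \<in> W0" "y = w *v x"
      using para.orbit_of_eq_iff by blast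
    then show "y \<in> X \<inter> \<Omega>"
      using x full.X_stable[of w x] W0_subset hermitian_norm_act[OF w(1), of x] by (auto simp: Omega)
  qed
  have "local_embedding W X W0 X0 \<Omega> x2 ?c = induced_map (orbit_space W X) (orbit_map W) e"
    by (simp add: local_embedding_def e_def)
  also have "\<dots> = path_class (orbit_space W X) (orbit_map W \<circ> p)"
    unfolding p(2) by (rule induced_map_path_class[OF cont_W p(1)])
  also have "\<dots> = path_class (orbit_space W X) (orbit_of W \<circ> g')"
  proof (rule path_class_eq[OF homotopic_pathsin_eq])
    show "pathin (orbit_space W X) (orbit_map W \<circ> p)"
      by (rule pathin_compose[OF p(1) cont_W])
    show "(orbit_map W \<circ> p) \<tau> = (orbit_of W \<circ> g') \<tau>" if "\<tau> \<in> {0..1}" for \<tau>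
      using g'(2)[OF that] orbit by (metis comp_apply)
  qed
  finally show thesis
    by (rule that[OF g'(1) g'_in])
qed

lemma transport_near_parabolic:
  assumes K: "gauge_on near_parabolic (residue_form b t (refls W \<inter> W0)) (residue_form b t (refls W)) K" "open near_parabolic"
    and g: "path g" "path_image g \<subseteq> X \<inter> \<Omega>"
  shows "K (pathfinish g) ** full.T g = para.T g ** K (pathstart g)"
proof -
  have "K (pathfinish g) ** full.T g = para.T (\<lambda>\<tau>. mat 1 *v g \<tau>) ** K (pathstart g)"
  proof (rule transport_gauge[OF full.connection_axioms para.connection_axioms _ K(2) g(1)])
    show "gauge_on near_parabolic (\<lambda>x v. residue_form b t (refls W \<inter> W0) (mat 1 *v x) (mat 1 *v v))
        (residue_form b t (refls W)) K"
      using K(1) by simp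
    show "path_image g \<subseteq> X" using g(2) by blast
    show "path_image g \<subseteq> near_parabolic" using g(2) Omega_near_parabolic by blast
    show "\<And>x. x \<in> path_image g \<Longrightarrow> mat 1 *v x \<in> X0" using g(2) X_subset_X0 by auto
  qed
  then show ?thesis by simp
qed

theorem restricted_monodromy:
  assumes eta: "path \<eta>" "path_image \<eta> \<subseteq> X" "pathstart \<eta> = x2" "pathfinish \<eta> = z"
    and eta0: "path \<eta>0" "path_image \<eta>0 \<subseteq> X0" "pathstart \<eta>0 = z0" "pathfinish \<eta>0 = x2"
  shows "isomorphic_reps (fundamental_group (orbit_space W0 X0) (orbit_of W0 z0))
           (monodromy X W r (h_times (residue_form b t (refls W))) z \<circ>
            (change_base (orbit_space W X) (orbit_of W \<circ> \<eta>) \<circ>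
             local_embedding W X W0 X0 \<Omega> x2 \<circ>
             change_base (orbit_space W0 X0) (orbit_of W0 \<circ> \<eta>0)))
           (monodromy X0 W0 r (h_times (residue_form b t (refls W \<inter> W0))) z0)"
proof -
  obtain K where K: "gauge_on near_parabolic (residue_form b t (refls W \<inter> W0)) (residue_form b t (refls W)) K"
    and K0: "\<And>x. hcoeff 0 (K x) = mat 1" and near: "open near_parabolic" "near_parabolic \<subseteq> X"
    and K_act: "\<And>w x. w \<in> W0 \<Longrightarrow> x \<in> near_parabolic \<Longrightarrow> w *v x \<in> near_parabolic \<Longrightarrow>
           K (w *v x) ** full.rho w = full.rho w ** K x"
    by (rule gauge_near_parabolic) blast
  note T_inv = full.transport_reversepath[OF eta(1,2)] para.transport_reversepath[OF eta0(1,2)]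
  \<comment> \<open>Read from right to left: from \<open>z\<close> back to \<open>x2\<close>, across
    the gauge transformation, then from \<open>x2\<close> to \<open>z0\<close>.\<close>
  define Q where "Q = para.T (reversepath \<eta>0) ** K x2 ** full.T (reversepath \<eta>)"
  have "invertible (to_fls Q)"
    unfolding Q_def to_fls_mult
    by (intro invertible_mult invertible_to_fls K0 invertible_to_fls_inverse[OF T_inv(1,2)]
        invertible_to_fls_inverse[OF T_inv(3,4)])
  moreover have "to_fls Q ** monodromy X W r (h_times (residue_form b t (refls W))) z
        (change_base (orbit_space W X) (orbit_of W \<circ> \<eta>)
          (local_embedding W X W0 X0 \<Omega> x2 (change_base (orbit_space W0 X0) (orbit_of W0 \<circ> \<eta>0) c)))
      = monodromy X0 W0 r (h_times (residue_form b t (refls W \<inter> W0))) z0 c ** to_fls Q"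
    if c: "c \<in> carrier (fundamental_group (orbit_space W0 X0) (orbit_of W0 z0))" for c
  proof -
    obtain q where q: "pathin (orbit_space W0 X0) q" "q 0 = orbit_of W0 z0" "q 1 = orbit_of W0 z0"
      "c = path_class (orbit_space W0 X0) q"
      using c unfolding fundamental_group_def by auto
    have z0: "z0 \<in> X0" using eta0 pathstart_in_path_image by blast
    obtain g where g: "path g" "path_image g \<subseteq> X0" "pathstart g = z0"
      and gq: "\<And>\<tau>. \<tau> \<in> {0..1} \<Longrightarrow> orbit_of W0 (g \<tau>) = q \<tau>"
      by (rule para.lift_pathin[OF q(1,2) z0]) blast
    have c_eq: "c = path_class (orbit_space W0 X0) (orbit_of W0 \<circ> g)"
      unfolding q(4) by (rule path_class_eq[OF homotopic_pathsin_eq[OF q(1)]]) (simp add: gq)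
    have "orbit_of W0 z0 = orbit_of W0 (pathfinish g)"
      using gq[of 1] q(3) by (simp add: pathfinish_def)
    then obtain v where v: "v \<in> W0" "pathfinish g = v *v z0"
      using para.orbit_of_eq_iff by blast
    have vW: "v \<in> W" using v W0_subset by blast
    define w where "w = matrix_inv v"
    have w: "w \<in> W0" unfolding w_def by (rule W0_inv[OF v(1)])
    define g1 where "g1 = reversepath \<eta>0 +++ (g +++ (\<lambda>\<tau>. v *v \<eta>0 \<tau>))"
    have v\<eta>0: "path (\<lambda>\<tau>. v *v \<eta>0 \<tau>)" "path_image (\<lambda>\<tau>. v *v \<eta>0 \<tau>) \<subseteq> X0"
      "pathstart (\<lambda>\<tau>. v *v \<eta>0 \<tau>) = v *v z0" "pathfinish (\<lambda>\<tau>. v *v \<eta>0 \<tau>) = v *v x2"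
      using eta0 para.X_stable[OF v(1)] full.path_act by (auto simp: path_image_def pathstart_def pathfinish_def)
    have g1: "path g1" "path_image g1 \<subseteq> X0" "pathstart g1 = x2" "pathfinish g1 = v *v x2"
      unfolding g1_def using eta0 g v v\<eta>0 by (auto simp: path_image_join)
    have c1: "change_base (orbit_space W0 X0) (orbit_of W0 \<circ> \<eta>0) c = path_class (orbit_space W0 X0) (orbit_of W0 \<circ> g1)"
      unfolding c_eq g1_def by (rule para.change_base_path_class[OF g v(2) eta0(1-3) v(1)])
    obtain g3 where g3: "homotopic_paths X0 g1 g3" "path_image g3 \<subseteq> X \<inter> \<Omega>"
      and c3: "local_embedding W X W0 X0 \<Omega> x2 (path_class (orbit_space W0 X0) (orbit_of W0 \<circ> g1))
        = path_class (orbit_space W X) (orbit_of W \<circ> g3)"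
      by (rule local_embedding_path_class[OF g1 v(1)])
    have g3': "path g3" "path_image g3 \<subseteq> X" "pathstart g3 = x2" "pathfinish g3 = v *v x2"
      using g3 homotopic_paths_imp_path[OF g3(1)] homotopic_paths_imp_pathstart[OF g3(1)]
        homotopic_paths_imp_pathfinish[OF g3(1)] g1 by auto
    define g4 where "g4 = reversepath \<eta> +++ (g3 +++ (\<lambda>\<tau>. v *v \<eta> \<tau>))"
    have v\<eta>: "path (\<lambda>\<tau>. v *v \<eta> \<tau>)" "path_image (\<lambda>\<tau>. v *v \<eta> \<tau>) \<subseteq> X"
      "pathstart (\<lambda>\<tau>. v *v \<eta> \<tau>) = v *v x2" "pathfinish (\<lambda>\<tau>. v *v \<eta> \<tau>) = v *v z"
      using eta full.X_stable[OF vW] full.path_act by (auto simp: path_image_def pathstart_def pathfinish_def)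
    have g4: "path g4" "path_image g4 \<subseteq> X" "pathstart g4 = z" "pathfinish g4 = v *v z"
      unfolding g4_def using eta g3' v\<eta> by (auto simp: path_image_join)
    have c4: "change_base (orbit_space W X) (orbit_of W \<circ> \<eta>) (path_class (orbit_space W X) (orbit_of W \<circ> g3))
        = path_class (orbit_space W X) (orbit_of W \<circ> g4)"
      unfolding g4_def by (rule full.change_base_path_class[OF g3' eta(1-3) vW])
    have m: "monodromy X W r (h_times (residue_form b t (refls W))) z (path_class (orbit_space W X) (orbit_of W \<circ> g4))
        = to_fls (full.rho w ** full.T g4)"
      unfolding w_def by (rule full.monodromy_eq[OF vW g4])
    have m0: "monodromy X0 W0 r (h_times (residue_form b t (refls W \<inter> W0))) z0 c = to_fls (full.rho w ** para.T g)"
      unfolding w_def c_eq full.rho_def using para.monodromy_eq[OF v(1) g v(2)] unfolding para.rho_def .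
    have t4: "full.rho w ** full.T g4 = full.T \<eta> ** (full.rho w ** full.T g3) ** full.T (reversepath \<eta>)"
      unfolding g4_def w_def by (rule full.transport_change_base[OF vW g3' eta(1-3)])
    have t1: "full.rho w ** para.T g1 = para.T \<eta>0 ** (full.rho w ** para.T g) ** para.T (reversepath \<eta>0)"
      unfolding g1_def w_def full.rho_def using para.transport_change_base[OF v(1) g v(2) eta0(1-3)] unfolding para.rho_def .
    \<comment> \<open>The homotopy from \<open>g1\<close> to \<open>g3\<close> runs in
      \<open>X0\<close>, so it compares the parabolic transports; the full transport is taken along
      \<open>g3\<close>, which stays in \<open>X\<close>.\<close>
    have t3: "para.T g3 = para.T g1"
      by (rule para.transport_homotopic[OF g3(1), symmetric])
    have gauge: "K (v *v x2) ** full.T g3 = para.T g3 ** K x2"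
      using transport_near_parabolic[OF K near(1) g3'(1) g3(2)] by (simp only: g3'(3,4))
    have vx2: "w *v (v *v x2) = x2"
      unfolding w_def by (rule full.W_inverse(4)[OF vW])
    have "x2 \<in> path_image g3" "v *v x2 \<in> path_image g3"
      using pathstart_in_path_image[of g3] pathfinish_in_path_image[of g3] by (simp_all only: g3'(3,4))
    then have "x2 \<in> near_parabolic" "v *v x2 \<in> near_parabolic"
      using g3(2) Omega_near_parabolic by blast+
    then have "K (w *v (v *v x2)) ** full.rho w = full.rho w ** K (v *v x2)"
      by (intro K_act w) (simp_all only: vx2)
    then have act: "K x2 ** full.rho w = full.rho w ** K (v *v x2)"
      by (simp only: vx2)
    \<comment> \<open>The heart of the comparison at \<open>x2\<close>: \<open>K\<close> is first
      moved past the group element, which shifts its argument to the end point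
      \<open>v *v x2\<close>, and then past the transport along \<open>g3\<close>, which brings it
      back to \<open>x2\<close>.\<close>
    have "K x2 ** (full.rho w ** full.T g3) = full.rho w ** (K (v *v x2) ** full.T g3)"
      by (simp only: matrix_mul_assoc act)
    also have "\<dots> = (full.rho w ** para.T g1) ** K x2"
      by (simp only: gauge t3 matrix_mul_assoc)
    finally have key: "K x2 ** (full.rho w ** full.T g3) = (full.rho w ** para.T g1) ** K x2" .
    let ?E = "full.T (reversepath \<eta>)" and ?F = "para.T (reversepath \<eta>0)"
    have "Q ** (full.rho w ** full.T g4) = ?F ** K x2 ** (?E ** full.T \<eta>) ** (full.rho w ** full.T g3) ** ?E"
      unfolding Q_def t4 by (simp only: matrix_mul_assoc)
    also have "\<dots> = ?F ** (K x2 ** (full.rho w ** full.T g3)) ** ?E"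
      by (simp only: T_inv(1) matrix_mul_rid matrix_mul_assoc)
    also have "\<dots> = (?F ** para.T \<eta>0) ** (full.rho w ** para.T g) ** (?F ** K x2 ** ?E)"
      unfolding key t1 by (simp only: matrix_mul_assoc)
    also have "\<dots> = (full.rho w ** para.T g) ** Q"
      unfolding Q_def by (simp only: T_inv(3) matrix_mul_lid)
    finally show ?thesis
      unfolding c1 c3 c4 m m0 by (simp only: to_fls_mult[symmetric])
  qed
  ultimately show ?thesis
    unfolding isomorphic_reps_def comp_apply by blast
qed

end

text \<open>The paths \<open>\<eta>\<close> and \<open>\<eta>0\<close> join the base points to
  \<open>x2\<close>, so the restriction is taken along the embedding of the group based at
  \<open>z0\<close> into the one based at \<open>z\<close>; varying them gives the conjugates of the
  embedding.\<close>

theorem theorem1: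
  fixes W W0 :: "(complex ^ 'n ^ 'n) set"
    and r :: "complex ^ 'n ^ 'n \<Rightarrow> complex ^ 'm ^ 'm"
    and t :: "complex ^ 'n ^ 'n \<Rightarrow> complex ^ 'm ^ 'm"
    and b :: "complex ^ 'n ^ 'n \<Rightarrow> complex ^ 'n \<Rightarrow> complex"
    and \<omega> \<omega>0 :: "complex ^ 'n \<Rightarrow> complex ^ 'n \<Rightarrow> complex fps ^ 'm ^ 'm"
    and I X X0 \<Omega> :: "(complex ^ 'n) set"
    and \<A>0 :: "(complex ^ 'n) set set"
    and B :: "complex ^ 'n \<Rightarrow> complex ^ 'n \<Rightarrow> complex"
    and x1 x2 z z0 :: "complex ^ 'n"
    and \<epsilon> :: real
    and \<eta> \<eta>0 :: "real \<Rightarrow> complex ^ 'n"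
  assumes refl_group: "reflection_group W"
    and X: "X = UNIV - \<Union>(arrangement W)"
    and action: "r \<in> hom (GL\<lparr>carrier := W\<rparr>) GL"
    and forms: "\<And>s. s \<in> refls W \<Longrightarrow> linear_form (b s) \<and> {x. b s x = 0} = fixed_space s"
    and \<omega>: "\<omega> = h_times (residue_form b t (refls W))"
    and integrable: "integrable_form X (residue_form b t (refls W))"
    and equivariant: "\<And>w s. w \<in> W \<Longrightarrow> s \<in> refls W \<Longrightarrow>
           r w ** t s ** matrix_inv (r w) = t (w ** s ** matrix_inv w)"
    and I: "vec.subspace I" "I \<noteq> UNIV"
    and W0: "W0 = parabolic W I"
    and A0: "\<A>0 = {H \<in> arrangement W. I \<subseteq> H}"
    and X0: "X0 = UNIV - \<Union>\<A>0"
    and \<omega>0: "\<omega>0 = h_times (residue_form b t (refls W \<inter> W0))"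
    and hermitian: "hermitian_inner B"
    and invariant: "\<And>w x y. w \<in> W \<Longrightarrow> B (w *v x) (w *v y) = B x y"
    and x1: "x1 \<in> I" "\<And>H. H \<in> arrangement W - \<A>0 \<Longrightarrow> x1 \<notin> H"
    and \<epsilon>: "\<epsilon> > 0"
    and Omega: "\<Omega> = {x. hermitian_norm B (x - x1) \<le> \<epsilon>}"
    and Omega_avoids: "\<And>H. H \<in> arrangement W - \<A>0 \<Longrightarrow> \<Omega> \<inter> H = {}"
    and x2: "x2 \<in> X" "hermitian_norm B (x2 - x1) < \<epsilon>"
    and base_path: "path \<eta>" "path_image \<eta> \<subseteq> X" "pathstart \<eta> = x2" "pathfinish \<eta> = z"
    and base_path0: "path \<eta>0" "path_image \<eta>0 \<subseteq> X0" "pathstart \<eta>0 = z0" "pathfinish \<eta>0 = x2"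
  shows "isomorphic_reps (fundamental_group (orbit_space W0 X0) (orbit_of W0 z0))
           (monodromy X W r \<omega> z \<circ>
            (change_base (orbit_space W X) (orbit_of W \<circ> \<eta>) \<circ>
             local_embedding W X W0 X0 \<Omega> x2 \<circ>
             change_base (orbit_space W0 X0) (orbit_of W0 \<circ> \<eta>0)))
           (monodromy X0 W0 r \<omega>0 z0)"
proof -
  \<comment> \<open>This translates between the two descriptions of the parabolic data, by group
    elements fixing \<open>I\<close> and by hyperplanes containing \<open>I\<close>.\<close>
  have in_W0: "s \<in> W0 \<longleftrightarrow> I \<subseteq> fixed_space s" if "s \<in> refls W" for s
    using that by (auto simp: W0 parabolic_def fixed_space_def refls_def)
  have ker: "b s x = 0 \<longleftrightarrow> x \<in> fixed_space s" if "s \<in> refls W" for s x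
    using forms[OF that] by blast
  have outside: "fixed_space s \<in> arrangement W - \<A>0" if "s \<in> refls W" "s \<notin> W0" for s
    using that in_W0[OF that(1)] by (simp add: A0 arrangement_def)
  interpret embedding_setup W W0 b t r I X X0 x1 B \<epsilon> \<Omega> x2
  proof (intro embedding_setup.intro parabolic_setup.intro embedding_setup_axioms.intro)
    show "X = {x. \<forall>s\<in>refls W. b s x \<noteq> 0}"
      using ker by (auto simp: X arrangement_def)
    have "\<A>0 = fixed_space ` (refls W \<inter> W0)"
      using in_W0 by (auto simp: A0 arrangement_def)
    then show "X0 = {x. \<forall>s\<in>refls W \<inter> W0. b s x \<noteq> 0}"
      using ker by (auto simp: X0)
    show "b s x1 = 0 \<longleftrightarrow> s \<in> W0" if s: "s \<in> refls W" for s
    proof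
      assume "b s x1 = 0"
      then have "x1 \<in> fixed_space s" using ker[OF s] by blast
      then show "s \<in> W0" using x1(2)[OF outside[OF s]] by blast
    next
      assume "s \<in> W0"
      then show "b s x1 = 0" using in_W0[OF s] ker[OF s] x1(1) by blast
    qed
    show "\<Omega> \<inter> fixed_space s = {}" if "s \<in> refls W" "s \<notin> W0" for s
      by (rule Omega_avoids[OF outside[OF that]])
  qed (fact refl_group action forms integrable equivariant W0 x1(1) hermitian invariant \<epsilon> Omega x2)+
  show ?thesis
    unfolding \<omega> \<omega>0 by (rule restricted_monodromy[OF base_path base_path0])
qed

end
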